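(* Let $\Gamma$ be a finite simple undirected graph with vertex set $X$, let $G=G(\Gamma)$ be the partially commutative group with commutation graph $\Gamma$, and let $L=L(\Gamma)$ be the lattice of closed subsets of $X$. Then $$\operatorname{St}^{\operatorname{conj}}(L)=\operatorname{Conj}(G)\rtimes\operatorname{St}(L),$$ that is, $\operatorname{Conj}(G)$ is a normal subgroup of $\operatorname{St}^{\operatorname{conj}}(L)$, $\operatorname{St}(L)$ is a subgroup of $\operatorname{St}^{\operatorname{conj}}(L)$, $\operatorname{Conj}(G)\cap\operatorname{St}(L)=\{1\}$ and $\operatorname{St}^{\operatorname{conj}}(L)=\operatorname{Conj}(G)\operatorname{St}(L)$.
   Context: Graphs and closed sets. For $Y\subseteq X$ the orthogonal complement is $Y^\perp=\{u\in X : d(u,y)\le 1 \text{ for all } y\in Y\}$, where $d$ is the graph distance in $\Gamma$ (infinite if there is no path); $\emptyset^\perp=X$, and $x^\perp=\{x\}^\perp$ for $x\in X$. The closure is $\operatorname{cl}(Y)=Y^{\perp\perp}$. $Y$ is closed if $Y=\operatorname{cl}(Y)$. $L$ is the set of all closed subsets of $X$, ordered by inclusion. Groups. $G=G(\Gamma)$ is the group with generating set $X$ and defining relations $xy=yx$ for all pairs of adjacent vertices $x,y$ of $\Gamma$. For $Y\subseteq X$, $G(Y)$ is the subgroup of $G$ generated by $Y$. For $g,h\in G$, $h^g=g^{-1}hg$, and $G(Y)^g=g^{-1}G(Y)g$. Automorphisms act on the right, $g\mapsto g^\phi$. Stabilisers. $\operatorname{St}(L)=\{\phi\in\operatorname{Aut}(G):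 G(Y)^\phi=G(Y)\text{ for all }Y\in L\}$. The conjugate-stabiliser $\operatorname{St}^{\operatorname{conj}}(L)$ is the set of $\phi\in\operatorname{Aut}(G)$ such that for every $Y\in L$ there exists $g_Y\in G$ with $G(Y)^\phi=G(Y)^{g_Y}$. Conjugating automorphisms. For $x\in X$ let $\Gamma_{x^\perp}$ be the graph obtained from $\Gamma$ by deleting all vertices of $x^\perp$ and their incident edges. For a connected component $C$ of $\Gamma_{x^\perp}$, the elementary conjugating automorphism $\alpha_C(x)$ of $G$ is given by $y\mapsto y^x=x^{-1}yx$ if $y\in C$ and $y\mapsto y$ if $y\in X\setminus C$. $\operatorname{Conj}(G)$ is the subgroup of $\operatorname{Aut}(G)$ generated by all $\alpha_C(x)$, over all $x\in X$ and all connected components $C$ of $\Gamma_{x^\perp}$. *)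

theory Defs
  imports "Graph_Theory.Graph_Theory" "HOL-Algebra.Bij" "HOL-Algebra.Generated_Groups"
begin

section \<open>Distance, orthogonal complements and closed sets\<close>

text \<open>A finite simple undirected graph is a \<^locale>\<open>pair_graph\<close>: a finite vertex set
  with a symmetric, irreflexive set of pairs of vertices as arcs.\<close>

text \<open>Every arc has weight 1, so the infimum of the walk costs is the graph distance;
  it is infinite if there is no walk.\<close>

definition graph_dist :: "'a pair_pre_digraph \<Rightarrow> 'a \<Rightarrow> 'a \<Rightarrow> ereal" where
  "graph_dist \<Gamma> u v = wf_digraph.\<mu> (with_proj \<Gamma>) (\<lambda>_. 1) u v"

definition ortho :: "'a pair_pre_digraph \<Rightarrow> 'a set \<Rightarrow> 'a set" where
  "ortho \<Gamma> Y = {u \<in> pverts \<Gamma>. \<forall>y\<in>Y. graph_dist \<Gamma> u y \<le> 1}"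

definition graph_cl :: "'a pair_pre_digraph \<Rightarrow> 'a set \<Rightarrow> 'a set" where
  "graph_cl \<Gamma> Y = ortho \<Gamma> (ortho \<Gamma> Y)"

definition closed_sets :: "'a pair_pre_digraph \<Rightarrow> 'a set set" where
  "closed_sets \<Gamma> = {Y. Y \<subseteq> pverts \<Gamma> \<and> Y = graph_cl \<Gamma> Y}"

text \<open>Strong components are the connected components here, the graph being symmetric.\<close>

definition star_components :: "'a pair_pre_digraph \<Rightarrow> 'a \<Rightarrow> 'a set set" where
  "star_components \<Gamma> x =
     pre_digraph.sccs_verts (with_proj \<Gamma> \<restriction> (pverts \<Gamma> - ortho \<Gamma> {x}))"


section \<open>Groups given by generators and relations\<close>

text \<open>The letter \<open>(x, True)\<close> stands for the generator \<open>x\<close> and \<open>(x, False)\<close> for its inverse.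
  A pair \<open>(u, v)\<close> of words in \<open>R\<close> is the defining relation \<open>u = v\<close>.\<close>

type_synonym 'a word = "('a \<times> bool) list"

definition words :: "'a set \<Rightarrow> 'a word set" where
  "words X = lists (X \<times> UNIV)"

inductive_set pres_rel :: "'a set \<Rightarrow> ('a word \<times> 'a word) set \<Rightarrow> ('a word \<times> 'a word) set"
  for X :: "'a set" and R :: "('a word \<times> 'a word) set" where
  pres_refl: "w \<in> words X \<Longrightarrow> (w, w) \<in> pres_rel X R"
| pres_sym: "(u, v) \<in> pres_rel X R \<Longrightarrow> (v, u) \<in> pres_rel X R"
| pres_trans: "(u, v) \<in> pres_rel X R \<Longrightarrow> (v, w) \<in> pres_rel X R \<Longrightarrow> (u, w) \<in> pres_rel X R"
| pres_cong: "(u, u') \<in> pres_rel X R \<Longrightarrow> (v, v') \<in> pres_rel X R \<Longrightarrow> (u @ v, u' @ v') \<in> pres_rel X R"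
| pres_cancel: "x \<in> X \<Longrightarrow> ([(x, b), (x, \<not> b)], []) \<in> pres_rel X R"
| pres_relation: "(u, v) \<in> R \<Longrightarrow> u \<in> words X \<Longrightarrow> v \<in> words X \<Longrightarrow> (u, v) \<in> pres_rel X R"

definition presented_group :: "'a set \<Rightarrow> ('a word \<times> 'a word) set \<Rightarrow> 'a word set monoid" where
  "presented_group X R =
     \<lparr>carrier = words X // pres_rel X R,
      monoid.mult = \<lambda>A B. \<Union>u\<in>A. \<Union>v\<in>B. pres_rel X R `` {u @ v},
      one = pres_rel X R `` {[]}\<rparr>"

definition pres_gen :: "'a set \<Rightarrow> ('a word \<times> 'a word) set \<Rightarrow> 'a \<Rightarrow> 'a word set" where
  "pres_gen X R x = pres_rel X R `` {[(x, True)]}"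

definition commutation_relations :: "'a pair_pre_digraph \<Rightarrow> ('a word \<times> 'a word) set" where
  "commutation_relations \<Gamma> =
     {([(x, True), (y, True)], [(y, True), (x, True)]) | x y. (x, y) \<in> parcs \<Gamma>}"

definition pc_group :: "'a pair_pre_digraph \<Rightarrow> 'a word set monoid" where
  "pc_group \<Gamma> = presented_group (pverts \<Gamma>) (commutation_relations \<Gamma>)"

definition pc_gen :: "'a pair_pre_digraph \<Rightarrow> 'a \<Rightarrow> 'a word set" where
  "pc_gen \<Gamma> = pres_gen (pverts \<Gamma>) (commutation_relations \<Gamma>)"

definition pc_sub :: "'a pair_pre_digraph \<Rightarrow> 'a set \<Rightarrow> 'a word set set" where
  "pc_sub \<Gamma> Y = generate (pc_group \<Gamma>) (pc_gen \<Gamma> ` Y)"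


section \<open>Automorphisms\<close>

definition conj_by :: "('g, 'b) monoid_scheme \<Rightarrow> 'g \<Rightarrow> 'g \<Rightarrow> 'g" where
  "conj_by G h g = inv\<^bsub>G\<^esub> g \<otimes>\<^bsub>G\<^esub> h \<otimes>\<^bsub>G\<^esub> g"

text \<open>Automorphisms act on the right: the product of \<open>\<phi>\<close> and \<open>\<psi>\<close> is \<open>\<phi>\<close> followed by \<open>\<psi>\<close>.
  This is the opposite of the multiplication of \<^const>\<open>AutoGroup\<close>.\<close>

definition right_AutoGroup :: "('g, 'b) monoid_scheme \<Rightarrow> ('g \<Rightarrow> 'g) monoid" where
  "right_AutoGroup G = AutoGroup G \<lparr>monoid.mult := \<lambda>\<phi> \<psi>. \<psi> \<otimes>\<^bsub>AutoGroup G\<^esub> \<phi>\<rparr>"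

definition St :: "'a pair_pre_digraph \<Rightarrow> ('a word set \<Rightarrow> 'a word set) set" where
  "St \<Gamma> = {\<phi> \<in> auto (pc_group \<Gamma>). \<forall>Y\<in>closed_sets \<Gamma>. \<phi> ` pc_sub \<Gamma> Y = pc_sub \<Gamma> Y}"

definition St_conj :: "'a pair_pre_digraph \<Rightarrow> ('a word set \<Rightarrow> 'a word set) set" where
  "St_conj \<Gamma> = {\<phi> \<in> auto (pc_group \<Gamma>). \<forall>Y\<in>closed_sets \<Gamma>. \<exists>g\<in>carrier (pc_group \<Gamma>).
     \<phi> ` pc_sub \<Gamma> Y = (\<lambda>h. conj_by (pc_group \<Gamma>) h g) ` pc_sub \<Gamma> Y}"

text \<open>Existence and uniqueness of the automorphism described here, for a vertex \<open>x\<close> and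
  a component \<open>C\<close>, is lemma \<open>ex1_elem_conj\<close> below.\<close>

definition elem_conj :: "'a pair_pre_digraph \<Rightarrow> 'a set \<Rightarrow> 'a \<Rightarrow> ('a word set \<Rightarrow> 'a word set)" where
  "elem_conj \<Gamma> C x = (THE \<phi>. \<phi> \<in> auto (pc_group \<Gamma>) \<and>
     (\<forall>y\<in>pverts \<Gamma>. \<phi> (pc_gen \<Gamma> y) =
        (if y \<in> C then conj_by (pc_group \<Gamma>) (pc_gen \<Gamma> y) (pc_gen \<Gamma> x) else pc_gen \<Gamma> y)))"

definition Conj :: "'a pair_pre_digraph \<Rightarrow> ('a word set \<Rightarrow> 'a word set) set" where
  "Conj \<Gamma> = generate (right_AutoGroup (pc_group \<Gamma>))
     {elem_conj \<Gamma> C x | C x. x \<in> pverts \<Gamma> \<and> C \<in> star_components \<Gamma> x}"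


section \<open>Presented groups are groups, with the expected universal property\<close>

lemma words_simps [simp]:
  "[] \<in> words X"
  "a # w \<in> words X \<longleftrightarrow> fst a \<in> X \<and> w \<in> words X"
  "u @ v \<in> words X \<longleftrightarrow> u \<in> words X \<and> v \<in> words X"
  by (auto simp: words_def mem_Times_iff)

lemma pres_rel_words: "(u, v) \<in> pres_rel X R \<Longrightarrow> u \<in> words X \<and> v \<in> words X"
  by (induction rule: pres_rel.induct) auto

lemma equiv_pres_rel: "equiv (words X) (pres_rel X R)"
  unfolding equiv_def refl_on_def sym_def trans_def
  by (auto intro: pres_rel.intros dest: pres_rel_words)

lemma pres_class_eq_iff:
  assumes "u \<in> words X" "v \<in> words X"
  shows "pres_rel X R `` {u} = pres_rel X R `` {v} \<longleftrightarrow> (u, v) \<in> pres_rel X R"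
  using equiv_class_eq_iff[OF equiv_pres_rel] assms by blast

lemma pres_carrierE:
  assumes "A \<in> carrier (presented_group X R)"
  obtains u where "u \<in> words X" "A = pres_rel X R `` {u}"
  using assms by (auto simp: presented_group_def quotient_def)

lemma pres_class_carrier:
  "u \<in> words X \<Longrightarrow> pres_rel X R `` {u} \<in> carrier (presented_group X R)"
  by (auto simp: presented_group_def quotient_def)

lemma pres_one: "\<one>\<^bsub>presented_group X R\<^esub> = pres_rel X R `` {[]}"
  by (simp add: presented_group_def)

lemma pres_mult:
  assumes "u \<in> words X" "v \<in> words X"
  shows "pres_rel X R `` {u} \<otimes>\<^bsub>presented_group X R\<^esub> pres_rel X R `` {v} = pres_rel X R `` {u @ v}"
proof -
  let ?r = "pres_rel X R"
  have eq: "?r `` {u' @ v'} = ?r `` {u @ v}" if "u' \<in> ?r `` {u}" "v' \<in> ?r `` {v}" for u' v'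
  proof -
    have "(u' @ v', u @ v) \<in> ?r" using that by (intro pres_cong) (auto intro: pres_sym)
    then show ?thesis by (rule equiv_class_eq[OF equiv_pres_rel])
  qed
  have "u \<in> ?r `` {u}" "v \<in> ?r `` {v}"
    using assms by (auto intro: pres_refl)
  then have "(\<Union>u'\<in>?r `` {u}. \<Union>v'\<in>?r `` {v}. ?r `` {u' @ v'}) = ?r `` {u @ v}"
    using eq by (intro equalityI UN_least) blast+
  then show ?thesis by (simp add: presented_group_def)
qed

lemma pres_inverse_word:
  "w \<in> words X \<Longrightarrow> \<exists>w'\<in>words X. (w' @ w, []) \<in> pres_rel X R"
proof (induction w)
  case Nil
  show ?case by (rule bexI[of _ "[]"]) (auto intro: pres_rel.intros)
next
  case (Cons a w)
  then obtain w' where w': "w' \<in> words X" "(w' @ w, []) \<in> pres_rel X R" by auto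
  obtain x b where a: "a = (x, b)" by (cases a)
  have x: "x \<in> X" using Cons.prems a by auto
  have c: "([(x, \<not> b), (x, b)], []) \<in> pres_rel X R"
    using pres_cancel[OF x, of "\<not> b" R] by simp
  have "([(x, \<not> b), (x, b)] @ w, [] @ w) \<in> pres_rel X R"
    using c Cons.prems by (intro pres_cong pres_refl) auto
  then have "(w' @ [(x, \<not> b), (x, b)] @ w, w' @ [] @ w) \<in> pres_rel X R"
    using w' by (intro pres_cong[of w' w'] pres_refl) auto
  then have "((w' @ [(x, \<not> b)]) @ a # w, []) \<in> pres_rel X R"
    using w'(2) a by (auto intro: pres_trans)
  then show ?case using w'(1) x by (intro bexI[of _ "w' @ [(x, \<not> b)]"]) auto
qed

lemma group_presented_group: "group (presented_group X R)"
proof (rule groupI)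
  fix A B assume "A \<in> carrier (presented_group X R)" "B \<in> carrier (presented_group X R)"
  then show "A \<otimes>\<^bsub>presented_group X R\<^esub> B \<in> carrier (presented_group X R)"
    by (auto elim!: pres_carrierE simp: pres_mult pres_class_carrier)
next
  show "\<one>\<^bsub>presented_group X R\<^esub> \<in> carrier (presented_group X R)"
    by (simp add: pres_one pres_class_carrier)
next
  fix A B C
  assume "A \<in> carrier (presented_group X R)" "B \<in> carrier (presented_group X R)"
    "C \<in> carrier (presented_group X R)"
  then show "A \<otimes>\<^bsub>presented_group X R\<^esub> B \<otimes>\<^bsub>presented_group X R\<^esub> C
      = A \<otimes>\<^bsub>presented_group X R\<^esub> (B \<otimes>\<^bsub>presented_group X R\<^esub> C)"
    by (auto elim!: pres_carrierE simp: pres_mult)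
next
  fix A assume "A \<in> carrier (presented_group X R)"
  then show "\<one>\<^bsub>presented_group X R\<^esub> \<otimes>\<^bsub>presented_group X R\<^esub> A = A"
    by (auto elim!: pres_carrierE simp: pres_mult pres_one)
next
  fix A assume "A \<in> carrier (presented_group X R)"
  then obtain w where w: "w \<in> words X" "A = pres_rel X R `` {w}" by (rule pres_carrierE)
  obtain w' where w': "w' \<in> words X" "(w' @ w, []) \<in> pres_rel X R"
    using pres_inverse_word[OF w(1)] by blast
  then show "\<exists>B\<in>carrier (presented_group X R). B \<otimes>\<^bsub>presented_group X R\<^esub> A = \<one>\<^bsub>presented_group X R\<^esub>"
    using w by (intro bexI[of _ "pres_rel X R `` {w'}"])
      (auto simp: pres_mult pres_one pres_class_carrier pres_class_eq_iff)
qed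

lemma pres_gen_carrier: "x \<in> X \<Longrightarrow> pres_gen X R x \<in> carrier (presented_group X R)"
  by (simp add: pres_gen_def pres_class_carrier)

lemma pres_gen_inv:
  assumes "x \<in> X"
  shows "inv\<^bsub>presented_group X R\<^esub> pres_gen X R x = pres_rel X R `` {[(x, False)]}"
proof (rule group.inv_equality[OF group_presented_group])
  show "pres_rel X R `` {[(x, False)]} \<otimes>\<^bsub>presented_group X R\<^esub> pres_gen X R x
      = \<one>\<^bsub>presented_group X R\<^esub>"
    using assms pres_cancel[OF assms, of False R]
    by (simp add: pres_gen_def pres_mult pres_one pres_class_eq_iff)
qed (use assms in \<open>auto simp: pres_gen_def pres_class_carrier\<close>)

primrec eval_word :: "('g, 'b) monoid_scheme \<Rightarrow> ('a \<Rightarrow> 'g) \<Rightarrow> 'a word \<Rightarrow> 'g" where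
  "eval_word H f [] = \<one>\<^bsub>H\<^esub>"
| "eval_word H f (a # w) =
     (if snd a then f (fst a) else inv\<^bsub>H\<^esub> f (fst a)) \<otimes>\<^bsub>H\<^esub> eval_word H f w"

context group
begin

lemma eval_word_closed:
  assumes "f \<in> X \<rightarrow> carrier G" "w \<in> words X"
  shows "eval_word G f w \<in> carrier G"
  using assms(2) by (induction w) (use assms(1) in auto)

lemma eval_word_append:
  assumes "f \<in> X \<rightarrow> carrier G" "u \<in> words X" "v \<in> words X"
  shows "eval_word G f (u @ v) = eval_word G f u \<otimes> eval_word G f v"
  using assms(2)
proof (induction u)
  case Nil
  then show ?case using eval_word_closed[OF assms(1,3)] by simp
next
  case (Cons a u)
  then have "f (fst a) \<in> carrier G" using assms(1) by auto
  then show ?case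
    using Cons eval_word_closed[OF assms(1,3)] eval_word_closed[OF assms(1), of u]
    by (auto simp: m_assoc)
qed

lemma eval_word_pres_rel:
  assumes f: "f \<in> X \<rightarrow> carrier G"
    and R: "\<And>u v. (u, v) \<in> R \<Longrightarrow> u \<in> words X \<Longrightarrow> v \<in> words X \<Longrightarrow> eval_word G f u = eval_word G f v"
    and "(u, v) \<in> pres_rel X R"
  shows "eval_word G f u = eval_word G f v"
  using assms(3)
proof induction
  case (pres_cong u u' v v')
  then show ?case using pres_rel_words eval_word_append[OF f] by metis
next
  case (pres_cancel x b)
  then have "f x \<in> carrier G" using f by auto
  then show ?case by (cases b) auto
qed (use R in auto)

lemma pres_hom_exists:
  assumes f: "f \<in> X \<rightarrow> carrier G"
    and R: "\<And>u v. (u, v) \<in> R \<Longrightarrow> u \<in> words X \<Longrightarrow> v \<in> words X \<Longrightarrow> eval_word G f u = eval_word G f v"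
  shows "\<exists>h\<in>hom (presented_group X R) G \<inter> extensional (carrier (presented_group X R)).
           \<forall>x\<in>X. h (pres_gen X R x) = f x"
proof -
  define P where "P = presented_group X R"
  define h where "h = restrict (\<lambda>A. eval_word G f (SOME w. w \<in> A)) (carrier P)"
  have h: "h (pres_rel X R `` {w}) = eval_word G f w" if w: "w \<in> words X" for w
  proof -
    have "(w, SOME v. v \<in> pres_rel X R `` {w}) \<in> pres_rel X R"
      using someI[of "\<lambda>v. v \<in> pres_rel X R `` {w}" w] pres_refl[OF w] by auto
    then have "eval_word G f w = eval_word G f (SOME v. v \<in> pres_rel X R `` {w})"
      using f R by - (rule eval_word_pres_rel[of f X R], blast+)
    then show ?thesis using w by (simp add: h_def P_def pres_class_carrier)
  qed
  have "h \<in> hom P G"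
  proof (rule homI)
    fix A assume "A \<in> carrier P"
    then obtain u where "u \<in> words X" "A = pres_rel X R `` {u}"
      unfolding P_def by (rule pres_carrierE)
    then show "h A \<in> carrier G"
      using h eval_word_closed[OF f] by metis
  next
    fix A B assume A: "A \<in> carrier P" and B: "B \<in> carrier P"
    obtain u where u: "u \<in> words X" "A = pres_rel X R `` {u}"
      using A unfolding P_def by (rule pres_carrierE)
    obtain v where v: "v \<in> words X" "B = pres_rel X R `` {v}"
      using B unfolding P_def by (rule pres_carrierE)
    have "h (A \<otimes>\<^bsub>P\<^esub> B) = h (pres_rel X R `` {u @ v})"
      using u v by (simp only: P_def pres_mult)
    also have "\<dots> = eval_word G f (u @ v)" using u v by (intro h) simp
    also have "\<dots> = h A \<otimes> h B"
      using eval_word_append[OF f u(1) v(1)] h[OF u(1)] h[OF v(1)] by (simp only: u(2) v(2))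
    finally show "h (A \<otimes>\<^bsub>P\<^esub> B) = h A \<otimes> h B" .
  qed
  moreover have "h (pres_gen X R x) = f x" if "x \<in> X" for x
  proof -
    have "f x \<in> carrier G" using f that by auto
    moreover have "h (pres_gen X R x) = eval_word G f [(x, True)]"
      unfolding pres_gen_def by (rule h) (use that in simp)
    ultimately show ?thesis by simp
  qed
  moreover have "h \<in> extensional (carrier P)" by (simp add: h_def)
  ultimately show ?thesis unfolding P_def by blast
qed

end

lemma pres_hom_eq:
  assumes "group H" "h \<in> hom (presented_group X R) H" "k \<in> hom (presented_group X R) H"
    and gens: "\<And>x. x \<in> X \<Longrightarrow> h (pres_gen X R x) = k (pres_gen X R x)"
    and "A \<in> carrier (presented_group X R)"
  shows "h A = k A"
proof -
  let ?P = "presented_group X R"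
  interpret h: group_hom ?P H h
    by (intro group_hom.intro group_hom_axioms.intro group_presented_group assms)
  interpret k: group_hom ?P H k
    by (intro group_hom.intro group_hom_axioms.intro group_presented_group assms)
  have "h (pres_rel X R `` {w}) = k (pres_rel X R `` {w})" if "w \<in> words X" for w
    using that
  proof (induction w)
    case Nil
    then show ?case by (metis h.hom_one k.hom_one pres_one)
  next
    case (Cons a w)
    obtain x b where a: "a = (x, b)" by (cases a)
    have x: "x \<in> X" using Cons.prems a by auto
    have 1: "h (pres_rel X R `` {[a]}) = k (pres_rel X R `` {[a]})"
    proof (cases b)
      case True
      then show ?thesis using gens[OF x] a by (simp add: pres_gen_def)
    next
      case False
      then show ?thesis
        using pres_gen_inv[OF x, of R, symmetric] a gens[OF x]
          h.hom_inv[OF pres_gen_carrier[OF x]] k.hom_inv[OF pres_gen_carrier[OF x]] by simp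
    qed
    have "pres_rel X R `` {a # w} = pres_rel X R `` {[a]} \<otimes>\<^bsub>?P\<^esub> pres_rel X R `` {w}"
      using Cons.prems by (simp add: pres_mult)
    then show ?case
      using 1 Cons by (simp add: pres_class_carrier)
  qed
  then show ?thesis using assms(5) by (auto elim: pres_carrierE)
qed


section \<open>Elementary conjugating automorphisms are well defined\<close>

lemma graph_dist_le_1_iff:
  assumes "pair_graph \<Gamma>" "u \<in> pverts \<Gamma>" "v \<in> pverts \<Gamma>"
  shows "graph_dist \<Gamma> u v \<le> 1 \<longleftrightarrow> u = v \<or> (u, v) \<in> parcs \<Gamma>"
proof -
  interpret pair_graph \<Gamma> by fact
  have cost: "awalk_cost (\<lambda>_. 1) p = real (length p)" for p
    by (induction p) auto
  have d: "graph_dist \<Gamma> u v = (INF p\<in>{p. awalk u p v}. ereal (real (length p)))"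
    unfolding graph_dist_def \<mu>_def cost ..
  show ?thesis
  proof
    assume le: "graph_dist \<Gamma> u v \<le> 1"
    show "u = v \<or> (u, v) \<in> parcs \<Gamma>"
    proof (rule ccontr)
      assume *: "\<not> (u = v \<or> (u, v) \<in> parcs \<Gamma>)"
      have "2 \<le> length p" if "awalk u p v" for p
      proof (cases p)
        case Nil
        then show ?thesis using that * by (simp add: awalk_Nil_iff)
      next
        case (Cons a q)
        then show ?thesis
          using that * by (cases q) (auto simp: awalk_def)
      qed
      then have "2 \<le> graph_dist \<Gamma> u v"
        unfolding d by (intro INF_greatest) auto
      then have "(2::ereal) \<le> 1" using le by (rule order_trans)
      then show False by simp
    qed
  next
    assume "u = v \<or> (u, v) \<in> parcs \<Gamma>"
    then have "\<exists>p. awalk u p v \<and> length p \<le> 1"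
    proof
      assume "u = v"
      then show ?thesis using assms by (intro exI[of _ "[]"]) (auto simp: awalk_Nil_iff)
    next
      assume "(u, v) \<in> parcs \<Gamma>"
      then show ?thesis using assms by (intro exI[of _ "[(u, v)]"]) (auto simp: awalk_def)
    qed
    then obtain p where "awalk u p v" "length p \<le> 1" by blast
    then show "graph_dist \<Gamma> u v \<le> 1"
      unfolding d by (intro INF_lower2[of p]) auto
  qed
qed

lemma ortho_singleton:
  assumes "pair_graph \<Gamma>" "x \<in> pverts \<Gamma>"
  shows "ortho \<Gamma> {x} = {u \<in> pverts \<Gamma>. u = x \<or> (u, x) \<in> parcs \<Gamma>}"
  using assms by (auto simp: ortho_def graph_dist_le_1_iff)

lemma star_component_adjacent:
  assumes "pair_graph \<Gamma>" "x \<in> pverts \<Gamma>" "C \<in> star_components \<Gamma> x"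
    and yC: "y \<in> C" and yz: "(y, z) \<in> parcs \<Gamma>"
  shows "z \<in> C \<or> z \<in> ortho \<Gamma> {x}"
proof (rule ccontr)
  assume *: "\<not> (z \<in> C \<or> z \<in> ortho \<Gamma> {x})"
  interpret pair_graph \<Gamma> by fact
  define H where "H = with_proj \<Gamma> \<restriction> (pverts \<Gamma> - ortho \<Gamma> {x})"
  interpret H: wf_digraph H
    unfolding H_def by (rule wellformed_induce_subgraph)
  have C: "C \<in> H.sccs_verts" using assms by (simp add: star_components_def H_def)
  have y: "y \<in> verts H" using C yC H.sccs_verts_subsets by blast
  have z: "z \<in> verts H" using * yz by (auto simp: H_def in_arcsD2)
  have zy: "(z, y) \<in> parcs \<Gamma>" using yz graph_symmetric by auto
  have "y \<rightarrow>\<^bsub>H\<^esub> z" "z \<rightarrow>\<^bsub>H\<^esub> y"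
    using y z yz zy by (auto simp: H_def arcs_ends_conv image_iff)
  then have "y \<rightarrow>\<^sup>*\<^bsub>H\<^esub> z" "z \<rightarrow>\<^sup>*\<^bsub>H\<^esub> y" by auto
  then show False using C yC * by (auto simp: H.sccs_verts_def)
qed

lemma star_component_subset:
  assumes "pair_graph \<Gamma>" "C \<in> star_components \<Gamma> x"
  shows "C \<subseteq> pverts \<Gamma> - ortho \<Gamma> {x}"
proof -
  interpret pair_graph \<Gamma> by fact
  interpret H: wf_digraph "with_proj \<Gamma> \<restriction> (pverts \<Gamma> - ortho \<Gamma> {x})"
    by (rule wellformed_induce_subgraph)
  show ?thesis using assms(2) H.sccs_verts_subsets by (auto simp: star_components_def)
qed

lemma group_pc_group: "group (pc_group \<Gamma>)"
  by (simp add: pc_group_def group_presented_group)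

lemma pc_gen_carrier: "x \<in> pverts \<Gamma> \<Longrightarrow> pc_gen \<Gamma> x \<in> carrier (pc_group \<Gamma>)"
  by (simp add: pc_group_def pc_gen_def pres_gen_carrier)

lemma pc_gen_commute:
  assumes "(x, y) \<in> parcs \<Gamma>" "x \<in> pverts \<Gamma>" "y \<in> pverts \<Gamma>"
  shows "pc_gen \<Gamma> x \<otimes>\<^bsub>pc_group \<Gamma>\<^esub> pc_gen \<Gamma> y = pc_gen \<Gamma> y \<otimes>\<^bsub>pc_group \<Gamma>\<^esub> pc_gen \<Gamma> x"
  using assms
  by (auto simp: pc_group_def pc_gen_def pres_gen_def pres_mult pres_class_eq_iff
      commutation_relations_def intro!: pres_relation)

lemma pc_hom_exists:
  assumes "group H" "f \<in> pverts \<Gamma> \<rightarrow> carrier H"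
    and "\<And>x y. (x, y) \<in> parcs \<Gamma> \<Longrightarrow> x \<in> pverts \<Gamma> \<Longrightarrow> y \<in> pverts \<Gamma>
      \<Longrightarrow> f x \<otimes>\<^bsub>H\<^esub> f y = f y \<otimes>\<^bsub>H\<^esub> f x"
  obtains h where "h \<in> hom (pc_group \<Gamma>) H" "h \<in> extensional (carrier (pc_group \<Gamma>))"
    "\<And>x. x \<in> pverts \<Gamma> \<Longrightarrow> h (pc_gen \<Gamma> x) = f x"
proof -
  interpret H: group H by fact
  have "eval_word H f u = eval_word H f v"
    if "(u, v) \<in> commutation_relations \<Gamma>" "u \<in> words (pverts \<Gamma>)" for u v
    using that assms(2,3) by (auto simp: commutation_relations_def Pi_iff)
  then have "\<exists>h\<in>hom (pc_group \<Gamma>) H \<inter> extensional (carrier (pc_group \<Gamma>)).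
      \<forall>x\<in>pverts \<Gamma>. h (pc_gen \<Gamma> x) = f x"
    unfolding pc_group_def pc_gen_def by (intro H.pres_hom_exists assms(2)) auto
  then show ?thesis using that by blast
qed

lemma pc_hom_eq:
  assumes "group H" "h \<in> hom (pc_group \<Gamma>) H" "k \<in> hom (pc_group \<Gamma>) H"
    and "\<And>x. x \<in> pverts \<Gamma> \<Longrightarrow> h (pc_gen \<Gamma> x) = k (pc_gen \<Gamma> x)"
    and "A \<in> carrier (pc_group \<Gamma>)"
  shows "h A = k A"
  using assms unfolding pc_group_def pc_gen_def by (rule pres_hom_eq)

lemma (in group) conj_by_simps:
  assumes "g \<in> carrier G"
  shows "h \<in> carrier G \<Longrightarrow> conj_by G h g \<in> carrier G"
    and "h \<in> carrier G \<Longrightarrow> k \<in> carrier G \<Longrightarrow> conj_by G h g \<otimes> conj_by G k g = conj_by G (h \<otimes> k) g"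
    and "h \<in> carrier G \<Longrightarrow> conj_by G (conj_by G h g) (inv g) = h"
    and "h \<in> carrier G \<Longrightarrow> conj_by G (conj_by G h (inv g)) g = h"
    and "h \<in> carrier G \<Longrightarrow> g \<otimes> h = h \<otimes> g \<Longrightarrow> conj_by G h g = h"
    and "h \<in> carrier G \<Longrightarrow> g \<otimes> h = h \<otimes> g \<Longrightarrow> conj_by G h (inv g) = h"
proof -
  show closed: "conj_by G h g \<in> carrier G" if "h \<in> carrier G" for h
    using assms that by (simp add: conj_by_def)
  show "conj_by G h g \<otimes> conj_by G k g = conj_by G (h \<otimes> k) g" if "h \<in> carrier G" "k \<in> carrier G"
    using assms that by (simp add: conj_by_def m_assoc) (simp add: m_assoc[symmetric])
  show "conj_by G (conj_by G h g) (inv g) = h" if "h \<in> carrier G"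
    using assms that by (simp add: conj_by_def m_assoc) (simp add: m_assoc[symmetric])
  show "conj_by G (conj_by G h (inv g)) g = h" if "h \<in> carrier G"
    using assms that by (simp add: conj_by_def m_assoc) (simp add: m_assoc[symmetric])
  show "conj_by G h g = h" if h: "h \<in> carrier G" and gh: "g \<otimes> h = h \<otimes> g"
  proof -
    have "conj_by G h g = inv g \<otimes> (g \<otimes> h)"
      unfolding gh using assms h by (simp add: conj_by_def m_assoc)
    also have "\<dots> = h" using assms h by (simp add: m_assoc[symmetric])
    finally show ?thesis .
  qed
  show "conj_by G h (inv g) = h" if h: "h \<in> carrier G" and gh: "g \<otimes> h = h \<otimes> g"
  proof -
    have "conj_by G h (inv g) = h \<otimes> g \<otimes> inv g"
      unfolding gh[symmetric] using assms h by (simp add: conj_by_def)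
    also have "\<dots> = h" using assms h by (simp add: m_assoc)
    finally show ?thesis .
  qed
qed

lemma ex1_elem_conj:
  assumes \<Gamma>: "pair_graph \<Gamma>" and x: "x \<in> pverts \<Gamma>" and C: "C \<in> star_components \<Gamma> x"
  shows "\<exists>!\<phi>. \<phi> \<in> auto (pc_group \<Gamma>) \<and> (\<forall>y\<in>pverts \<Gamma>. \<phi> (pc_gen \<Gamma> y) =
    (if y \<in> C then conj_by (pc_group \<Gamma>) (pc_gen \<Gamma> y) (pc_gen \<Gamma> x) else pc_gen \<Gamma> y))"
proof -
  interpret pair_graph \<Gamma> by fact
  define P where "P = pc_group \<Gamma>"
  define e where "e = pc_gen \<Gamma>"
  interpret P: group P unfolding P_def by (rule group_pc_group)
  have e: "e y \<in> carrier P" if "y \<in> pverts \<Gamma>" for y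
    using that pc_gen_carrier by (simp add: P_def e_def)
  have comm: "e y \<otimes>\<^bsub>P\<^esub> e z = e z \<otimes>\<^bsub>P\<^esub> e y" if "(y, z) \<in> parcs \<Gamma>" for y z
    using that pc_gen_commute in_arcsD1 in_arcsD2 by (metis P_def e_def)
  have sym: "(z, y) \<in> parcs \<Gamma>" if "(y, z) \<in> parcs \<Gamma>" for y z
    using that graph_symmetric by auto
  have CX: "C \<subseteq> pverts \<Gamma> - ortho \<Gamma> {x}" by (rule star_component_subset[OF \<Gamma> C])
  have xC: "x \<notin> C" using CX x ortho_singleton[OF \<Gamma> x] by auto
  have boundary: "e x \<otimes>\<^bsub>P\<^esub> e z = e z \<otimes>\<^bsub>P\<^esub> e x"
    if "y \<in> C" "(y, z) \<in> parcs \<Gamma>" "z \<notin> C" for y z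
    using star_component_adjacent[OF \<Gamma> x C that(1,2)] that ortho_singleton[OF \<Gamma> x] comm[of z x]
    by auto
  have ex: "\<exists>h. h \<in> hom P P \<and> h \<in> extensional (carrier P)
      \<and> (\<forall>y\<in>pverts \<Gamma>. h (e y) = (if y \<in> C then conj_by P (e y) g else e y))"
    if g: "g = e x \<or> g = inv\<^bsub>P\<^esub> e x" for g
  proof -
    have gP: "g \<in> carrier P" using g e[OF x] by auto
    define f where "f = (\<lambda>y. if y \<in> C then conj_by P (e y) g else e y)"
    have f: "f \<in> pverts \<Gamma> \<rightarrow> carrier P"
      using gP e by (auto simp: f_def P.conj_by_simps)
    have half: "f y \<otimes>\<^bsub>P\<^esub> f z = f z \<otimes>\<^bsub>P\<^esub> f y"
      if "(y, z) \<in> parcs \<Gamma>" "y \<in> C" "y \<in> pverts \<Gamma>" "z \<in> pverts \<Gamma>" for y z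
    proof -
      have "f z = conj_by P (e z) g"
        using g boundary[OF that(2,1)] e[OF x] e[OF that(4)]
        by (auto simp: f_def P.conj_by_simps(5,6))
      then show ?thesis
        using that gP e comm[OF that(1)] by (simp add: f_def P.conj_by_simps)
    qed
    have "f y \<otimes>\<^bsub>P\<^esub> f z = f z \<otimes>\<^bsub>P\<^esub> f y"
      if "(y, z) \<in> parcs \<Gamma>" "y \<in> pverts \<Gamma>" "z \<in> pverts \<Gamma>" for y z
    proof (cases "y \<in> C \<or> z \<in> C")
      case True
      then show ?thesis using half[of y z] half[of z y] that sym by metis
    next
      case False
      then show ?thesis using comm[OF that(1)] by (simp add: f_def)
    qed
    then obtain h where "h \<in> hom P P" "h \<in> extensional (carrier P)"
      "\<And>y. y \<in> pverts \<Gamma> \<Longrightarrow> h (e y) = f y"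
      using pc_hom_exists[of P f \<Gamma>] f P.is_group unfolding P_def e_def by blast
    then show ?thesis by (auto simp: f_def)
  qed
  obtain h where h: "h \<in> hom P P" "h \<in> extensional (carrier P)"
    "\<And>y. y \<in> pverts \<Gamma> \<Longrightarrow> h (e y) = (if y \<in> C then conj_by P (e y) (e x) else e y)"
    using ex[OF disjI1[OF refl]] by blast
  obtain k where k: "k \<in> hom P P" "k \<in> extensional (carrier P)"
    "\<And>y. y \<in> pverts \<Gamma> \<Longrightarrow> k (e y) = (if y \<in> C then conj_by P (e y) (inv\<^bsub>P\<^esub> e x) else e y)"
    using ex[OF disjI2[OF refl]] by blast
  interpret h: group_hom P P h by unfold_locales (rule h)
  interpret k: group_hom P P k by unfold_locales (rule k)
  have hc: "h (conj_by P a b) = conj_by P (h a) (h b)" if "a \<in> carrier P" "b \<in> carrier P" for a b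
    using that by (simp add: conj_by_def)
  have kc: "k (conj_by P a b) = conj_by P (k a) (k b)" if "a \<in> carrier P" "b \<in> carrier P" for a b
    using that by (simp add: conj_by_def)
  have hx: "h (e x) = e x" and kx: "k (e x) = e x" using h k x xC by auto
  have id: "(\<lambda>a. a) \<in> hom P P" by (auto simp: hom_def)
  have kh: "k (h a) = a" if "a \<in> carrier P" for a
  proof -
    have "(k \<circ> h) a = (\<lambda>a. a) a"
    proof (rule pc_hom_eq[of P _ \<Gamma>, folded P_def e_def, OF P.is_group _ id _ that])
      show "k \<circ> h \<in> hom P P" using h(1) k(1) by (rule hom_compose)
      fix y assume y: "y \<in> pverts \<Gamma>"
      show "(k \<circ> h) (e y) = e y"
        using e[OF x] e[OF y] h(3)[OF y] k(3)[OF y] by (simp add: kc kx P.conj_by_simps)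
    qed
    then show ?thesis by simp
  qed
  have hk: "h (k a) = a" if "a \<in> carrier P" for a
  proof -
    have "(h \<circ> k) a = (\<lambda>a. a) a"
    proof (rule pc_hom_eq[of P _ \<Gamma>, folded P_def e_def, OF P.is_group _ id _ that])
      show "h \<circ> k \<in> hom P P" using k(1) h(1) by (rule hom_compose)
      fix y assume y: "y \<in> pverts \<Gamma>"
      show "(h \<circ> k) (e y) = e y"
        using e[OF x] e[OF y] h(3)[OF y] k(3)[OF y] by (simp add: hc hx P.conj_by_simps)
    qed
    then show ?thesis by simp
  qed
  have "bij_betw h (carrier P) (carrier P)"
    by (rule bij_betwI[where g = k]) (auto simp: kh hk)
  then have "h \<in> auto P" using h by (simp add: auto_def Bij_def)
  moreover have "h' = h" if h': "h' \<in> auto P"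
    "\<forall>y\<in>pverts \<Gamma>. h' (e y) = (if y \<in> C then conj_by P (e y) (e x) else e y)" for h'
  proof (rule extensionalityI[of _ "carrier P"])
    show "h' \<in> extensional (carrier P)" "h \<in> extensional (carrier P)"
      using h' h by (auto simp: auto_def Bij_def)
    fix a assume "a \<in> carrier P"
    then show "h' a = h a"
      by (rule pc_hom_eq[of P _ \<Gamma>, folded P_def e_def, OF P.is_group, rotated 3])
        (use h h' in \<open>auto simp: auto_def\<close>)
  qed
  ultimately show ?thesis
    using h(3) unfolding P_def e_def by (intro ex1I[of _ h]) blast+
qed

end

theory Submission
  imports Defs "HOL-Algebra.Elementary_Groups"
begin

text \<open>Write \<open>IA\<close> for the automorphisms acting trivially on the abelianisation of \<open>G\<close>. The closure of
  a clique is a clique, and on \<open>G(Y)\<close> with \<open>Y\<close> a clique an element is determined by its exponents.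
  Hence \<open>St \<inter> IA\<close> is trivial, because \<open>\<phi>\<close> in \<open>St\<close> maps \<open>x\<close> into \<open>G(cl x)\<close>, and an element of
  \<open>St_conj \<inter> IA\<close> maps adjacent generators to conjugates by a common element. By Laurence's theorem
  such automorphisms lie in \<open>Conj\<close>, so \<open>Conj = St_conj \<inter> IA\<close>, which makes normality evident.
  Undoing the conjugation separately on every \<open>G(cl x)\<close> turns \<open>\<phi>\<close> in \<open>St_conj\<close> into an element of
  \<open>St\<close> with the same action on the abelianisation.

  For Laurence's theorem let \<open>\<phi> x = v\<^sub>x x v\<^sub>x\<^sup>-\<^sup>1\<close> with \<open>v\<^sub>x\<close> shortest. If no \<open>v\<^sub>y\<close> has a reduced prefix
  \<open>v\<^sub>x x\<^sup>\<plusminus>\<^sup>1\<close>, a ping-pong argument shows that \<open>\<phi> u\<close> has the prefix \<open>v\<^sub>x x\<^sup>\<plusminus>\<^sup>1\<close> exactly when \<open>x\<^sup>\<plusminus>\<^sup>1\<close>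
  is a first letter of \<open>u\<close>; as \<open>\<phi>\<close> is onto, all \<open>v\<^sub>x\<close> are trivial. Otherwise the prefix is shared by
  all \<open>v\<^sub>z\<close> with \<open>z\<close> in the component of \<open>y\<close> outside \<open>x\<^sup>\<bottom>\<close>, and composing with an elementary
  conjugating automorphism shortens them all.\<close>

section \<open>Normal forms\<close>

definition flip :: "'a \<times> bool \<Rightarrow> 'a \<times> bool" where
  "flip a = (fst a, \<not> snd a)"

lemma flip_simps [simp]: "fst (flip a) = fst a" "flip (flip a) = a" "flip a \<noteq> a" "a \<noteq> flip a"
  by (auto simp: flip_def prod_eq_iff)

locale raag =
  fixes \<Gamma> :: "'a pair_pre_digraph"
  assumes pair_graph: "pair_graph \<Gamma>"
begin

interpretation pair_graph \<Gamma> by (rule pair_graph)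

abbreviation X where "X \<equiv> pverts \<Gamma>"
abbreviation adj where "adj x y \<equiv> (x, y) \<in> parcs \<Gamma>"
abbreviation P where "P \<equiv> pc_group \<Gamma>"
abbreviation gen where "gen \<equiv> pc_gen \<Gamma>"
abbreviation sub where "sub \<equiv> pc_sub \<Gamma>"

lemma adj_sym: "adj x y \<Longrightarrow> adj y x"
  using graph_symmetric by auto

lemma adj_irrefl: "\<not> adj x x"
  using no_loops by fastforce

lemma adj_X: "adj x y \<Longrightarrow> x \<in> X" "adj x y \<Longrightarrow> y \<in> X"
  using in_arcsD1 in_arcsD2 by auto

lemma finite_X [simp]: "finite X"
  by (rule finite_verts)

text \<open>A word is represented by its projections to all pairs of non-adjacent vertices \<open>u\<close>, \<open>v\<close>
  (where \<open>u = v\<close> is allowed). Words that differ by swapping adjacent letters have the same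
  projections, so no quotient has to be formed.\<close>

definition touches :: "'a \<times> bool \<Rightarrow> 'a \<Rightarrow> 'a \<Rightarrow> bool" where
  "touches a u v \<longleftrightarrow> \<not> adj u v \<and> (u = fst a \<or> v = fst a)"

definition prep :: "'a \<times> bool \<Rightarrow> ('a \<Rightarrow> 'a \<Rightarrow> 'a word) \<Rightarrow> 'a \<Rightarrow> 'a \<Rightarrow> 'a word" where
  "prep a F = (\<lambda>u v. if touches a u v then a # F u v else F u v)"

definition rem :: "'a \<times> bool \<Rightarrow> ('a \<Rightarrow> 'a \<Rightarrow> 'a word) \<Rightarrow> 'a \<Rightarrow> 'a \<Rightarrow> 'a word" where
  "rem a F = (\<lambda>u v. if touches a u v then tl (F u v) else F u v)"

text \<open>A letter can be shuffled to the front of a word exactly when it heads every projection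
  that records it.\<close>

definition avail :: "'a \<times> bool \<Rightarrow> ('a \<Rightarrow> 'a \<Rightarrow> 'a word) \<Rightarrow> bool" where
  "avail a F \<longleftrightarrow> (\<forall>u v. touches a u v \<longrightarrow> (\<exists>r. F u v = a # r))"

text \<open>Left multiplication by a letter: it cancels against its inverse if that can be brought
  to the front, and is prepended otherwise.\<close>

definition act :: "'a \<times> bool \<Rightarrow> ('a \<Rightarrow> 'a \<Rightarrow> 'a word) \<Rightarrow> 'a \<Rightarrow> 'a \<Rightarrow> 'a word" where
  "act a F = (if avail (flip a) F then rem (flip a) F else prep a F)"

text \<open>Not every family of lists consists of the projections of one word. This predicate
  singles out the families that come from reduced words.\<close>

inductive red :: "('a \<Rightarrow> 'a \<Rightarrow> 'a word) \<Rightarrow> bool" where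
  red_Nil: "red (\<lambda>_ _. [])"
| red_prep: "red F \<Longrightarrow> fst a \<in> X \<Longrightarrow> \<not> avail (flip a) F \<Longrightarrow> red (prep a F)"

definition nf :: "'a word \<Rightarrow> 'a \<Rightarrow> 'a \<Rightarrow> 'a word" where
  "nf w = foldr act w (\<lambda>_ _. [])"

text \<open>The projection to the pair \<open>x\<close>, \<open>x\<close> keeps exactly the letters
  at \<open>x\<close>, so the diagonal counts each letter of the word once.\<close>

definition fsize :: "('a \<Rightarrow> 'a \<Rightarrow> 'a word) \<Rightarrow> nat" where
  "fsize F = (\<Sum>x\<in>X. length (F x x))"

lemma touches_flip [simp]: "touches (flip a) = touches a"
  by (auto simp: touches_def fun_eq_iff)

lemma touches_self [simp]: "touches a (fst a) (fst a)"
  by (simp add: touches_def adj_irrefl)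

lemma touches_disjoint: "adj (fst a) (fst c) \<Longrightarrow> touches a u v \<Longrightarrow> \<not> touches c u v"
  using adj_sym adj_irrefl by (auto simp: touches_def)

lemma avail_prep_self [simp]: "avail a (prep a F)"
  by (simp add: avail_def prep_def)

lemma rem_prep [simp]: "rem a (prep a F) = F"
  by (auto simp: rem_def prep_def fun_eq_iff)

lemma prep_rem: "avail a F \<Longrightarrow> prep a (rem a F) = F"
  by (fastforce simp: rem_def prep_def avail_def fun_eq_iff)

text \<open>Letters at equal or non-adjacent vertices are both recorded in the projection to that
  pair, and a list has only one head.\<close>

lemma avail_unique:
  assumes "avail a F" "avail c F" "a \<noteq> c"
  shows "adj (fst a) (fst c)"
proof (rule ccontr)
  assume "\<not> adj (fst a) (fst c)"
  then have "touches a (fst a) (fst c)" "touches c (fst a) (fst c)"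
    by (auto simp: touches_def)
  then show False using assms unfolding avail_def by (metis list.inject)
qed

lemma avail_prep_iff: "adj (fst a) (fst c) \<Longrightarrow> avail a (prep c F) \<longleftrightarrow> avail a F"
  using touches_disjoint by (auto simp: avail_def prep_def)

lemma avail_rem_iff: "adj (fst a) (fst c) \<Longrightarrow> avail a (rem c F) \<longleftrightarrow> avail a F"
  using touches_disjoint by (auto simp: avail_def rem_def)

lemma avail_prep_other:
  assumes "avail a (prep c F)" "a \<noteq> c"
  shows "adj (fst a) (fst c)" "avail a F"
  using avail_unique[OF assms(1) avail_prep_self assms(2)] avail_prep_iff assms by blast+

lemma prep_prep: "adj (fst a) (fst c) \<Longrightarrow> prep a (prep c F) = prep c (prep a F)"
  using touches_disjoint by (auto simp: prep_def fun_eq_iff)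

lemma rem_prep_commute: "adj (fst a) (fst c) \<Longrightarrow> rem a (prep c F) = prep c (rem a F)"
  using touches_disjoint by (auto simp: prep_def rem_def fun_eq_iff)

lemma rem_rem: "adj (fst a) (fst c) \<Longrightarrow> rem a (rem c F) = rem c (rem a F)"
  using touches_disjoint by (auto simp: rem_def fun_eq_iff)

lemma not_avail_Nil [simp]: "\<not> avail a (\<lambda>_ _. [])"
  using touches_self unfolding avail_def by blast

text \<open>The letter prepended last is either \<open>a\<close>, where the side condition of
  \<open>red_prep\<close> applies, or is adjacent to \<open>a\<close> and commutes with the removal.
  This is what makes \<open>act a\<close> and \<open>act (flip a)\<close> mutually inverse on
  reduced families.\<close>

lemma red_rem:
  assumes "red F" "avail a F"
  shows "red (rem a F) \<and> \<not> avail (flip a) (rem a F)"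
  using assms
proof (induction arbitrary: a)
  case (red_prep F c)
  show ?case
  proof (cases "a = c")
    case True
    then show ?thesis using red_prep by simp
  next
    case False
    then have ac: "adj (fst a) (fst c)" "avail a F"
      using avail_prep_other red_prep.prems by blast+
    have IH: "red (rem a F)" "\<not> avail (flip a) (rem a F)"
      using red_prep.IH ac by auto
    have "\<not> avail (flip c) (rem a F)"
      using red_prep.hyps ac adj_sym by (simp add: avail_rem_iff)
    then show ?thesis
      using IH ac red_prep.hyps by (simp add: rem_prep_commute avail_prep_iff red.red_prep)
  qed
qed simp

lemma red_act: "red F \<Longrightarrow> fst a \<in> X \<Longrightarrow> red (act a F)"
  using red_rem red_prep by (simp add: act_def)

lemma act_cancel:
  assumes "red F"
  shows "act a (act (flip a) F) = F"
  using red_rem[OF assms, of a] by (simp add: act_def prep_rem)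

lemma act_commute:
  assumes "adj (fst a) (fst c)"
  shows "act a (act c F) = act c (act a F)"
  using assms adj_sym[OF assms]
  by (simp add: act_def avail_prep_iff avail_rem_iff prep_prep rem_prep_commute rem_rem)

lemma foldr_act_red: "red F \<Longrightarrow> w \<in> words X \<Longrightarrow> red (foldr act w F)"
  by (induction w) (auto intro: red_act)

text \<open>The action of letters on reduced families satisfies the defining relations, so
  \<open>nf\<close> depends only on the group element that a word represents.\<close>

lemma foldr_act_pres_rel:
  assumes "(u, v) \<in> pres_rel X (commutation_relations \<Gamma>)" "red F"
  shows "foldr act u F = foldr act v F"
  using assms
proof (induction arbitrary: F)
  case (pres_cong u u' v v')
  then show ?case by (auto simp: foldr_act_red dest!: pres_rel_words)
next
  case (pres_cancel x b)
  then show ?case using act_cancel[of F "(x, b)"] by (simp add: flip_def)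
next
  case (pres_relation u v)
  then show ?case
    using act_commute[of "(_, True)" "(_, True)"] by (auto simp: commutation_relations_def)
qed auto

lemma fsize_prep:
  assumes "fst a \<in> X"
  shows "fsize (prep a F) = Suc (fsize F)"
proof -
  have "fsize (prep a F) = (\<Sum>x\<in>X. length (F x x) + (if x = fst a then 1 else 0))"
    unfolding fsize_def by (intro sum.cong) (auto simp: prep_def touches_def adj_irrefl)
  then show ?thesis using assms by (simp add: sum.distrib fsize_def)
qed

lemma fsize_rem: "fst a \<in> X \<Longrightarrow> avail a F \<Longrightarrow> fsize F = Suc (fsize (rem a F))"
  using fsize_prep[of a "rem a F"] by (simp add: prep_rem)

lemma nf_simps [simp]: "nf [] = (\<lambda>_ _. [])" "nf (a # w) = act a (nf w)"
  by (simp_all add: nf_def)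

lemma red_nf: "w \<in> words X \<Longrightarrow> red (nf w)"
  unfolding nf_def by (intro foldr_act_red red_Nil)

lemma set_nf: "set (nf w u v) \<subseteq> set w"
proof (induction w arbitrary: u v)
  case (Cons a w)
  have "set (act a (nf w) u v) \<subseteq> insert a (set (nf w u v))"
    by (auto simp: act_def rem_def prep_def dest: list.set_sel(2)[rotated])
      (metis list.set_sel(2) tl_Nil)
  then show ?case using Cons by auto
qed simp

lemma fsize_nf_le: "w \<in> words X \<Longrightarrow> fsize (nf w) \<le> length w"
proof (induction w)
  case (Cons a w)
  then show ?case
    using fsize_rem[of "flip a" "nf w"] by (auto simp: act_def fsize_prep)
qed (simp add: fsize_def)


section \<open>Word length\<close>

definition cls :: "'a word \<Rightarrow> 'a word set" where
  "cls w = pres_rel X (commutation_relations \<Gamma>) `` {w}"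

definition lt :: "'a \<times> bool \<Rightarrow> 'a word set" where
  "lt a = cls [a]"

definition nfg :: "'a word set \<Rightarrow> 'a \<Rightarrow> 'a \<Rightarrow> 'a word" where
  "nfg g = nf (SOME w. w \<in> g)"

text \<open>This is the word length of \<open>g\<close>: \<open>len_cls_le\<close> bounds it by the
  length of any word for \<open>g\<close>, and \<open>tight_wordE\<close> gives a word attaining
  it.\<close>

definition len :: "'a word set \<Rightarrow> nat" where
  "len g = fsize (nfg g)"

sublocale grp: group P by (rule group_pc_group)

abbreviation mul (infixl "\<cdot>" 70) where "g \<cdot> h \<equiv> g \<otimes>\<^bsub>P\<^esub> h"
abbreviation iv where "iv g \<equiv> inv\<^bsub>P\<^esub> g"
abbreviation G where "G \<equiv> carrier P"

lemma cls_closed [simp]: "w \<in> words X \<Longrightarrow> cls w \<in> G"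
  by (simp add: cls_def pc_group_def pres_class_carrier)

lemma clsE:
  assumes "g \<in> G"
  obtains w where "w \<in> words X" "g = cls w"
  using assms pres_carrierE unfolding cls_def pc_group_def by blast

lemma cls_Nil: "cls [] = \<one>\<^bsub>P\<^esub>"
  by (simp add: cls_def pc_group_def pres_one)

lemma cls_append: "u \<in> words X \<Longrightarrow> v \<in> words X \<Longrightarrow> cls (u @ v) = cls u \<cdot> cls v"
  by (simp add: cls_def pc_group_def pres_mult)

lemma cls_Cons: "fst a \<in> X \<Longrightarrow> w \<in> words X \<Longrightarrow> cls (a # w) = lt a \<cdot> cls w"
  using cls_append[of "[a]" w] by (simp add: lt_def)

lemma lt_closed [simp]: "fst a \<in> X \<Longrightarrow> lt a \<in> G"
  by (simp add: lt_def)

lemma gen_closed [simp]: "x \<in> X \<Longrightarrow> gen x \<in> G"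
  by (rule pc_gen_carrier)

lemma lt_True [simp]: "lt (x, True) = gen x"
  by (simp add: lt_def cls_def pc_gen_def pres_gen_def)

lemma lt_False [simp]: "x \<in> X \<Longrightarrow> lt (x, False) = iv (gen x)"
  by (simp add: lt_def cls_def pc_gen_def pc_group_def pres_gen_inv)

lemma lt_flip: "fst a \<in> X \<Longrightarrow> lt (flip a) = iv (lt a)"
  by (cases a; cases "snd a") (auto simp: flip_def)

lemma nfg_cls:
  assumes "w \<in> words X"
  shows "nfg (cls w) = nf w"
proof -
  have "(SOME v. v \<in> cls w) \<in> cls w"
    by (rule someI[of _ w]) (use assms in \<open>auto simp: cls_def intro: pres_refl\<close>)
  then have "(w, SOME v. v \<in> cls w) \<in> pres_rel X (commutation_relations \<Gamma>)"
    by (simp add: cls_def)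
  then show ?thesis
    using foldr_act_pres_rel[OF _ red_Nil] by (simp add: nfg_def nf_def)
qed

lemma red_nfg: "g \<in> G \<Longrightarrow> red (nfg g)"
  by (metis clsE nfg_cls red_nf)

lemma nfg_lt_mul: "g \<in> G \<Longrightarrow> fst a \<in> X \<Longrightarrow> nfg (lt a \<cdot> g) = act a (nfg g)"
  by (elim clsE) (simp flip: cls_Cons add: nfg_cls)

lemma lt_commute:
  assumes "adj (fst a) (fst c)"
  shows "lt a \<cdot> lt c = lt c \<cdot> lt a"
proof -
  obtain x b y d where [simp]: "a = (x, b)" "c = (y, d)" by (cases a; cases c)
  have X: "x \<in> X" "y \<in> X" using assms adj_X by auto
  have c: "gen x \<cdot> gen y = gen y \<cdot> gen x"
    using assms X pc_gen_commute by simp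
  have 1: "iv h \<cdot> g = g \<cdot> iv h" if "h \<cdot> g = g \<cdot> h" "h \<in> G" "g \<in> G" for g h
    using that by (metis grp.inv_closed grp.inv_solve_left grp.m_assoc grp.m_closed grp.inv_solve_right)
  show ?thesis
    using 1[OF c] 1[OF c[symmetric]] 1[OF 1[OF c, symmetric]] c X by (cases b; cases d) simp_all
qed


text \<open>If the first letter \<open>c\<close> is not \<open>a\<close> itself, then
  \<open>a\<close> is adjacent to \<open>c\<close> and already available in the tail. It is brought
  to the front there and then swapped with \<open>c\<close>.\<close>

lemma tight_avail:
  assumes "w \<in> words X" "fsize (nf w) = length w" "avail a (nf w)"
  shows "\<exists>w'\<in>words X. cls w = cls (a # w') \<and> length w = Suc (length w')"
  using assms
proof (induction w)
  case (Cons c w)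
  have c: "fst c \<in> X" and w: "w \<in> words X" using Cons.prems by auto
  \<comment> \<open>A cancellation would leave fewer letters than the word has, against the
    assumption on its length.\<close>
  have na: "\<not> avail (flip c) (nf w)"
    using Cons.prems(2) fsize_rem[of "flip c" "nf w"] fsize_nf_le[OF w] c by (auto simp: act_def)
  then have sz: "fsize (nf w) = length w" and nf: "nf (c # w) = prep c (nf w)"
    using Cons.prems(2) c by (auto simp: act_def fsize_prep)
  show ?case
  proof (cases "a = c")
    case True
    then show ?thesis using w by auto
  next
    case False
    then have ac: "adj (fst a) (fst c)" "avail a (nf w)"
      using Cons.prems(3) avail_prep_other unfolding nf by blast+
    then obtain w' where w': "w' \<in> words X" "cls w = cls (a # w')" "length w = Suc (length w')"
      using Cons.IH[OF w sz] by blast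
    have a: "fst a \<in> X" using ac adj_X by blast
    have "cls (c # w) = lt c \<cdot> (lt a \<cdot> cls w')"
      using w' w a c by (simp add: cls_Cons)
    also have "\<dots> = lt a \<cdot> (lt c \<cdot> cls w')"
      using lt_commute[OF ac(1)] a c w' by (simp flip: grp.m_assoc)
    also have "\<dots> = cls (a # c # w')" using w' a c by (simp add: cls_Cons)
    finally show ?thesis using w' c by (intro bexI[of _ "c # w'"]) auto
  qed
qed (simp add: nf_def)

text \<open>A letter put in front of a tight word gives a tight word unless it cancels. In that case
  \<open>tight_avail\<close> brings its inverse to the front, and the remaining word is
  tight.\<close>

lemma tight_word_exists:
  "w \<in> words X \<Longrightarrow> \<exists>w'\<in>words X. cls w' = cls w \<and> length w' = fsize (nf w')"
proof (induction w)
  case (Cons c w)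
  then obtain w' where w': "w' \<in> words X" "cls w' = cls w" "length w' = fsize (nf w')" by auto
  have c: "fst c \<in> X" and w: "w \<in> words X" using Cons.prems by auto
  have eq: "cls (c # w) = cls (c # w')" using w w' c by (simp add: cls_Cons)
  show ?case
  proof (cases "avail (flip c) (nf w')")
    case True
    then obtain v where v: "v \<in> words X" "cls w' = cls (flip c # v)" "length w' = Suc (length v)"
      using tight_avail w' by metis
    have "cls (c # w') = lt c \<cdot> (iv (lt c) \<cdot> cls v)"
      using v c w' by (simp add: cls_Cons lt_flip)
    also have "\<dots> = cls v" using v c by (simp flip: grp.m_assoc)
    finally have "cls v = cls (c # w)" using eq by simp
    moreover have "length v = fsize (nf v)"
    proof -
      have "nf v = nfg (cls (c # w'))"
        using \<open>cls v = cls (c # w)\<close> eq v(1) by (metis nfg_cls)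
      also have "\<dots> = rem (flip c) (nf w')" using True w'(1) c by (simp add: nfg_cls act_def)
      finally show ?thesis using fsize_rem[of "flip c" "nf w'"] True v(3) w'(3) c by simp
    qed
    ultimately show ?thesis using v by blast
  next
    case False
    then have "length (c # w') = fsize (nf (c # w'))"
      using w' c by (simp add: act_def fsize_prep)
    then show ?thesis using eq w' c by (intro bexI[of _ "c # w'"]) auto
  qed
qed (intro bexI[of _ "[]"], auto simp: fsize_def)

lemma tight_wordE:
  assumes "g \<in> G"
  obtains w where "w \<in> words X" "g = cls w" "len g = length w"
proof -
  obtain v where "v \<in> words X" "g = cls v" using assms by (rule clsE)
  then show ?thesis using tight_word_exists[of v] that by (metis len_def nfg_cls)
qed

lemma len_cls_le: "w \<in> words X \<Longrightarrow> len (cls w) \<le> length w"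
  by (simp add: len_def nfg_cls fsize_nf_le)

lemma len_one [simp]: "len \<one>\<^bsub>P\<^esub> = 0"
  using len_cls_le[of "[]"] by (simp add: cls_Nil)

lemma len_eq_0_iff: "g \<in> G \<Longrightarrow> len g = 0 \<longleftrightarrow> g = \<one>\<^bsub>P\<^esub>"
  by (elim tight_wordE) (auto simp: cls_Nil)

lemma iv_cls:
  "w \<in> words X \<Longrightarrow> rev (map flip w) \<in> words X \<and> iv (cls w) = cls (rev (map flip w))"
  by (induction w)
    (auto simp: cls_Nil cls_Cons cls_append grp.inv_mult_group lt_flip[symmetric] simp flip: lt_def)

lemma len_iv [simp]:
  assumes "g \<in> G"
  shows "len (iv g) = len g"
proof -
  have le: "len (iv h) \<le> len h" if "h \<in> G" for h
    using that iv_cls len_cls_le by (elim tight_wordE) (metis length_map length_rev)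
  show ?thesis using le[OF assms] le[of "iv g"] assms by simp
qed

lemma len_lt_mul:
  assumes "g \<in> G" "fst a \<in> X"
  shows "len g = Suc (len (lt a \<cdot> g)) \<and> avail (flip a) (nfg g)
    \<or> len (lt a \<cdot> g) = Suc (len g) \<and> \<not> avail (flip a) (nfg g)"
  using assms fsize_rem[of "flip a" "nfg g"]
  by (auto simp: len_def nfg_lt_mul act_def fsize_prep)

lemma len_mul_le:
  assumes "g \<in> G" "h \<in> G"
  shows "len (g \<cdot> h) \<le> len g + len h"
  using assms
  by (elim tight_wordE) (metis cls_append len_cls_le length_append words_simps(3))


section \<open>Ends of group elements\<close>

text \<open>The possible first letters of reduced words for \<open>g\<close>. The formulation by
  length makes \<open>rend\<close>, the last letters, its mirror image under inversion;
  \<open>lend_avail\<close> is the link to normal forms.\<close>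

definition lend :: "'a \<times> bool \<Rightarrow> 'a word set \<Rightarrow> bool" where
  "lend a g \<longleftrightarrow> fst a \<in> X \<and> len g = Suc (len (iv (lt a) \<cdot> g))"

definition rend :: "'a \<times> bool \<Rightarrow> 'a word set \<Rightarrow> bool" where
  "rend a g \<longleftrightarrow> fst a \<in> X \<and> len g = Suc (len (g \<cdot> iv (lt a)))"

lemma lend_X: "lend a g \<Longrightarrow> fst a \<in> X" and rend_X: "rend a g \<Longrightarrow> fst a \<in> X"
  by (auto simp: lend_def rend_def)

lemma lend_avail: "g \<in> G \<Longrightarrow> lend a g \<longleftrightarrow> fst a \<in> X \<and> avail a (nfg g)"
  using len_lt_mul[of g "flip a"] by (auto simp: lend_def lt_flip)

lemma rend_iff_lend_iv: "g \<in> G \<Longrightarrow> rend a g \<longleftrightarrow> lend (flip a) (iv g)"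
proof -
  assume g: "g \<in> G"
  have "len (g \<cdot> iv (lt a)) = len (lt a \<cdot> iv g)" if "fst a \<in> X"
    using that g len_iv[of "g \<cdot> iv (lt a)"] by (simp add: grp.inv_mult_group)
  then show ?thesis
    using g by (auto simp: lend_def rend_def lt_flip)
qed

lemma len_lt_mul_not_lend: "g \<in> G \<Longrightarrow> fst a \<in> X \<Longrightarrow> \<not> lend (flip a) g \<Longrightarrow> len (lt a \<cdot> g) = Suc (len g)"
  using len_lt_mul[of g a] by (auto simp: lend_avail)

lemma lend_iff_less:
  assumes "g \<in> G" "fst a \<in> X"
  shows "lend a g \<longleftrightarrow> len (iv (lt a) \<cdot> g) < len g"
    and "\<not> lend a g \<longleftrightarrow> len (iv (lt a) \<cdot> g) = Suc (len g)"
  using len_lt_mul[of g "flip a"] assms by (auto simp: lend_avail lt_flip)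

lemma lend_flip_iff:
  assumes "g \<in> G" "fst a \<in> X"
  shows "lend (flip a) g \<longleftrightarrow> len (lt a \<cdot> g) < len g"
    and "\<not> lend (flip a) g \<longleftrightarrow> len (lt a \<cdot> g) = Suc (len g)"
  using lend_iff_less[of g "flip a"] assms by (auto simp: lt_flip)

lemma rend_iff_less:
  assumes "g \<in> G" "fst a \<in> X"
  shows "rend a g \<longleftrightarrow> len (g \<cdot> iv (lt a)) < len g"
    and "\<not> rend a g \<longleftrightarrow> len (g \<cdot> iv (lt a)) = Suc (len g)"
proof -
  have "iv (g \<cdot> iv (lt a)) = lt a \<cdot> iv g"
    using assms by (simp add: grp.inv_mult_group)
  then have "len (lt a \<cdot> iv g) = len (g \<cdot> iv (lt a))"
    using assms len_iv[of "g \<cdot> iv (lt a)"] by simp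
  then show "rend a g \<longleftrightarrow> len (g \<cdot> iv (lt a)) < len g"
    "\<not> rend a g \<longleftrightarrow> len (g \<cdot> iv (lt a)) = Suc (len g)"
    using lend_flip_iff[of "iv g" a] assms by (auto simp: rend_iff_lend_iv)
qed

lemma rend_flip_iff:
  assumes "g \<in> G" "fst a \<in> X"
  shows "rend (flip a) g \<longleftrightarrow> len (g \<cdot> lt a) < len g"
    and "\<not> rend (flip a) g \<longleftrightarrow> len (g \<cdot> lt a) = Suc (len g)"
  using rend_iff_less[of g "flip a"] assms by (auto simp: lt_flip)

lemma lend_two:
  assumes "g \<in> G" "lend a g" "lend c g" "a \<noteq> c"
  shows "adj (fst a) (fst c)" "lend a (iv (lt c) \<cdot> g)"
proof -
  have X: "fst a \<in> X" "fst c \<in> X" using assms lend_X by auto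
  have av: "avail a (nfg g)" "avail c (nfg g)" using assms lend_avail by auto
  show ac: "adj (fst a) (fst c)" using avail_unique[OF av assms(4)] .
  have "nfg (iv (lt c) \<cdot> g) = rem c (nfg g)"
    using nfg_lt_mul[of g "flip c"] assms X av by (simp add: lt_flip act_def)
  then show "lend a (iv (lt c) \<cdot> g)"
    using av ac X assms by (simp add: lend_avail avail_rem_iff)
qed

lemma rend_two:
  assumes "g \<in> G" "rend a g" "rend c g" "a \<noteq> c"
  shows "adj (fst a) (fst c)" "rend a (g \<cdot> iv (lt c))"
proof -
  have X: "fst a \<in> X" "fst c \<in> X" using assms rend_X by auto
  have l: "lend (flip a) (iv g)" "lend (flip c) (iv g)" "flip a \<noteq> flip c"
    using assms rend_iff_lend_iv by (auto, metis flip_simps(2))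
  show "adj (fst a) (fst c)" using lend_two(1)[OF _ l] assms by simp
  show "rend a (g \<cdot> iv (lt c))"
    using lend_two(2)[OF _ l] assms X by (simp add: rend_iff_lend_iv grp.inv_mult_group lt_flip)
qed

lemma rend_exists:
  assumes "g \<in> G" "g \<noteq> \<one>\<^bsub>P\<^esub>"
  shows "\<exists>a. rend a g"
proof -
  have "iv g \<in> G" "iv g \<noteq> \<one>\<^bsub>P\<^esub>" using assms by auto
  then obtain w where w: "w \<in> words X" "iv g = cls w" "len (iv g) = length w" "w \<noteq> []"
    by (metis tight_wordE cls_Nil)
  then obtain a v where av: "w = a # v" by (cases w) auto
  have "iv (lt a) \<cdot> iv g = cls v"
    using w av by (simp add: cls_Cons flip: grp.m_assoc)
  then have "lend a (iv g)"
    using w av lend_iff_less(1)[of "iv g" a] len_cls_le[of v] \<open>iv g \<in> G\<close> by auto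
  then have "rend (flip a) g" using assms rend_iff_lend_iv[of g "flip a"] by simp
  then show ?thesis by blast
qed


lemma iv_mul_cancel: "g \<in> G \<Longrightarrow> h \<in> G \<Longrightarrow> iv g \<cdot> (g \<cdot> h) = h"
  by (simp flip: grp.m_assoc)

lemma mul_iv_cancel: "g \<in> G \<Longrightarrow> h \<in> G \<Longrightarrow> g \<cdot> (iv g \<cdot> h) = h"
  by (simp flip: grp.m_assoc)

lemmas gsimps = grp.m_assoc grp.inv_mult_group iv_mul_cancel mul_iv_cancel

lemma lend_exists: "g \<in> G \<Longrightarrow> g \<noteq> \<one>\<^bsub>P\<^esub> \<Longrightarrow> \<exists>a. lend a g"
  using rend_exists[of "iv g"] rend_iff_lend_iv[of "iv g"] by (metis grp.inv_closed grp.inv_eq_1_iff grp.inv_inv)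

lemma lend_lt_mul_adj:
  assumes "g \<in> G" "adj (fst a) (fst c)"
  shows "lend a (lt c \<cdot> g) \<longleftrightarrow> lend a g"
proof -
  have "fst c \<in> X" using assms adj_X by blast
  then show ?thesis
    using assms by (simp add: lend_avail nfg_lt_mul act_def avail_prep_iff avail_rem_iff)
qed

lemma lend_lt_mul: "g \<in> G \<Longrightarrow> fst a \<in> X \<Longrightarrow> lend a (lt a \<cdot> g) \<longleftrightarrow> \<not> lend (flip a) g"
  using len_lt_mul[of g a] by (auto simp: lend_avail nfg_lt_mul act_def)
    (metis red_nfg red_rem flip_simps(2))

lemma rend_mul_lt: "g \<in> G \<Longrightarrow> fst a \<in> X \<Longrightarrow> rend a (g \<cdot> lt a) \<longleftrightarrow> \<not> rend (flip a) g"
  using lend_lt_mul[of "iv g" "flip a"] by (simp add: rend_iff_lend_iv grp.inv_mult_group lt_flip)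

lemma len_lt [simp]: "fst a \<in> X \<Longrightarrow> len (lt a) = 1"
  using len_lt_mul[of "\<one>\<^bsub>P\<^esub>" a] by auto

text \<open>Lengths add when nothing cancels at the junction. The induction moves one first letter
  \<open>b\<close> of \<open>m\<close> over to \<open>v\<close> at a time.\<close>

lemma len_mul:
  assumes "v \<in> G" "m \<in> G" "\<And>a. rend a v \<Longrightarrow> \<not> lend (flip a) m"
  shows "len (v \<cdot> m) = len v + len m"
  using assms
proof (induction "len m" arbitrary: v m)
  case 0
  then show ?case by (simp add: len_eq_0_iff)
next
  case (Suc n)
  then have "m \<noteq> \<one>\<^bsub>P\<^esub>" by auto
  then obtain b where b: "lend b m" using lend_exists Suc.prems by blast
  define m' where "m' = iv (lt b) \<cdot> m"
  have X: "fst b \<in> X" using b lend_X by blast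
  have m': "m' \<in> G" "m = lt b \<cdot> m'" "len m = Suc (len m')"
    using b X Suc.prems by (auto simp: m'_def mul_iv_cancel lend_def)
  have nb: "\<not> rend (flip b) v" using Suc.prems(3)[of "flip b"] b by auto
  have vb: "len (v \<cdot> lt b) = Suc (len v)" using rend_flip_iff(2) Suc.prems X nb by blast
  \<comment> \<open>The junction stays free of cancellation: a last letter \<open>c\<close> of
    \<open>v \<cdot> lt b\<close> other than \<open>b\<close> commutes with \<open>b\<close>. So
    \<open>c\<close> is a last letter of \<open>v\<close>, and \<open>flip c\<close> in front of
    \<open>m'\<close> would also be in front of \<open>m\<close>.\<close>
  have "\<not> lend (flip c) m'" if c: "rend c (v \<cdot> lt b)" for c
  proof (cases "c = b")
    case True
    then show ?thesis using b m' X lend_lt_mul by simp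
  next
    case False
    have "rend b (v \<cdot> lt b)" using nb X Suc.prems by (simp add: rend_mul_lt)
    then have *: "adj (fst c) (fst b)" "rend c (v \<cdot> lt b \<cdot> iv (lt b))"
      using rend_two[OF _ c] False X Suc.prems by auto
    then have "rend c v" using X Suc.prems by (simp add: gsimps)
    then show ?thesis
      using Suc.prems(3) lend_lt_mul_adj[of m' "flip c" b] * m' by auto
  qed
  then have "len (v \<cdot> lt b \<cdot> m') = len (v \<cdot> lt b) + len m'"
    using Suc.hyps(1)[of m' "v \<cdot> lt b"] Suc.hyps(2) m' Suc.prems X by simp
  then show ?case using vb m' Suc.prems X by (simp add: grp.m_assoc)
qed

definition sim :: "'a \<Rightarrow> 'a \<Rightarrow> bool" where
  "sim x y \<longleftrightarrow> x = y \<or> adj x y"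

lemma sim_sym: "sim x y \<Longrightarrow> sim y x"
  using adj_sym by (auto simp: sim_def)

lemma ortho_sing: "x \<in> X \<Longrightarrow> ortho \<Gamma> {x} = {u \<in> X. sim x u}"
  using ortho_singleton[OF pair_graph] adj_sym by (auto simp: sim_def)

text \<open>These are the elements of minimal length in their left coset modulo the parabolic
  subgroup on \<open>x\<close> and its neighbours.\<close>

definition reduced_at :: "'a \<Rightarrow> 'a word set \<Rightarrow> bool" where
  "reduced_at x v \<longleftrightarrow> v \<in> G \<and> (\<forall>a. rend a v \<longrightarrow> \<not> sim x (fst a))"

text \<open>Every first letter of \<open>lt a \<cdot> k\<close> is \<open>a\<close> or adjacent to
  it, and \<open>v\<close> has no last letter at such a vertex. Hence \<open>len_mul\<close>
  applies.\<close>

lemma len_reduced_at: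
  assumes "reduced_at (fst a) v" "k \<in> G" "\<not> lend (flip a) k" "fst a \<in> X"
  shows "len (v \<cdot> (lt a \<cdot> k)) = Suc (len v + len k)"
proof -
  have l: "lend a (lt a \<cdot> k)" "len (lt a \<cdot> k) = Suc (len k)"
    using assms by (auto simp: lend_lt_mul len_lt_mul_not_lend)
  have "\<not> lend (flip c) (lt a \<cdot> k)" if "rend c v" for c
  proof
    assume "lend (flip c) (lt a \<cdot> k)"
    then have "flip c = a \<or> adj (fst a) (fst c)"
      using lend_two(1)[OF _ l(1), of "flip c"] assms by auto
    then have "sim (fst a) (fst c)" by (metis flip_simps(1) sim_def)
    then show False using that assms(1) unfolding reduced_at_def by blast
  qed
  then show ?thesis using len_mul[of v "lt a \<cdot> k"] assms l by (simp add: reduced_at_def)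
qed

section \<open>The prefix order on group elements\<close>

definition pre :: "'a word set \<Rightarrow> 'a word set \<Rightarrow> bool" where
  "pre u h \<longleftrightarrow> len h = len u + len (iv u \<cdot> h)"

lemma preI: "u \<in> G \<Longrightarrow> h \<in> G \<Longrightarrow> len u + len (iv u \<cdot> h) \<le> len h \<Longrightarrow> pre u h"
  using len_mul_le[of u "iv u \<cdot> h"] by (simp add: pre_def mul_iv_cancel)

lemma pre_trans:
  assumes "u \<in> G" "v \<in> G" "h \<in> G" "pre u v" "pre v h"
  shows "pre u h"
proof (rule preI)
  have "iv u \<cdot> h = (iv u \<cdot> v) \<cdot> (iv v \<cdot> h)" using assms by (simp add: gsimps)
  then show "len u + len (iv u \<cdot> h) \<le> len h"
    using len_mul_le[of "iv u \<cdot> v" "iv v \<cdot> h"] assms by (simp add: pre_def)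
qed (use assms in auto)

lemma pre_mul: "u \<in> G \<Longrightarrow> k \<in> G \<Longrightarrow> len (u \<cdot> k) = len u + len k \<Longrightarrow> pre u (u \<cdot> k)"
  by (simp add: pre_def iv_mul_cancel)

lemma rend_pre: "h \<in> G \<Longrightarrow> rend c h \<Longrightarrow> pre (h \<cdot> iv (lt c)) h"
  by (rule preI) (auto simp: rend_def gsimps)

text \<open>Take \<open>c\<close> to be a last letter of the nontrivial remainder
  \<open>iv p \<cdot> h\<close>.\<close>

lemma pre_proper:
  assumes "p \<in> G" "h \<in> G" "pre p h" "p \<noteq> h"
  obtains c where "rend c h" "pre p (h \<cdot> iv (lt c))" "len (iv p \<cdot> (h \<cdot> iv (lt c))) < len (iv p \<cdot> h)"
proof -
  have "iv p \<cdot> h \<noteq> \<one>\<^bsub>P\<^esub>"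
    using assms mul_iv_cancel[of p h] by auto
  then obtain c where c: "rend c (iv p \<cdot> h)" using rend_exists[of "iv p \<cdot> h"] assms by auto
  then have X: "fst c \<in> X" by (rule rend_X)
  have l: "len (iv p \<cdot> h) = Suc (len (iv p \<cdot> (h \<cdot> iv (lt c))))"
    using c X assms by (simp add: rend_def grp.m_assoc)
  have "len (h \<cdot> iv (lt c)) \<le> len p + len (iv p \<cdot> (h \<cdot> iv (lt c)))"
    using len_mul_le[of p "iv p \<cdot> (h \<cdot> iv (lt c))"] assms X by (simp add: mul_iv_cancel)
  then have "len (h \<cdot> iv (lt c)) < len h" using assms l by (simp add: pre_def)
  then have r: "rend c h" using rend_iff_less X assms by blast
  then have "pre p (h \<cdot> iv (lt c))" using assms l by (simp add: pre_def rend_def)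
  then show ?thesis using that r l by simp
qed

text \<open>A last letter \<open>b\<close> of \<open>h\<close> that \<open>p\<close> does not have
  must sit in the remainder. The induction strips another last letter \<open>c\<close> of the
  remainder; \<open>b\<close> and \<open>c\<close> commute, so \<open>b\<close> is still last in the
  shorter element.\<close>

lemma pre_rend:
  assumes "p \<in> G" "h \<in> G" "pre p h" "rend b h" "\<not> rend b p"
  shows "pre p (h \<cdot> iv (lt b))"
  using assms
proof (induction "len (iv p \<cdot> h)" arbitrary: h rule: less_induct)
  case less
  then have "p \<noteq> h" by auto
  then obtain c where c: "rend c h" "pre p (h \<cdot> iv (lt c))"
      "len (iv p \<cdot> (h \<cdot> iv (lt c))) < len (iv p \<cdot> h)"
    using pre_proper less.prems by metis
  have X: "fst b \<in> X" "fst c \<in> X" using c less.prems rend_X by auto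
  show ?case
  proof (cases "c = b")
    case True
    then show ?thesis using c by simp
  next
    case False
    have bc: "adj (fst b) (fst c)" "rend b (h \<cdot> iv (lt c))" "rend c (h \<cdot> iv (lt b))"
      using rend_two[of h b c] rend_two[of h c b] c less.prems False by auto
    have 1: "pre p (h \<cdot> iv (lt c) \<cdot> iv (lt b))"
      using less.hyps[of "h \<cdot> iv (lt c)"] c less.prems bc X by simp
    have "iv (lt c) \<cdot> iv (lt b) = iv (lt b) \<cdot> iv (lt c)"
      using lt_commute[OF bc(1)] X grp.inv_mult_group by (metis lt_closed)
    then have "h \<cdot> iv (lt c) \<cdot> iv (lt b) = h \<cdot> iv (lt b) \<cdot> iv (lt c)"
      using less.prems X by (simp add: grp.m_assoc)
    then show ?thesis
      using pre_trans[OF _ _ _ 1, of "h \<cdot> iv (lt b)"] rend_pre[OF _ bc(3)] less.prems X by simp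
  qed
qed

text \<open>Each of \<open>p\<close> and \<open>q\<close> has only one last letter. Last letters of
  \<open>h\<close> are stripped while both remain prefixes, until \<open>h\<close> is one of them;
  the other is then a proper prefix of it and avoids its only last letter. This gives the
  disjointness in the ping-pong argument.\<close>

lemma pre_disjoint:
  assumes "p \<in> G" "q \<in> G" "h \<in> G" "pre p h" "pre q h"
    and "\<And>c. rend c p \<Longrightarrow> c = a" "\<And>c. rend c q \<Longrightarrow> c = b" "a \<noteq> b" "\<not> adj (fst a) (fst b)"
    and "p \<noteq> q"
  shows "pre q (p \<cdot> iv (lt a)) \<or> pre p (q \<cdot> iv (lt b))"
  using assms(3-5)
proof (induction "len h" arbitrary: h rule: less_induct)
  case less
  show ?case
  proof (cases "p = h \<or> q = h")
    case True
    then show ?thesis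
      using pre_proper[of q h] pre_proper[of p h] less.prems assms by metis
  next
    case False
    then obtain c d where c: "rend c h" "pre p (h \<cdot> iv (lt c))" and d: "rend d h" "pre q (h \<cdot> iv (lt d))"
      using pre_proper[of q h] pre_proper[of p h] less.prems assms(1,2) by metis
    have X: "fst c \<in> X" "fst d \<in> X" using c d rend_X by auto
    have l: "len (h \<cdot> iv (lt c)) < len h" "len (h \<cdot> iv (lt d)) < len h"
      using c d by (auto simp: rend_def)
    \<comment> \<open>If stripping \<open>c\<close> destroyed the prefix \<open>q\<close> and
      stripping \<open>d\<close> the prefix \<open>p\<close>, then \<open>c = b\<close> and
      \<open>d = a\<close> would be distinct last letters of \<open>h\<close>, hence
      adjacent.\<close>
    show ?thesis
    proof (cases "rend c q \<and> rend d p")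
      case True
      then have "c = b" "d = a" using assms by auto
      then show ?thesis using rend_two(1)[OF _ d(1) c(1)] less.prems assms by auto
    next
      case False
      then have "pre q (h \<cdot> iv (lt c)) \<or> pre p (h \<cdot> iv (lt d))"
        using pre_rend[of q h c] pre_rend[of p h d] c d less.prems assms(1,2) by blast
      then show ?thesis
        using less.hyps[OF l(1)] less.hyps[OF l(2)] c d less.prems X by auto
    qed
  qed
qed


section \<open>Parabolic subgroups\<close>

lemma sub_subgroup: "Y \<subseteq> X \<Longrightarrow> subgroup (sub Y) P"
  unfolding pc_sub_def by (rule grp.generate_is_subgroup) auto

lemma sub_subset: "Y \<subseteq> X \<Longrightarrow> sub Y \<subseteq> G"
  using sub_subgroup subgroup.subset by blast

lemma sub_closed: "Y \<subseteq> X \<Longrightarrow> g \<in> sub Y \<Longrightarrow> g \<in> G"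
  using sub_subset by blast

lemma gen_in_sub: "x \<in> Y \<Longrightarrow> gen x \<in> sub Y"
  unfolding pc_sub_def by (auto intro: generate.incl)

lemma sub_mono: "Y \<subseteq> Z \<Longrightarrow> sub Y \<subseteq> sub Z"
  unfolding pc_sub_def by (intro grp.mono_generate) auto

lemma lt_in_sub:
  assumes "fst a \<in> Y" "Y \<subseteq> X"
  shows "lt a \<in> sub Y"
proof (cases "snd a")
  case True
  then show ?thesis using gen_in_sub[OF assms(1)] by (cases a) auto
next
  case False
  then have "lt a = iv (gen (fst a))" using assms by (cases a) auto
  then show ?thesis
    using gen_in_sub[OF assms(1)] subgroup.m_inv_closed[OF sub_subgroup[OF assms(2)]] by simp
qed

lemma sub_subset_iff_gens:
  assumes "subgroup H P" "\<And>x. x \<in> Y \<Longrightarrow> gen x \<in> H"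
  shows "sub Y \<subseteq> H"
  unfolding pc_sub_def using assms by (intro grp.generate_subgroup_incl) auto

lemma centralizer_subgroup: "g \<in> G \<Longrightarrow> subgroup {h \<in> G. g \<cdot> h = h \<cdot> g} P"
proof (rule grp.subgroupI)
  fix h assume g: "g \<in> G" and h: "h \<in> {h \<in> G. g \<cdot> h = h \<cdot> g}"
  then have hG: "h \<in> G" by simp
  have "g \<cdot> iv h = iv h \<cdot> (h \<cdot> g) \<cdot> iv h" using g hG by (simp add: gsimps)
  also have "\<dots> = iv h \<cdot> (g \<cdot> h) \<cdot> iv h" using h by simp
  also have "\<dots> = iv h \<cdot> g" using g hG by (simp add: gsimps)
  finally show "iv h \<in> {h \<in> G. g \<cdot> h = h \<cdot> g}" using hG by simp
next
  fix h k assume g: "g \<in> G" and h: "h \<in> {h \<in> G. g \<cdot> h = h \<cdot> g}" "k \<in> {h \<in> G. g \<cdot> h = h \<cdot> g}"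
  then have "g \<cdot> (h \<cdot> k) = h \<cdot> g \<cdot> k" by (simp flip: grp.m_assoc)
  also have "\<dots> = h \<cdot> k \<cdot> g" using g h by (simp add: grp.m_assoc)
  finally show "h \<cdot> k \<in> {h \<in> G. g \<cdot> h = h \<cdot> g}" using h by simp
qed auto

lemma sub_commute:
  assumes "g \<in> G" "Y \<subseteq> X" "\<And>y. y \<in> Y \<Longrightarrow> g \<cdot> gen y = gen y \<cdot> g" "h \<in> sub Y"
  shows "g \<cdot> h = h \<cdot> g"
proof -
  have "gen y \<in> {h \<in> G. g \<cdot> h = h \<cdot> g}" if "y \<in> Y" for y
    using assms(2) assms(3)[OF that] that by (simp add: subset_eq)
  then have "h \<in> {h \<in> G. g \<cdot> h = h \<cdot> g}"
    using sub_subset_iff_gens[OF centralizer_subgroup[OF assms(1)], of Y] assms(4) by blast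
  then show ?thesis by simp
qed

lemma gen_commute: "sim x y \<Longrightarrow> gen x \<cdot> gen y = gen y \<cdot> gen x"
  using lt_commute[of "(x, True)" "(y, True)"] by (auto simp: sim_def)

lemma words_mono: "Y \<subseteq> Z \<Longrightarrow> words Y \<subseteq> words Z"
  unfolding words_def by (rule lists_mono) auto

lemma sub_words:
  assumes "Y \<subseteq> X" "g \<in> sub Y"
  shows "\<exists>w\<in>words Y. g = cls w"
proof -
  have wX: "w \<in> words X" if "w \<in> words Y" for w
    using that words_mono[OF assms(1)] by blast
  show ?thesis
    using assms(2) unfolding pc_sub_def
  proof (induction rule: generate.induct)
    case one
    then show ?case using cls_Nil words_simps(1) by metis
  next
    case (incl h)
    then obtain y where "y \<in> Y" "h = gen y" by blast
    then have "[(y, True)] \<in> words Y" "h = cls [(y, True)]" by (simp_all flip: lt_def)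
    then show ?case by blast
  next
    case (inv h)
    then obtain y where "y \<in> Y" "h = gen y" by blast
    then have "[(y, False)] \<in> words Y" "iv h = cls [(y, False)]"
      using assms(1) by (simp_all add: subset_eq flip: lt_def)
    then show ?case by blast
  next
    case (eng h1 h2)
    then obtain u v where "u \<in> words Y" "v \<in> words Y" "h1 = cls u" "h2 = cls v" by blast
    then have "u @ v \<in> words Y" "h1 \<cdot> h2 = cls (u @ v)" using wX by (simp_all add: cls_append)
    then show ?case by blast
  qed
qed

text \<open>A normal form contains only letters of the word it is computed from, and elements of
  \<open>sub Y\<close> are represented by words over \<open>Y\<close>.\<close>

lemma sub_lend:
  assumes "Y \<subseteq> X" "g \<in> sub Y" "lend a g"
  shows "fst a \<in> Y"
proof -
  obtain w where w: "w \<in> words Y" "g = cls w" using sub_words assms by blast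
  then have wX: "w \<in> words X" using words_mono[OF assms(1)] by blast
  have "avail a (nf w)" using assms w wX lend_avail[of g a] by (simp add: nfg_cls)
  then obtain r where "nf w (fst a) (fst a) = a # r"
    using touches_self unfolding avail_def by blast
  then have "a \<in> set w" using set_nf[of w "fst a" "fst a"] by auto
  then show ?thesis using w(1) by (auto simp: words_def)
qed

lemma sub_rend:
  assumes "Y \<subseteq> X" "g \<in> sub Y" "rend a g"
  shows "fst a \<in> Y"
  using sub_lend[of Y "iv g" "flip a"] assms sub_closed[OF assms(1,2)]
    subgroup.m_inv_closed[OF sub_subgroup[OF assms(1)]] by (simp add: rend_iff_lend_iv)

text \<open>The factor \<open>q\<close> is removed letter by letter from the right. No last letter
  of \<open>p\<close> lies in \<open>Y\<close>, so \<open>p\<close> survives each removal by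
  \<open>pre_rend\<close>.\<close>

lemma pre_strip:
  assumes "Y \<subseteq> X" "p \<in> G" "z \<in> G" "q \<in> sub Y" "pre p (z \<cdot> q)" "\<And>c. rend c p \<Longrightarrow> fst c \<notin> Y"
  shows "pre p z"
  using assms(4,5)
proof (induction "len q" arbitrary: q rule: less_induct)
  case less
  have q: "q \<in> G" using sub_closed less.prems assms by blast
  show ?case
  proof (cases "q = \<one>\<^bsub>P\<^esub>")
    case True
    then show ?thesis using less.prems assms by simp
  next
    case False
    then obtain c where c: "rend c q" using rend_exists q by blast
    then have cY: "fst c \<in> Y" and cX: "fst c \<in> X" using sub_rend less.prems assms by blast+
    have q': "q \<cdot> iv (lt c) \<in> sub Y" using less.prems(1) lt_in_sub[of "flip c"] cY assms(1) cX
      by (simp add: lt_flip subgroup.m_closed[OF sub_subgroup])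
    have l: "len (q \<cdot> iv (lt c)) < len q" using c by (simp add: rend_def)
    have "pre p (z \<cdot> (q \<cdot> iv (lt c)))"
    proof (cases "rend c (z \<cdot> q)")
      case True
      moreover have "\<not> rend c p" using assms(6) cY by blast
      ultimately show ?thesis using pre_rend[of p "z \<cdot> q" c] less.prems assms cX q
        by (simp add: grp.m_assoc)
    next
      case False
      \<comment> \<open>Here removing \<open>c\<close> lengthens the product, so
        \<open>z \<cdot> q\<close> is itself a prefix of the new element and
        \<open>pre_trans\<close> suffices.\<close>
      then have "rend (flip c) (z \<cdot> q \<cdot> iv (lt c))"
        using rend_mul_lt[of "z \<cdot> q" "flip c"] assms(3) q cX by (simp add: lt_flip)
      from rend_pre[OF _ this] have "pre (z \<cdot> q) (z \<cdot> q \<cdot> iv (lt c))"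
        using assms(3) q cX by (simp add: lt_flip gsimps)
      then show ?thesis
        using pre_trans[of p "z \<cdot> q" "z \<cdot> q \<cdot> iv (lt c)"] assms q cX less.prems
        by (simp add: grp.m_assoc)
    qed
    then show ?thesis using less.hyps[OF l q'] by blast
  qed
qed

text \<open>Last letters in \<open>Y\<close> are moved into the second factor for as long as there
  are any.\<close>

lemma coset_rep:
  assumes "Y \<subseteq> X" "g \<in> G"
  shows "\<exists>u s. u \<in> G \<and> s \<in> sub Y \<and> g = u \<cdot> s \<and> (\<forall>a. rend a u \<longrightarrow> fst a \<notin> Y)"
  using assms(2)
proof (induction "len g" arbitrary: g rule: less_induct)
  case less
  show ?case
  proof (cases "\<exists>a. rend a g \<and> fst a \<in> Y")
    case True
    then obtain a where a: "rend a g" "fst a \<in> Y" "fst a \<in> X" using assms by blast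
    then obtain u s where us: "u \<in> G" "s \<in> sub Y" "g \<cdot> iv (lt a) = u \<cdot> s" "\<forall>a. rend a u \<longrightarrow> fst a \<notin> Y"
      using less.hyps[of "g \<cdot> iv (lt a)"] less.prems by (auto simp: rend_def)
    have s: "s \<in> G" using us sub_closed assms by blast
    have "g = g \<cdot> iv (lt a) \<cdot> lt a" using less.prems a by (simp add: gsimps)
    also have "\<dots> = u \<cdot> (s \<cdot> lt a)" using us s a by (simp add: grp.m_assoc)
    finally have "g = u \<cdot> (s \<cdot> lt a)" .
    moreover have "s \<cdot> lt a \<in> sub Y"
      using us lt_in_sub a assms by (simp add: subgroup.m_closed[OF sub_subgroup])
    ultimately show ?thesis using us by blast
  next
    case False
    then show ?thesis using less.prems subgroup.one_closed[OF sub_subgroup[OF assms(1)]]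
      by (intro exI[of _ g] exI[of _ "\<one>\<^bsub>P\<^esub>"]) auto
  qed
qed

section \<open>Stars, links and centralisers of generators\<close>

definition star :: "'a \<Rightarrow> 'a set" where "star x = {u \<in> X. sim x u}"
definition link :: "'a \<Rightarrow> 'a set" where "link x = {u \<in> X. adj x u}"

lemma star_link: "x \<in> X \<Longrightarrow> star x = insert x (link x)"
  by (auto simp: star_def link_def sim_def)

lemma star_subset: "star x \<subseteq> X" and link_subset: "link x \<subseteq> X"
  by (auto simp: star_def link_def)

lemma reduced_at_iff: "reduced_at x v \<longleftrightarrow> v \<in> G \<and> (\<forall>a. rend a v \<longrightarrow> fst a \<notin> star x)"
  using rend_X by (auto simp: reduced_at_def star_def)

text \<open>Write \<open>p = u \<cdot> s\<close> with \<open>s\<close> in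
  \<open>sub (star y)\<close> and \<open>u\<close> reduced at \<open>y\<close>. As \<open>s\<close>
  commutes with \<open>gen y\<close>, so does \<open>u\<close>. But
  \<open>u \<cdot> gen y \<cdot> iv u\<close> has length twice that of \<open>u\<close> plus one, so
  \<open>u\<close> is trivial.\<close>

lemma centralizer_gen:
  assumes "p \<in> G" "y \<in> X" "p \<cdot> gen y = gen y \<cdot> p"
  shows "p \<in> sub (star y)"
proof -
  obtain u s where us: "u \<in> G" "s \<in> sub (star y)" "p = u \<cdot> s" "reduced_at y u"
    using coset_rep[OF star_subset assms(1), of y] by (auto simp: reduced_at_iff)
  have s: "s \<in> G" using us sub_closed star_subset by blast
  have c: "gen y \<cdot> s = s \<cdot> gen y"
    by (rule sub_commute[OF _ star_subset _ us(2)]) (simp_all add: assms(2) star_def gen_commute)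
  have "u \<cdot> (gen y \<cdot> iv u) = u \<cdot> (gen y \<cdot> s) \<cdot> iv s \<cdot> iv u"
    using us s assms(2) by (simp add: gsimps)
  also have "\<dots> = p \<cdot> gen y \<cdot> iv p" using us s assms(2) unfolding c by (simp add: gsimps)
  also have "\<dots> = gen y" unfolding assms(3) using assms by (simp add: gsimps)
  finally have "len (u \<cdot> (lt (y, True) \<cdot> iv u)) = len (lt (y, True))" by simp
  moreover have "\<not> lend (flip (y, True)) (iv u)"
    using us by (auto simp: rend_iff_lend_iv[symmetric] reduced_at_def sim_def)
  ultimately have "len u = 0"
    using len_reduced_at[of "(y, True)" u "iv u"] len_lt[of "(y, True)"] us(1,4) assms(2) by simp
  then show ?thesis using us s by (simp add: len_eq_0_iff)
qed

text \<open>Since \<open>gen y\<close> commutes with \<open>sub Y\<close>, the products of the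
  required form already constitute a subgroup, and it contains all generators.\<close>

lemma sub_insert_split:
  assumes "insert y Y \<subseteq> X" "\<And>z. z \<in> Y \<Longrightarrow> sim y z" "p \<in> sub (insert y Y)"
  shows "\<exists>q\<in>sub Y. \<exists>n::int. p = q \<cdot> gen y [^]\<^bsub>P\<^esub> n"
proof -
  have y: "y \<in> X" and Y: "Y \<subseteq> X" using assms by auto
  note YS = sub_subgroup[OF Y]
  have comm: "gen y [^]\<^bsub>P\<^esub> (n::int) \<cdot> q = q \<cdot> gen y [^]\<^bsub>P\<^esub> n" if "q \<in> sub Y" for q n
  proof -
    have "gen y \<cdot> q = q \<cdot> gen y"
      by (rule sub_commute[OF _ Y _ that]) (simp_all add: y assms(2) gen_commute)
    then have "gen y \<in> {h \<in> G. q \<cdot> h = h \<cdot> q}" using y by simp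
    then have "gen y [^]\<^bsub>P\<^esub> n \<in> {h \<in> G. q \<cdot> h = h \<cdot> q}"
      by (intro grp.subgroup_int_pow_closed centralizer_subgroup sub_closed[OF Y that])
    then show ?thesis by simp
  qed
  let ?H = "{p. \<exists>q\<in>sub Y. \<exists>n::int. p = q \<cdot> gen y [^]\<^bsub>P\<^esub> n}"
  have "subgroup ?H P"
  proof (rule grp.subgroupI)
    show "?H \<subseteq> G" using sub_closed[OF Y] y by auto
    show "?H \<noteq> {}" using subgroup.one_closed[OF YS] by blast
  next
    fix p assume "p \<in> ?H"
    then obtain q and n :: int where "q \<in> sub Y" "p = q \<cdot> gen y [^]\<^bsub>P\<^esub> n" by auto
    moreover from this have "iv p = iv q \<cdot> gen y [^]\<^bsub>P\<^esub> (- n)"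
      using y sub_closed[OF Y] comm[of "iv q" "-n"] subgroup.m_inv_closed[OF YS]
      by (simp add: grp.inv_mult_group grp.int_pow_neg)
    ultimately show "iv p \<in> ?H" using subgroup.m_inv_closed[OF YS] by blast
  next
    fix p p' assume "p \<in> ?H" "p' \<in> ?H"
    then obtain q q' and n n' :: int where *: "q \<in> sub Y" "p = q \<cdot> gen y [^]\<^bsub>P\<^esub> n"
      "q' \<in> sub Y" "p' = q' \<cdot> gen y [^]\<^bsub>P\<^esub> n'" by auto
    have G: "q \<in> G" "q' \<in> G" using * sub_closed[OF Y] by auto
    have "p \<cdot> p' = q \<cdot> (gen y [^]\<^bsub>P\<^esub> n \<cdot> q') \<cdot> gen y [^]\<^bsub>P\<^esub> n'"
      using * G y by (simp add: grp.m_assoc)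
    also have "\<dots> = q \<cdot> q' \<cdot> (gen y [^]\<^bsub>P\<^esub> n \<cdot> gen y [^]\<^bsub>P\<^esub> n')"
      using G y by (simp add: comm[OF *(3)] grp.m_assoc)
    also have "\<dots> = q \<cdot> q' \<cdot> gen y [^]\<^bsub>P\<^esub> (n + n')" using y by (simp add: grp.int_pow_mult)
    finally show "p \<cdot> p' \<in> ?H" using * subgroup.m_closed[OF YS] by blast
  qed
  moreover have "gen z \<in> ?H" if "z \<in> insert y Y" for z
  proof (cases "z = y")
    case True
    then show ?thesis using y subgroup.one_closed[OF YS]
      by (auto intro!: bexI[of _ "\<one>\<^bsub>P\<^esub>"] exI[of _ 1])
  next
    case False
    then have "gen z \<in> sub Y" "gen z \<in> G" using that gen_in_sub Y by auto
    then show ?thesis by (auto intro!: bexI[of _ "gen z"] exI[of _ 0])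
  qed
  ultimately have "sub (insert y Y) \<subseteq> ?H" by (rule sub_subset_iff_gens)
  then show ?thesis using assms(3) by blast
qed


section \<open>Automorphisms\<close>

abbreviation A where "A \<equiv> right_AutoGroup P"

lemma carrier_A [simp]: "carrier A = auto P"
  by (simp add: right_AutoGroup_def AutoGroup_def)

lemma autoD:
  assumes "\<phi> \<in> auto P"
  shows "\<phi> \<in> hom P P" "\<phi> \<in> extensional G" "bij_betw \<phi> G G"
  using assms by (auto simp: auto_def Bij_def)

lemma autoI: "\<phi> \<in> hom P P \<Longrightarrow> \<phi> \<in> extensional G \<Longrightarrow> bij_betw \<phi> G G \<Longrightarrow> \<phi> \<in> auto P"
  by (simp add: auto_def Bij_def)

lemma mult_A: "\<phi> \<in> auto P \<Longrightarrow> \<psi> \<in> auto P \<Longrightarrow> \<phi> \<otimes>\<^bsub>A\<^esub> \<psi> = compose G \<psi> \<phi>"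
  by (simp add: right_AutoGroup_def AutoGroup_def BijGroup_def auto_def)

lemma one_A: "\<one>\<^bsub>A\<^esub> = (\<lambda>h\<in>G. h)"
  by (simp add: right_AutoGroup_def AutoGroup_def BijGroup_def)

text \<open>The opposite of the library's automorphism group, so each law is the corresponding one
  there with left and right exchanged.\<close>

sublocale agrp: group A
proof (rule groupI)
  interpret B: group "AutoGroup P" by (rule grp.AutoGroup)
  have [simp]: "carrier (AutoGroup P) = auto P" by (simp add: AutoGroup_def)
  have m: "\<phi> \<otimes>\<^bsub>A\<^esub> \<psi> = \<psi> \<otimes>\<^bsub>AutoGroup P\<^esub> \<phi>" and o: "\<one>\<^bsub>A\<^esub> = \<one>\<^bsub>AutoGroup P\<^esub>" for \<phi> \<psi>
    by (simp_all add: right_AutoGroup_def)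
  show "\<phi> \<otimes>\<^bsub>A\<^esub> \<psi> \<in> carrier A" if "\<phi> \<in> carrier A" "\<psi> \<in> carrier A" for \<phi> \<psi>
    using that B.m_closed by (simp add: m)
  show "\<one>\<^bsub>A\<^esub> \<in> carrier A" using B.one_closed by (simp add: o)
  show "\<phi> \<otimes>\<^bsub>A\<^esub> \<psi> \<otimes>\<^bsub>A\<^esub> \<chi> = \<phi> \<otimes>\<^bsub>A\<^esub> (\<psi> \<otimes>\<^bsub>A\<^esub> \<chi>)"
    if "\<phi> \<in> carrier A" "\<psi> \<in> carrier A" "\<chi> \<in> carrier A" for \<phi> \<psi> \<chi>
    using that B.m_assoc by (simp add: m)
  show "\<one>\<^bsub>A\<^esub> \<otimes>\<^bsub>A\<^esub> \<phi> = \<phi>" if "\<phi> \<in> carrier A" for \<phi>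
    using that B.r_one by (simp add: m o)
  show "\<exists>\<psi>\<in>carrier A. \<psi> \<otimes>\<^bsub>A\<^esub> \<phi> = \<one>\<^bsub>A\<^esub>" if "\<phi> \<in> carrier A" for \<phi>
    using that B.r_inv B.inv_closed unfolding m o by fastforce
qed

lemma mult_A_apply: "\<phi> \<in> auto P \<Longrightarrow> \<psi> \<in> auto P \<Longrightarrow> h \<in> G \<Longrightarrow> (\<phi> \<otimes>\<^bsub>A\<^esub> \<psi>) h = \<psi> (\<phi> h)"
  by (simp add: mult_A compose_def)

lemma auto_closed [simp]: "\<phi> \<in> auto P \<Longrightarrow> h \<in> G \<Longrightarrow> \<phi> h \<in> G"
  using bij_betwE[OF autoD(3)] by blast

lemma auto_hom: "\<phi> \<in> auto P \<Longrightarrow> group_hom P P \<phi>"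
  by (intro group_hom.intro group_hom_axioms.intro autoD(1)) auto

lemma auto_mult: "\<phi> \<in> auto P \<Longrightarrow> g \<in> G \<Longrightarrow> h \<in> G \<Longrightarrow> \<phi> (g \<cdot> h) = \<phi> g \<cdot> \<phi> h"
  using autoD(1) by (simp add: hom_mult)

lemma auto_iv: "\<phi> \<in> auto P \<Longrightarrow> g \<in> G \<Longrightarrow> \<phi> (iv g) = iv (\<phi> g)"
  by (rule group_hom.hom_inv[OF auto_hom])

lemma auto_one: "\<phi> \<in> auto P \<Longrightarrow> \<phi> \<one>\<^bsub>P\<^esub> = \<one>\<^bsub>P\<^esub>"
  by (rule group_hom.hom_one[OF auto_hom])

lemma hom_eqI:
  assumes "group H" "\<phi> \<in> hom P H" "\<psi> \<in> hom P H" "\<And>x. x \<in> X \<Longrightarrow> \<phi> (gen x) = \<psi> (gen x)" "h \<in> G"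
  shows "\<phi> h = \<psi> h"
  by (rule pc_hom_eq[OF assms(1-3) _ assms(5)]) (rule assms(4))

lemma auto_eqI:
  assumes "\<phi> \<in> auto P" "\<psi> \<in> auto P" "\<And>x. x \<in> X \<Longrightarrow> \<phi> (gen x) = \<psi> (gen x)"
  shows "\<phi> = \<psi>"
proof (rule extensionalityI[OF autoD(2) autoD(2), OF assms(1,2)])
  show "\<phi> h = \<psi> h" if "h \<in> G" for h
    by (rule hom_eqI[OF grp.is_group autoD(1) autoD(1) _ that]) (use assms in simp_all)
qed

text \<open>Conjugation with the uninverted conjugator on the left, opposite to
  \<open>conj_by\<close>. In this form conjugators can be compared by prefixes, and nested
  conjugations multiply in the order in which they are written.\<close>

definition cj :: "'a word set \<Rightarrow> 'a word set \<Rightarrow> 'a word set" where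
  "cj g h = g \<cdot> h \<cdot> iv g"

lemma cj_closed [simp]: "g \<in> G \<Longrightarrow> h \<in> G \<Longrightarrow> cj g h \<in> G"
  by (simp add: cj_def)

lemma cj_cj: "g \<in> G \<Longrightarrow> h \<in> G \<Longrightarrow> k \<in> G \<Longrightarrow> cj g (cj h k) = cj (g \<cdot> h) k"
  by (simp add: cj_def gsimps)

lemma cj_iv: "g \<in> G \<Longrightarrow> h \<in> G \<Longrightarrow> cj g (iv h) = iv (cj g h)"
  by (simp add: cj_def gsimps)

lemma cj_mult: "g \<in> G \<Longrightarrow> h \<in> G \<Longrightarrow> k \<in> G \<Longrightarrow> cj g (h \<cdot> k) = cj g h \<cdot> cj g k"
  by (simp add: cj_def gsimps)

lemma cj_commute: "g \<in> G \<Longrightarrow> h \<in> G \<Longrightarrow> g \<cdot> h = h \<cdot> g \<Longrightarrow> cj g h = h"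
  by (simp add: cj_def grp.m_assoc)

lemma cj_one: "h \<in> G \<Longrightarrow> cj \<one>\<^bsub>P\<^esub> h = h"
  by (simp add: cj_def)

lemma cj_eqD:
  assumes "g \<in> G" "h \<in> G" "k \<in> G" "cj g k = cj h k"
  shows "iv g \<cdot> h \<cdot> k = k \<cdot> (iv g \<cdot> h)"
proof -
  have "iv g \<cdot> h \<cdot> k = iv g \<cdot> cj h k \<cdot> h" using assms(1-3) by (simp add: cj_def gsimps)
  also have "\<dots> = k \<cdot> (iv g \<cdot> h)" using assms(1-3) unfolding assms(4)[symmetric] by (simp add: cj_def gsimps)
  finally show ?thesis .
qed

lemma auto_cj: "\<phi> \<in> auto P \<Longrightarrow> g \<in> G \<Longrightarrow> h \<in> G \<Longrightarrow> \<phi> (cj g h) = cj (\<phi> g) (\<phi> h)"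
  by (simp add: cj_def auto_mult auto_iv)

lemma conj_by_cj: "g \<in> G \<Longrightarrow> conj_by P h g = cj (iv g) h"
  by (simp add: conj_by_def cj_def)

lemma lt_gen_commute:
  assumes "sim (fst a) y" "fst a \<in> X"
  shows "lt a \<cdot> gen y = gen y \<cdot> lt a"
proof (cases "adj (fst a) y")
  case True
  then show ?thesis using lt_commute[of a "(y, True)"] by simp
next
  case False
  then have "fst a = y" using assms by (simp add: sim_def)
  then show ?thesis using assms by (cases a; cases "snd a") auto
qed

text \<open>One conjugator must serve both ends of an edge; the case \<open>x = y\<close> covers
  vertices without neighbours. Such common conjugators are what membership in \<open>St_conj\<close>
  and \<open>IA\<close> supplies.\<close>

definition conjugating :: "('a word set \<Rightarrow> 'a word set) \<Rightarrow> bool" where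
  "conjugating \<phi> \<longleftrightarrow> \<phi> \<in> auto P \<and> (\<forall>x\<in>X. \<forall>y\<in>X. sim x y \<longrightarrow>
     (\<exists>g\<in>G. \<phi> (gen x) = cj g (gen x) \<and> \<phi> (gen y) = cj g (gen y)))"

definition shortest_conjugators :: "('a word set \<Rightarrow> 'a word set) \<Rightarrow> ('a \<Rightarrow> 'a word set) \<Rightarrow> bool" where
  "shortest_conjugators \<phi> v \<longleftrightarrow> (\<forall>x\<in>X. v x \<in> G \<and> \<phi> (gen x) = cj (v x) (gen x)
     \<and> (\<forall>g\<in>G. \<phi> (gen x) = cj g (gen x) \<longrightarrow> len (v x) \<le> len g))"

lemma conjugating_mult:
  assumes "conjugating \<phi>" "conjugating \<psi>"
  shows "conjugating (\<phi> \<otimes>\<^bsub>A\<^esub> \<psi>)"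
  unfolding conjugating_def
proof (intro conjI ballI impI)
  have a: "\<phi> \<in> auto P" "\<psi> \<in> auto P" using assms by (auto simp: conjugating_def)
  then show "\<phi> \<otimes>\<^bsub>A\<^esub> \<psi> \<in> auto P" using agrp.m_closed by simp
  fix x y assume xy: "x \<in> X" "y \<in> X" "sim x y"
  obtain g where g: "g \<in> G" "\<phi> (gen x) = cj g (gen x)" "\<phi> (gen y) = cj g (gen y)"
    using assms(1) xy unfolding conjugating_def by blast
  obtain h where h: "h \<in> G" "\<psi> (gen x) = cj h (gen x)" "\<psi> (gen y) = cj h (gen y)"
    using assms(2) xy unfolding conjugating_def by blast
  show "\<exists>g\<in>G. (\<phi> \<otimes>\<^bsub>A\<^esub> \<psi>) (gen x) = cj g (gen x) \<and> (\<phi> \<otimes>\<^bsub>A\<^esub> \<psi>) (gen y) = cj g (gen y)"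
    using a g h xy by (intro bexI[of _ "\<psi> g \<cdot> h"]) (simp_all add: mult_A_apply auto_cj cj_cj)
qed

lemma sim_refl: "sim x x"
  by (simp add: sim_def)

lemma shortest_conjugators_exist:
  assumes "conjugating \<phi>"
  shows "\<exists>v. shortest_conjugators \<phi> v"
proof -
  have "\<exists>g. g \<in> G \<and> \<phi> (gen x) = cj g (gen x)
      \<and> (\<forall>h\<in>G. \<phi> (gen x) = cj h (gen x) \<longrightarrow> len g \<le> len h)" if x: "x \<in> X" for x
  proof -
    obtain g where "g \<in> G \<and> \<phi> (gen x) = cj g (gen x)"
      using assms x sim_refl[of x] unfolding conjugating_def by blast
    then show ?thesis
      using ex_has_least_nat[of "\<lambda>g. g \<in> G \<and> \<phi> (gen x) = cj g (gen x)" g len] by blast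
  qed
  then show ?thesis unfolding shortest_conjugators_def by metis
qed

lemma reduced_at_closed: "reduced_at x u \<Longrightarrow> u \<in> G"
  by (simp add: reduced_at_def)

lemma reduced_at_pre:
  assumes "reduced_at x u" "p \<in> sub (star x)"
  shows "pre u (u \<cdot> p)"
proof (rule pre_mul)
  show u: "u \<in> G" and p: "p \<in> G"
    using assms sub_closed[OF star_subset] reduced_at_closed by blast+
  show "len (u \<cdot> p) = len u + len p"
  proof (rule len_mul[OF u p])
    show "\<not> lend (flip a) p" if "rend a u" for a
      using that assms(1) sub_lend[OF star_subset assms(2), of "flip a"]
      unfolding reduced_at_iff by (metis flip_simps(1))
  qed
qed

lemma reduced_at_not_rend: "reduced_at (fst a) u \<Longrightarrow> \<not> rend a u \<and> \<not> rend (flip a) u"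
  unfolding reduced_at_def sim_def by (metis flip_simps(1))

text \<open>A second last letter would commute with \<open>a\<close> and so be a last letter of
  \<open>u\<close> adjacent to \<open>fst a\<close>.\<close>

lemma rend_reduced_at:
  assumes "reduced_at (fst a) u" "fst a \<in> X"
  shows "rend c (u \<cdot> lt a) \<longleftrightarrow> c = a"
proof -
  have u: "u \<in> G" using assms reduced_at_closed by blast
  have r: "rend a (u \<cdot> lt a)" using rend_mul_lt[OF u assms(2)] reduced_at_not_rend[OF assms(1)] by blast
  have "c = a" if c: "rend c (u \<cdot> lt a)"
  proof (rule ccontr)
    assume "c \<noteq> a"
    then have "adj (fst c) (fst a)" "rend c (u \<cdot> lt a \<cdot> iv (lt a))"
      using rend_two[OF _ c r] u assms by auto
    then have "sim (fst a) (fst c)" "rend c u" using u assms adj_sym by (auto simp: sim_def gsimps)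
    then show False using assms(1) unfolding reduced_at_def by blast
  qed
  then show ?thesis using r by blast
qed

lemma len_reduced_at_lt: "reduced_at (fst a) u \<Longrightarrow> fst a \<in> X \<Longrightarrow> len (u \<cdot> lt a) = Suc (len u)"
  using rend_flip_iff(2)[of u a] reduced_at_not_rend[of a u] reduced_at_closed[of "fst a" u] by simp

lemma pre_reduced_at:
  assumes "reduced_at (fst a) u" "fst a \<in> X" "k \<in> G" "\<not> lend (flip a) k"
  shows "pre (u \<cdot> lt a) (u \<cdot> (lt a \<cdot> k))"
  using assms len_reduced_at[OF assms(1,3,4,2)] len_reduced_at_lt[OF assms(1,2)]
    reduced_at_closed[OF assms(1)]
  by (simp add: pre_def gsimps)

text \<open>Together with \<open>pre_reduced_at\<close> this describes the elements with prefix
  \<open>u \<cdot> lt a\<close> as the cancellation-free products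
  \<open>u \<cdot> (lt a \<cdot> k)\<close>.\<close>

lemma pre_reduced_atD:
  assumes "reduced_at (fst a) u" "fst a \<in> X" "h \<in> G" "pre (u \<cdot> lt a) h"
  obtains k where "k \<in> G" "h = u \<cdot> (lt a \<cdot> k)" "\<not> lend (flip a) k" "len h = Suc (len u + len k)"
proof -
  have u: "u \<in> G" using assms reduced_at_closed by blast
  define k where "k = iv (u \<cdot> lt a) \<cdot> h"
  have k: "k \<in> G" "h = u \<cdot> (lt a \<cdot> k)" using u assms by (simp_all add: k_def gsimps)
  have l: "len h = Suc (len u + len k)"
    using assms(4) len_reduced_at_lt[OF assms(1,2)] by (simp add: pre_def k_def)
  have "len h \<le> len u + len (lt a \<cdot> k)" using len_mul_le u k assms(2) by simp
  then have "\<not> lend (flip a) k" using l lend_flip_iff(1)[OF k(1) assms(2)] by simp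
  then show ?thesis using that k l by blast
qed

text \<open>Multiplying by a letter adjacent to \<open>y\<close> neither creates nor destroys a
  first letter at \<open>y\<close>.\<close>

lemma lend_sub_link:
  assumes "e \<in> sub (link y)" "k \<in> G" "fst a = y"
  shows "lend a (e \<cdot> k) \<longleftrightarrow> lend a k"
proof -
  obtain w where w: "w \<in> words (link y)" "e = cls w"
    using sub_words[OF link_subset assms(1)] by blast
  have "lend a (cls w \<cdot> k) \<longleftrightarrow> lend a k" if "w \<in> words (link y)" for w
    using that
  proof (induction w)
    case Nil
    then show ?case using assms by (simp add: cls_Nil)
  next
    case (Cons c w)
    have w: "w \<in> words X" using Cons.prems words_mono[OF link_subset[of y]] by auto
    have c: "adj (fst a) (fst c)" "fst c \<in> X" using Cons.prems assms by (auto simp: link_def)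
    then have "cls (c # w) \<cdot> k = lt c \<cdot> (cls w \<cdot> k)" using w assms by (simp add: cls_Cons grp.m_assoc)
    then show ?case using Cons lend_lt_mul_adj[OF _ c(1)] w assms by simp
  qed
  then show ?thesis using w by simp
qed

end

section \<open>Conjugating automorphisms\<close>

text \<open>Induction along a walk from \<open>y\<close> to \<open>z\<close> that avoids the
  orthogonal complement of \<open>x\<close>.\<close>

lemma (in raag) star_component_induct:
  assumes "C \<in> star_components \<Gamma> x" "y \<in> C" "z \<in> C" "Q y"
    and step: "\<And>u w. Q u \<Longrightarrow> adj u w \<Longrightarrow> w \<notin> ortho \<Gamma> {x} \<Longrightarrow> Q w"
  shows "Q z"
proof -
  interpret pair_graph \<Gamma> by (rule pair_graph)
  define H where "H = with_proj \<Gamma> \<restriction> (pverts \<Gamma> - ortho \<Gamma> {x})"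
  interpret H: wf_digraph H
    unfolding H_def by (rule wellformed_induce_subgraph)
  have "y \<rightarrow>\<^sup>*\<^bsub>H\<^esub> z"
    using assms by (auto simp: star_components_def H.sccs_verts_def simp flip: H_def)
  then have "(y, z) \<in> (arcs_ends H)\<^sup>*" by (rule reachable_rtranclI)
  then show ?thesis
  proof (induction rule: rtrancl_induct)
    case (step u w)
    then have "adj u w" "w \<notin> ortho \<Gamma> {x}" by (auto simp: H_def arcs_ends_conv)
    then show ?case using assms(5) step.IH by blast
  qed (rule assms(4))
qed

lemma (in raag) star_component_exists:
  assumes "y \<in> X" "y \<notin> ortho \<Gamma> {x}"
  obtains C where "C \<in> star_components \<Gamma> x" "y \<in> C"
proof -
  interpret pair_graph \<Gamma> by (rule pair_graph)
  define H where "H = with_proj \<Gamma> \<restriction> (pverts \<Gamma> - ortho \<Gamma> {x})"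
  interpret H: wf_digraph H
    unfolding H_def by (rule wellformed_induce_subgraph)
  have "y \<in> verts H" using assms by (simp add: H_def)
  then show ?thesis
    using that[of "H.scc_of y"] H.scc_of_in_sccs_verts H.in_scc_of_self by (simp add: star_components_def flip: H_def)
qed

locale conjugated = raag +
  fixes \<phi> :: "'a word set \<Rightarrow> 'a word set" and v :: "'a \<Rightarrow> 'a word set"
  assumes conjugating: "conjugating \<phi>"
    and shortest: "shortest_conjugators \<phi> v"
begin

lemma auto_phi: "\<phi> \<in> auto P"
  using conjugating by (simp add: conjugating_def)

lemma v_closed [simp]: "x \<in> X \<Longrightarrow> v x \<in> G"
  using shortest by (simp add: shortest_conjugators_def)

lemma phi_gen: "x \<in> X \<Longrightarrow> \<phi> (gen x) = cj (v x) (gen x)"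
  using shortest by (simp add: shortest_conjugators_def)

lemma phi_lt: "fst a \<in> X \<Longrightarrow> \<phi> (lt a) = cj (v (fst a)) (lt a)"
  using phi_gen by (cases a; cases "snd a") (auto simp: auto_iv auto_phi cj_iv)

text \<open>A last letter of \<open>v x\<close> in the star of \<open>x\<close> commutes with
  \<open>gen x\<close> and could be dropped from the conjugator, contradicting minimal
  length.\<close>

lemma v_reduced:
  assumes "x \<in> X"
  shows "reduced_at x (v x)"
  unfolding reduced_at_def
proof (intro conjI allI impI notI)
  fix a assume a: "rend a (v x)" and s: "sim x (fst a)"
  have X: "fst a \<in> X" using a rend_X by blast
  have c: "lt a \<cdot> gen x = gen x \<cdot> lt a" using lt_gen_commute[OF sim_sym[OF s] X] .
  have "iv (lt a) \<cdot> gen x = gen x \<cdot> iv (lt a)"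
    using lt_gen_commute[of "flip a" x] sim_sym[OF s] X by (simp add: lt_flip)
  then have "cj (iv (lt a)) (gen x) = gen x" using X assms by (simp add: cj_commute)
  then have "\<phi> (gen x) = cj (v x \<cdot> iv (lt a)) (gen x)"
    using X assms cj_cj[of "v x" "iv (lt a)" "gen x"] by (simp add: phi_gen)
  then have "len (v x) \<le> len (v x \<cdot> iv (lt a))"
    using shortest assms X unfolding shortest_conjugators_def by simp
  then show False using a by (simp add: rend_def)
qed (use assms in simp)

text \<open>Both \<open>v x\<close> and \<open>v y\<close> differ from a conjugator common to
  \<open>x\<close> and \<open>y\<close> by centralising elements, which
  \<open>centralizer_gen\<close> places in the star subgroups.\<close>

lemma common_conjugator:
  assumes "x \<in> X" "y \<in> X" "sim x y"
  obtains p q where "p \<in> sub (star x)" "q \<in> sub (star y)" "v x \<cdot> p = v y \<cdot> q"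
    "\<phi> (gen x) = cj (v x \<cdot> p) (gen x)"
proof -
  obtain g where g: "g \<in> G" "\<phi> (gen x) = cj g (gen x)" "\<phi> (gen y) = cj g (gen y)"
    using conjugating assms unfolding conjugating_def by blast
  have 1: "iv (v z) \<cdot> g \<in> sub (star z)" if "z \<in> X" "\<phi> (gen z) = cj g (gen z)" for z
    using cj_eqD[of "v z" g "gen z"] that phi_gen[of z] g
    by (intro centralizer_gen) simp_all
  show ?thesis
    using that[OF 1[OF assms(1) g(2)] 1[OF assms(2) g(3)]] assms g by (simp add: mul_iv_cancel)
qed

lemma v_pre_mul: "x \<in> X \<Longrightarrow> p \<in> sub (star x) \<Longrightarrow> pre (v x) (v x \<cdot> p)"
  using reduced_at_pre v_reduced by blast

text \<open>The left part of \<open>\<phi> (lt a)\<close>, which is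
  \<open>v (fst a) \<cdot> lt a \<cdot> iv (v (fst a))\<close>. Its only last letter is
  \<open>a\<close>.\<close>

definition pp :: "'a \<times> bool \<Rightarrow> 'a word set" where
  "pp a = v (fst a) \<cdot> lt a"

lemma pp_closed [simp]: "fst a \<in> X \<Longrightarrow> pp a \<in> G"
  by (simp add: pp_def)

lemma rend_pp: "fst a \<in> X \<Longrightarrow> rend c (pp a) \<longleftrightarrow> c = a"
  unfolding pp_def by (intro rend_reduced_at v_reduced)

lemma len_pp: "fst a \<in> X \<Longrightarrow> len (pp a) = Suc (len (v (fst a)))"
  unfolding pp_def by (intro len_reduced_at_lt v_reduced)

text \<open>Writing \<open>h\<close> as \<open>v (fst a) \<cdot> k\<close>, the hypothesis says that
  \<open>k\<close> does not begin with \<open>flip a\<close>. Hence nothing cancels when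
  \<open>lt a\<close> is inserted in front of \<open>k\<close>.\<close>

lemma ping:
  assumes "fst a \<in> X" "h \<in> G" "\<not> pre (pp (flip a)) h"
  shows "pre (pp a) (\<phi> (lt a) \<cdot> h)"
proof -
  let ?v = "v (fst a)"
  define k where "k = iv ?v \<cdot> h"
  have k: "k \<in> G" "h = ?v \<cdot> k" using assms by (simp_all add: k_def mul_iv_cancel)
  have "\<not> lend (flip a) k"
  proof
    assume l: "lend (flip a) k"
    then have "\<not> lend (flip (flip a)) (lt a \<cdot> k)" using lend_lt_mul[OF k(1) assms(1)] by simp
    then have "pre (pp (flip a)) (?v \<cdot> (lt (flip a) \<cdot> (lt a \<cdot> k)))"
      using pre_reduced_at[of "flip a" ?v "lt a \<cdot> k"] v_reduced assms(1) k(1) by (simp add: pp_def)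
    then show False using assms k by (simp add: lt_flip gsimps)
  qed
  then have "pre (pp a) (?v \<cdot> (lt a \<cdot> k))"
    using pre_reduced_at[OF v_reduced[OF assms(1)] assms(1) k(1)] by (simp add: pp_def)
  then show ?thesis using assms k by (simp add: phi_lt cj_def gsimps)
qed

text \<open>Seen from \<open>v (fst a)\<close>, the image of \<open>lt c\<close> is a conjugate of
  an element \<open>e\<close> of the link subgroup. Such an element commutes with
  \<open>lt a\<close> and does not affect which letters at \<open>fst a\<close> come first.\<close>

lemma ping_adjacent:
  assumes "adj (fst c) (fst a)" "h \<in> G" "pre (pp a) h"
  shows "pre (pp a) (\<phi> (lt c) \<cdot> h)"
proof -
  let ?y = "fst a" and ?x = "fst c"
  have X: "?x \<in> X" "?y \<in> X" using assms(1) adj_X by auto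
  obtain k where k: "k \<in> G" "h = v ?y \<cdot> (lt a \<cdot> k)" "\<not> lend (flip a) k"
    using pre_reduced_atD[OF v_reduced[OF X(2)] X(2) assms(2)] assms(3) unfolding pp_def by blast
  obtain p q where pq: "p \<in> sub (star ?x)" "q \<in> sub (star ?y)" "v ?x \<cdot> p = v ?y \<cdot> q"
    "\<phi> (gen ?x) = cj (v ?x \<cdot> p) (gen ?x)"
    by (rule common_conjugator[OF X]) (use assms(1) in \<open>simp add: sim_def\<close>)
  obtain q' and n :: int where q': "q' \<in> sub (link ?y)" "q = q' \<cdot> gen ?y [^]\<^bsub>P\<^esub> n"
    using sub_insert_split[of ?y "link ?y" q] pq(2) X by (auto simp: star_link link_def sim_def)
  have q'G: "q' \<in> G" using q'(1) sub_closed[OF link_subset] by blast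
  define e where "e = cj q' (lt c)"
  have "lt c \<in> sub (link ?y)" using assms(1) adj_sym X by (intro lt_in_sub) (auto simp: link_def)
  then have e: "e \<in> sub (link ?y)"
    using q'(1) sub_subgroup[OF link_subset[of ?y]]
    by (simp add: e_def cj_def subgroup.m_closed subgroup.m_inv_closed)
  then have eG: "e \<in> G" using sub_closed[OF link_subset] by blast
  have "gen ?x \<cdot> gen ?y = gen ?y \<cdot> gen ?x" using gen_commute assms(1) by (simp add: sim_def)
  then have "gen ?y \<in> {h \<in> G. gen ?x \<cdot> h = h \<cdot> gen ?x}" using X by simp
  then have "gen ?y [^]\<^bsub>P\<^esub> n \<in> {h \<in> G. gen ?x \<cdot> h = h \<cdot> gen ?x}"
    by (intro grp.subgroup_int_pow_closed centralizer_subgroup gen_closed X(1))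
  then have "cj q (gen ?x) = cj q' (gen ?x)"
    using X q'G cj_cj[of q' "gen ?y [^]\<^bsub>P\<^esub> n" "gen ?x"] by (simp add: q'(2) cj_commute)
  then have "\<phi> (gen ?x) = cj (v ?y) (cj q' (gen ?x))"
    using pq q' q'G X cj_cj[of "v ?y" q "gen ?x"] by simp
  then have "\<phi> (lt c) = cj (v ?y) e"
    unfolding e_def using X q'G by (cases c; cases "snd c") (auto simp: auto_iv auto_phi cj_iv)
  then have "\<phi> (lt c) \<cdot> h = v ?y \<cdot> (e \<cdot> (lt a \<cdot> k))"
    using k X eG by (simp add: cj_def gsimps)
  moreover have "lt a \<cdot> e = e \<cdot> lt a"
    by (rule sub_commute[OF _ link_subset _ e])
      (simp_all add: X lt_gen_commute link_def sim_def)
  then have "e \<cdot> (lt a \<cdot> k) = lt a \<cdot> (e \<cdot> k)"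
    using k X eG by (simp flip: grp.m_assoc)
  ultimately show ?thesis
    using pre_reduced_at[OF v_reduced[OF X(2)] X(2), of "e \<cdot> k"] k eG e lend_sub_link[OF e k(1), of "flip a"]
    by (simp add: pp_def)
qed

text \<open>Ping-pong on the sets of elements with prefix \<open>pp a\<close>: for distinct letters that are not
  adjacent these sets are disjoint, and for adjacent letters the image of one preserves the set of
  the other.\<close>

lemma lend_iff_pre_pp:
  assumes indep: "\<And>a y. fst a \<in> X \<Longrightarrow> y \<in> X \<Longrightarrow> \<not> pre (pp a) (v y)"
    and "u \<in> G" "fst b \<in> X"
  shows "lend b u \<longleftrightarrow> pre (pp b) (\<phi> u)"
  using assms(2,3)
proof (induction "len u" arbitrary: u b rule: less_induct)
  case less
  have split: "\<exists>u'. u' \<in> G \<and> u = lt c \<cdot> u' \<and> len u' < len u \<and> \<not> lend (flip c) u' \<and> \<phi> u = \<phi> (lt c) \<cdot> \<phi> u'"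
    if c: "lend c u" for c
  proof -
    have X: "fst c \<in> X" using lend_X c by blast
    define u' where "u' = iv (lt c) \<cdot> u"
    have u': "u' \<in> G" "u = lt c \<cdot> u'" using X less.prems by (simp_all add: u'_def mul_iv_cancel)
    moreover have "len u' < len u" using c by (simp add: lend_def u'_def)
    moreover have "\<not> lend (flip c) u'" using c u' X lend_lt_mul by simp
    moreover have "\<phi> u = \<phi> (lt c) \<cdot> \<phi> u'" using u' X auto_phi by (simp add: auto_mult)
    ultimately show ?thesis by blast
  qed
  \<comment> \<open>After splitting off \<open>c\<close>, the induction hypothesis excludes the
    prefix \<open>pp (flip c)\<close> from \<open>\<phi> u'\<close>, so \<open>ping\<close>
    applies.\<close>
  have a: "pre (pp c) (\<phi> u)" if c: "lend c u" for c
  proof -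
    obtain u' where u': "u' \<in> G" "u = lt c \<cdot> u'" "len u' < len u" "\<not> lend (flip c) u'"
        "\<phi> u = \<phi> (lt c) \<cdot> \<phi> u'"
      using split[OF c] by blast
    have X: "fst c \<in> X" using lend_X c by blast
    then have "\<not> pre (pp (flip c)) (\<phi> u')" using less.hyps[OF u'(3,1), of "flip c"] u'(4) by simp
    then show ?thesis using ping[OF X, of "\<phi> u'"] u' auto_phi by simp
  qed
  have b: "\<not> pre (pp b) (\<phi> u)" if nb: "\<not> lend b u"
  proof (cases "u = \<one>\<^bsub>P\<^esub>")
    case True
    then show ?thesis using len_pp[OF less.prems(2)] by (simp add: auto_one auto_phi pre_def)
  next
    case False
    then obtain c where c: "lend c u" using lend_exists less.prems by blast
    have cX: "fst c \<in> X" using lend_X c by blast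
    have bc: "b \<noteq> c" using nb c by blast
    show ?thesis
    proof (cases "adj (fst b) (fst c)")
      case True
      obtain u' where u': "u' \<in> G" "u = lt c \<cdot> u'" "len u' < len u" "\<not> lend (flip c) u'"
        "\<phi> u = \<phi> (lt c) \<cdot> \<phi> u'"
        using split[OF c] by blast
      have "\<not> lend b u'" using lend_lt_mul_adj[OF u'(1) True] u'(2) nb by simp
      then have n: "\<not> pre (pp b) (\<phi> u')" using less.hyps[OF u'(3,1) less.prems(2)] by simp
      show ?thesis
      proof
        assume "pre (pp b) (\<phi> u)"
        \<comment> \<open>Multiplying back by the image of \<open>flip c\<close> would transport the
          prefix from \<open>\<phi> u\<close> to \<open>\<phi> u'\<close>.\<close>
        then have "pre (pp b) (\<phi> (lt (flip c)) \<cdot> \<phi> u)"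
          using ping_adjacent[of "flip c" b "\<phi> u"] adj_sym[OF True] less.prems auto_phi by simp
        then show False using n u' cX auto_phi by (simp add: lt_flip auto_iv iv_mul_cancel)
      qed
    next
      case False
      have ne: "pp b \<noteq> pp c" using rend_pp[OF less.prems(2)] rend_pp[OF cX] bc by metis
      show ?thesis
      proof
        assume "pre (pp b) (\<phi> u)"
        \<comment> \<open>Now \<open>\<phi> u\<close> has both prefixes \<open>pp b\<close> and
          \<open>pp c\<close>. By \<open>pre_disjoint\<close> one of them is a prefix of the
          conjugator inside the other, which \<open>indep\<close> forbids.\<close>
        then have "pre (pp c) (pp b \<cdot> iv (lt b)) \<or> pre (pp b) (pp c \<cdot> iv (lt c))"
          using pre_disjoint[of "pp b" "pp c" "\<phi> u" b c] a[OF c] rend_pp less.prems cX False bc ne auto_phi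
          by (metis auto_closed pp_closed)
        then show False using indep[OF cX less.prems(2)] indep[OF less.prems(2) cX] less.prems cX
          by (auto simp: pp_def gsimps)
      qed
    qed
  qed
  show ?case using a b by blast
qed

text \<open>By surjectivity \<open>gen x\<close> is some \<open>\<phi> u\<close>. A first letter
  \<open>b\<close> of \<open>u\<close> makes \<open>pp b\<close> a prefix of an element of length
  one; so the conjugator at \<open>fst b\<close> is trivial and \<open>b\<close> is the letter
  \<open>gen x\<close>.\<close>

lemma phi_identity:
  assumes "\<And>a y. fst a \<in> X \<Longrightarrow> y \<in> X \<Longrightarrow> \<not> pre (pp a) (v y)" "x \<in> X"
  shows "\<phi> (gen x) = gen x"
proof -
  obtain u where u: "u \<in> G" "\<phi> u = gen x"
    using autoD(3)[OF auto_phi] assms(2) gen_closed unfolding bij_betw_def by (metis imageE)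
  have l1: "len (gen x) = 1" using len_lt[of "(x, True)"] assms(2) by simp
  have "u \<noteq> \<one>\<^bsub>P\<^esub>" using u l1 auto_one[OF auto_phi] by (metis len_one zero_neq_one)
  then obtain b where b: "lend b u" using lend_exists u by blast
  have bX: "fst b \<in> X" using b lend_X by blast
  have "pre (pp b) (gen x)" using lend_iff_pre_pp[OF assms(1) u(1) bX] b u by simp
  then have "len (v (fst b)) = 0" "len (iv (pp b) \<cdot> gen x) = 0" using l1 len_pp[OF bX] by (auto simp: pre_def)
  then have v1: "v (fst b) = \<one>\<^bsub>P\<^esub>" and e: "iv (pp b) \<cdot> gen x = \<one>\<^bsub>P\<^esub>"
    using bX assms(2) by (simp_all add: len_eq_0_iff)
  have "gen x = pp b \<cdot> (iv (pp b) \<cdot> gen x)" using bX assms(2) by (simp add: mul_iv_cancel)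
  also have "\<dots> = lt b" unfolding e using bX by (simp add: pp_def v1)
  finally have "lend b (gen x)" using bX lend_lt_mul[of "\<one>\<^bsub>P\<^esub>" b] by (simp add: lend_def)
  then have "fst b = x" using sub_lend[of "{x}" "gen x" b] gen_in_sub assms(2) by auto
  then show ?thesis using v1 phi_gen[OF assms(2)] assms(2) by (simp add: cj_one)
qed

text \<open>The prefix passes from \<open>v y\<close> to \<open>v y \<cdot> p\<close>, which equals
  \<open>v z \<cdot> q\<close>. As \<open>a\<close> does not lie over the star of \<open>z\<close>,
  \<open>pre_strip\<close> removes \<open>q\<close>.\<close>

lemma pre_pp_propagate:
  assumes "fst a \<in> X" "y \<in> X" "z \<in> X" "sim y z" "pre (pp a) (v y)" "\<not> sim (fst a) z"
  shows "pre (pp a) (v z)"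
proof -
  obtain p q where pq: "p \<in> sub (star y)" "q \<in> sub (star z)" "v y \<cdot> p = v z \<cdot> q"
      "\<phi> (gen y) = cj (v y \<cdot> p) (gen y)"
    by (rule common_conjugator[OF assms(2-4)])
  have "p \<in> G" "q \<in> G" using pq(1,2) sub_closed[OF star_subset] by blast+
  then have "pre (pp a) (v z \<cdot> q)"
    using pre_trans[of "pp a" "v y" "v y \<cdot> p"] v_pre_mul[OF assms(2) pq(1)] assms pq(3) by simp
  moreover have "fst c \<notin> star z" if "rend c (pp a)" for c
    using that assms(1,6) sim_sym[of z "fst a"] by (auto simp: rend_pp star_def)
  ultimately show ?thesis
    using pre_strip[OF star_subset _ _ pq(2)] assms(1,3) by simp
qed

text \<open>Otherwise the prefix could be carried over to \<open>v (fst a)\<close>, which is shorter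
  than \<open>pp a\<close>.\<close>

lemma pre_pp_not_sim:
  assumes "fst a \<in> X" "y \<in> X" "pre (pp a) (v y)"
  shows "\<not> sim (fst a) y"
proof
  let ?x = "fst a"
  assume s: "sim ?x y"
  obtain p q where pq: "p \<in> sub (star ?x)" "q \<in> sub (star y)" "v ?x \<cdot> p = v y \<cdot> q"
      "\<phi> (gen ?x) = cj (v ?x \<cdot> p) (gen ?x)"
    by (rule common_conjugator[OF assms(1,2) s])
  obtain p' and n :: int where p': "p' \<in> sub (link ?x)" "p = p' \<cdot> gen ?x [^]\<^bsub>P\<^esub> n"
    using sub_insert_split[of ?x "link ?x" p] pq(1) assms by (auto simp: star_link link_def sim_def)
  have G: "p' \<in> G" "q \<in> G" using p'(1) pq(2) sub_closed[OF link_subset] sub_closed[OF star_subset] by blast+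
  \<comment> \<open>The letter \<open>a\<close> lies over the star of \<open>?x\<close> but not over
    its link. Moving the power of \<open>gen ?x\<close> to the other side leaves \<open>p'\<close>
    in the link subgroup, where \<open>pre_strip\<close> applies.\<close>
  let ?q = "q \<cdot> gen ?x [^]\<^bsub>P\<^esub> (- n)"
  have "gen ?x \<in> sub (star y)" using s sim_sym assms(1) by (intro gen_in_sub) (auto simp: star_def)
  then have q: "?q \<in> sub (star y)"
    using pq(2) sub_subgroup[OF star_subset[of y]] grp.subgroup_int_pow_closed by (metis subgroup.m_closed)
  have "v y \<cdot> ?q = v ?x \<cdot> p \<cdot> gen ?x [^]\<^bsub>P\<^esub> (- n)"
    unfolding pq(3) using assms G by (simp add: grp.m_assoc)
  also have "\<dots> = v ?x \<cdot> p'"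
    using assms G by (simp add: p'(2) grp.int_pow_neg gsimps)
  finally have eq: "v y \<cdot> ?q = v ?x \<cdot> p'" .
  then have "pre (pp a) (v ?x \<cdot> p')"
    using pre_trans[of "pp a" "v y" "v y \<cdot> ?q"] v_pre_mul[OF assms(2) q] assms G by simp
  moreover have "fst c \<notin> link ?x" if "rend c (pp a)" for c
    using that assms(1) adj_irrefl by (simp add: rend_pp link_def)
  ultimately have "pre (pp a) (v ?x)"
    using pre_strip[OF link_subset _ _ p'(1)] assms(1) by simp
  then show False using len_pp[OF assms(1)] by (simp add: pre_def)
qed

lemma pre_pp_component:
  assumes "fst a \<in> X" "pre (pp a) (v y)" "C \<in> star_components \<Gamma> (fst a)" "y \<in> C" "z \<in> C"
  shows "pre (pp a) (v z)"
proof -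
  have C: "C \<subseteq> X" using star_component_subset[OF pair_graph assms(3)] by blast
  have "z \<in> X \<and> pre (pp a) (v z)"
  proof (rule star_component_induct[OF assms(3-5)])
    fix u w assume "u \<in> X \<and> pre (pp a) (v u)" "adj u w" "w \<notin> ortho \<Gamma> {fst a}"
    then show "w \<in> X \<and> pre (pp a) (v w)"
      using pre_pp_propagate[of a u w] assms(1) adj_X(2)[of u w] by (simp add: ortho_sing sim_def)
  qed (use assms C in auto)
  then show ?thesis ..
qed

text \<open>With \<open>v z\<close> of the form \<open>v ?x \<cdot> (lt a \<cdot> k)\<close>,
  multiplying by \<open>\<phi> (lt (flip a))\<close> on the left gives
  \<open>v ?x \<cdot> k\<close>, so the letter \<open>a\<close> disappears.\<close>

lemma shorter_conjugator:
  assumes "fst a \<in> X" "z \<in> X" "pre (pp a) (v z)"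
  obtains g where "g \<in> G" "\<phi> (cj (lt (flip a)) (gen z)) = cj g (gen z)" "len g < len (v z)"
proof -
  let ?x = "fst a"
  obtain k where k: "k \<in> G" "v z = v ?x \<cdot> (lt a \<cdot> k)" "len (v z) = Suc (len (v ?x) + len k)"
    using pre_reduced_atD[OF v_reduced[OF assms(1)] assms(1), of "v z"] assms unfolding pp_def by auto
  have "\<phi> (cj (lt (flip a)) (gen z)) = cj (\<phi> (lt (flip a)) \<cdot> v z) (gen z)"
    using assms auto_phi by (simp add: auto_cj phi_gen cj_cj)
  also have "\<phi> (lt (flip a)) \<cdot> v z = v ?x \<cdot> k"
    using assms k by (simp add: phi_lt) (simp add: lt_flip cj_def gsimps)
  finally show ?thesis
    using that[of "v ?x \<cdot> k"] k assms len_mul_le[of "v ?x" k] by simp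
qed

end

context raag
begin

section \<open>Elementary conjugating automorphisms and Laurence's theorem\<close>

lemma elem_conj:
  assumes "x \<in> X" "C \<in> star_components \<Gamma> x"
  shows "elem_conj \<Gamma> C x \<in> auto P"
    and "y \<in> X \<Longrightarrow> elem_conj \<Gamma> C x (gen y) = (if y \<in> C then cj (iv (gen x)) (gen y) else gen y)"
  using theI'[OF ex1_elem_conj[OF pair_graph assms]] assms(1)
  unfolding elem_conj_def[symmetric] by (auto simp: conj_by_cj)


lemma A_inv_apply:
  assumes "\<phi> \<in> auto P" "h \<in> G"
  shows "(inv\<^bsub>A\<^esub> \<phi>) (\<phi> h) = h" "\<phi> ((inv\<^bsub>A\<^esub> \<phi>) h) = h"
proof -
  have a: "inv\<^bsub>A\<^esub> \<phi> \<in> auto P" using agrp.inv_closed[of \<phi>] assms(1) by simp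
  have "(\<phi> \<otimes>\<^bsub>A\<^esub> inv\<^bsub>A\<^esub> \<phi>) h = h" "(inv\<^bsub>A\<^esub> \<phi> \<otimes>\<^bsub>A\<^esub> \<phi>) h = h"
    using agrp.r_inv[of \<phi>] agrp.l_inv[of \<phi>] assms by (simp_all add: one_A)
  then show "(inv\<^bsub>A\<^esub> \<phi>) (\<phi> h) = h" "\<phi> ((inv\<^bsub>A\<^esub> \<phi>) h) = h"
    using mult_A_apply[OF assms(1) a assms(2)] mult_A_apply[OF a assms] by simp_all
qed

lemma A_inv_auto [simp]: "\<phi> \<in> auto P \<Longrightarrow> inv\<^bsub>A\<^esub> \<phi> \<in> auto P"
  using agrp.inv_closed[of \<phi>] by simp

lemma elem_conj_inv_gen:
  assumes "x \<in> X" "C \<in> star_components \<Gamma> x" "y \<in> X"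
  shows "(inv\<^bsub>A\<^esub> (elem_conj \<Gamma> C x)) (gen y) = (if y \<in> C then cj (gen x) (gen y) else gen y)"
proof -
  let ?\<alpha> = "elem_conj \<Gamma> C x" and ?\<beta> = "inv\<^bsub>A\<^esub> (elem_conj \<Gamma> C x)"
  note a = elem_conj[OF assms(1,2)]
  have b: "?\<beta> \<in> auto P" using a(1) by simp
  have fix_out: "?\<beta> (gen z) = gen z" if "z \<in> X" "z \<notin> C" for z
    using A_inv_apply(1)[OF a(1), of "gen z"] a(2)[of z] that by simp
  have "x \<notin> C" using star_component_subset[OF pair_graph assms(2)] assms(1) ortho_sing sim_refl by auto
  then have bx: "?\<beta> (gen x) = gen x" using fix_out assms(1) by simp
  show ?thesis
  proof (cases "y \<in> C")
    case True
    have "gen y = ?\<beta> (cj (iv (gen x)) (gen y))"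
      using A_inv_apply(1)[OF a(1), of "gen y"] a(2)[of y] assms(3) True by simp
    also have "\<dots> = cj (iv (gen x)) (?\<beta> (gen y))"
      using b bx assms by (simp add: auto_cj auto_iv)
    finally have "cj (gen x) (gen y) = cj (gen x) (cj (iv (gen x)) (?\<beta> (gen y)))" by simp
    then show ?thesis using True assms b by (simp add: cj_cj cj_one)
  next
    case False
    then show ?thesis using fix_out assms(3) by simp
  qed
qed

lemma elem_conj_in_Conj: "x \<in> X \<Longrightarrow> C \<in> star_components \<Gamma> x \<Longrightarrow> elem_conj \<Gamma> C x \<in> Conj \<Gamma>"
  unfolding Conj_def by (rule generate.incl) blast

lemma Conj_subgroup: "subgroup (Conj \<Gamma>) A"
  unfolding Conj_def using elem_conj(1) by (intro agrp.generate_is_subgroup) auto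

text \<open>Treats an elementary conjugating automorphism and its inverse together: the sign of
  \<open>a\<close> decides between them.\<close>

lemma elem_conj_signed:
  assumes "fst a \<in> X" "C \<in> star_components \<Gamma> (fst a)"
  obtains \<alpha> where "\<alpha> \<in> Conj \<Gamma>" "\<alpha> \<in> auto P"
    "\<And>y. y \<in> X \<Longrightarrow> \<alpha> (gen y) = (if y \<in> C then cj (lt (flip a)) (gen y) else gen y)"
proof -
  let ?\<alpha> = "elem_conj \<Gamma> C (fst a)"
  have C: "?\<alpha> \<in> Conj \<Gamma>" "inv\<^bsub>A\<^esub> ?\<alpha> \<in> Conj \<Gamma>"
    using elem_conj_in_Conj[OF assms] subgroup.m_inv_closed[OF Conj_subgroup] by blast+
  obtain x b where xb: "a = (x, b)" by (cases a)
  show ?thesis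
  proof (cases b)
    case True
    show ?thesis
      by (rule that[OF C(1) elem_conj(1)[OF assms]])
        (use True xb assms elem_conj(2)[OF assms] in \<open>simp add: lt_flip\<close>)
  next
    case False
    show ?thesis
      by (rule that[OF C(2) A_inv_auto[OF elem_conj(1)[OF assms]]])
        (use False xb assms elem_conj_inv_gen[OF assms] in \<open>simp add: lt_flip\<close>)
  qed
qed

lemma star_boundary:
  assumes "x \<in> X" "C \<in> star_components \<Gamma> x" "y \<in> C" "sim y z"
  shows "z \<in> C \<or> z \<in> X \<and> sim x z"
proof -
  have "z \<in> C \<or> z \<in> ortho \<Gamma> {x}"
    using star_component_adjacent[OF pair_graph assms(1-3), of z] assms(3,4) by (auto simp: sim_def)
  then show ?thesis using ortho_sing[OF assms(1)] by simp
qed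

text \<open>If an edge leaves \<open>C\<close>, its outer end lies in the star of
  \<open>fst a\<close> and is fixed by conjugation with \<open>lt a\<close>, so this conjugator
  serves both ends.\<close>

lemma conjugating_partial:
  assumes "fst a \<in> X" "C \<in> star_components \<Gamma> (fst a)" "\<alpha> \<in> auto P"
    and \<alpha>: "\<And>y. y \<in> X \<Longrightarrow> \<alpha> (gen y) = (if y \<in> C then cj (lt a) (gen y) else gen y)"
  shows "conjugating \<alpha>"
  unfolding conjugating_def
proof (intro conjI ballI impI)
  fix y z assume yz: "y \<in> X" "z \<in> X" "sim y z"
  have fixed: "cj (lt a) (gen w) = gen w" if "sim (fst a) w" "w \<in> X" for w
    using cj_commute[OF _ _ lt_gen_commute] that assms(1) by simp
  have "\<alpha> (gen y) = cj (lt a) (gen y) \<and> \<alpha> (gen z) = cj (lt a) (gen z)" if "y \<in> C \<or> z \<in> C"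
    using that \<alpha> yz fixed star_boundary[OF assms(1,2), of y z] star_boundary[OF assms(1,2), of z y] sim_sym
    by metis
  moreover have "\<alpha> (gen y) = cj \<one>\<^bsub>P\<^esub> (gen y) \<and> \<alpha> (gen z) = cj \<one>\<^bsub>P\<^esub> (gen z)" if "\<not> (y \<in> C \<or> z \<in> C)"
    using that \<alpha> yz by (simp add: cj_one)
  ultimately show "\<exists>g\<in>G. \<alpha> (gen y) = cj g (gen y) \<and> \<alpha> (gen z) = cj g (gen z)"
    using assms(1) lt_closed grp.one_closed by blast
qed (rule assms(3))

text \<open>Laurence's theorem, by induction on the total length of the conjugators.\<close>

theorem conjugating_in_Conj:
  assumes "conjugating \<phi>" "shortest_conjugators \<phi> v"
  shows "\<phi> \<in> Conj \<Gamma>"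
  using assms
proof (induction "\<Sum>x\<in>X. len (v x)" arbitrary: \<phi> v rule: less_induct)
  case less
  interpret conjugated \<Gamma> \<phi> v by unfold_locales (rule less.prems)+
  show ?case
  proof (cases "\<exists>a y. fst a \<in> X \<and> y \<in> X \<and> pre (pp a) (v y)")
    case False
    have "\<phi> = \<one>\<^bsub>A\<^esub>"
    proof (rule auto_eqI[OF auto_phi])
      show "\<one>\<^bsub>A\<^esub> \<in> auto P" using agrp.one_closed by simp
      fix x assume x: "x \<in> X"
      then have "\<phi> (gen x) = gen x" using phi_identity False by blast
      then show "\<phi> (gen x) = \<one>\<^bsub>A\<^esub> (gen x)" using x by (simp add: one_A)
    qed
    then show ?thesis using subgroup.one_closed[OF Conj_subgroup] by simp
  next
    case True
    then obtain a y where ay: "fst a \<in> X" "y \<in> X" "pre (pp a) (v y)" by blast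
    then have "y \<notin> ortho \<Gamma> {fst a}" using pre_pp_not_sim[OF ay] by (simp add: ortho_sing)
    then obtain C where C: "C \<in> star_components \<Gamma> (fst a)" "y \<in> C"
      using star_component_exists[OF ay(2)] by blast
    obtain \<alpha> where \<alpha>: "\<alpha> \<in> Conj \<Gamma>" "\<alpha> \<in> auto P"
      "\<And>y. y \<in> X \<Longrightarrow> \<alpha> (gen y) = (if y \<in> C then cj (lt (flip a)) (gen y) else gen y)"
      using elem_conj_signed[OF ay(1) C(1)] by blast
    have ca: "conjugating \<alpha>"
      by (rule conjugating_partial[of "flip a"]) (use ay C \<alpha> in simp_all)
    \<comment> \<open>Applying \<open>\<alpha>\<close> first conjugates the generators in
      \<open>C\<close> by the inverse of \<open>lt a\<close>, so that \<open>\<phi>\<close> can then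
      cancel the common prefix.\<close>
    define \<psi> where "\<psi> = \<alpha> \<otimes>\<^bsub>A\<^esub> \<phi>"
    have c\<psi>: "conjugating \<psi>" unfolding \<psi>_def using conjugating_mult[OF ca conjugating] .
    obtain w where w: "shortest_conjugators \<psi> w" using shortest_conjugators_exist[OF c\<psi>] by blast
    have \<psi>_gen: "\<psi> (gen z) = \<phi> (\<alpha> (gen z))" if "z \<in> X" for z
      unfolding \<psi>_def using mult_A_apply[OF \<alpha>(2) auto_phi] that by simp
    have w_le: "len (w z) \<le> len g" if "z \<in> X" "g \<in> G" "\<psi> (gen z) = cj g (gen z)" for z g
      using w that unfolding shortest_conjugators_def by blast
    have lessC: "len (w z) < len (v z)" if z: "z \<in> C" for z
    proof -
      have zX: "z \<in> X" using star_component_subset[OF pair_graph C(1)] z by blast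
      obtain g where "g \<in> G" "\<phi> (cj (lt (flip a)) (gen z)) = cj g (gen z)" "len g < len (v z)"
        using shorter_conjugator[OF ay(1) zX pre_pp_component[OF ay(1,3) C z]] by blast
      then show ?thesis using w_le[OF zX, of g] \<psi>_gen[OF zX] \<alpha>(3)[OF zX] z by simp
    qed
    \<comment> \<open>Outside \<open>C\<close> the old conjugators still work, and inside they
      shrink. The component contains \<open>y\<close>, so the sum drops strictly.\<close>
    have "(\<Sum>x\<in>X. len (w x)) < (\<Sum>x\<in>X. len (v x))"
    proof (rule sum_strict_mono_ex1)
      show "\<forall>z\<in>X. len (w z) \<le> len (v z)"
      proof
        fix z assume z: "z \<in> X"
        show "len (w z) \<le> len (v z)"
        proof (cases "z \<in> C")
          case True
          then show ?thesis using lessC by (simp add: less_imp_le)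
        next
          case False
          then show ?thesis using w_le[OF z v_closed[OF z]] \<psi>_gen[OF z] \<alpha>(3)[OF z] phi_gen[OF z] by simp
        qed
      qed
      show "\<exists>z\<in>X. len (w z) < len (v z)" using lessC C(2) ay(2) by blast
    qed simp
    then have "\<psi> \<in> Conj \<Gamma>" using less.hyps c\<psi> w by blast
    then have "inv\<^bsub>A\<^esub> \<alpha> \<otimes>\<^bsub>A\<^esub> \<psi> \<in> Conj \<Gamma>"
      using \<alpha>(1) subgroup.m_closed[OF Conj_subgroup] subgroup.m_inv_closed[OF Conj_subgroup] by blast
    moreover have "inv\<^bsub>A\<^esub> \<alpha> \<otimes>\<^bsub>A\<^esub> \<psi> = \<phi>"
      unfolding \<psi>_def using agrp.inv_solve_left[of \<alpha> \<phi>] \<alpha>(2) auto_phi by (simp flip: agrp.m_assoc)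
    ultimately show ?thesis by simp
  qed
qed


section \<open>Exponents\<close>

text \<open>The exponent sum of \<open>x\<close>, a coordinate on the abelianisation, obtained from
  the universal property; its values on \<open>G\<close> are determined by those on the
  generators.\<close>

definition expo :: "'a \<Rightarrow> 'a word set \<Rightarrow> int" where
  "expo x = (SOME h. h \<in> hom P integer_group \<and> (\<forall>y\<in>X. h (gen y) = of_bool (y = x)))"

lemma expo_spec: "expo x \<in> hom P integer_group \<and> (\<forall>y\<in>X. expo x (gen y) = of_bool (y = x))"
proof -
  obtain h where "h \<in> hom P integer_group" "\<And>y. y \<in> X \<Longrightarrow> h (gen y) = of_bool (y = x)"
    by (rule pc_hom_exists[of integer_group "\<lambda>y. of_bool (y = x)" \<Gamma>]) auto
  then show ?thesis
    unfolding expo_def by (intro someI[of "\<lambda>h. h \<in> hom P integer_group \<and> (\<forall>y\<in>X. h (gen y) = of_bool (y = x))" h]) simp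
qed

lemma expo_hom: "expo x \<in> hom P integer_group"
  using expo_spec by blast

lemma expo_gen: "y \<in> X \<Longrightarrow> expo x (gen y) = of_bool (y = x)"
  using expo_spec by blast

lemma expo_group_hom: "group_hom P integer_group (expo x)"
  by (intro group_hom.intro group_hom_axioms.intro expo_hom) auto

lemma expo_mult: "g \<in> G \<Longrightarrow> h \<in> G \<Longrightarrow> expo x (g \<cdot> h) = expo x g + expo x h"
  using hom_mult[OF expo_hom] by simp

lemma expo_one: "expo x \<one>\<^bsub>P\<^esub> = 0"
  using group_hom.hom_one[OF expo_group_hom] by simp

lemma expo_iv: "g \<in> G \<Longrightarrow> expo x (iv g) = - expo x g"
  using group_hom.hom_inv[OF expo_group_hom] by simp

lemma expo_int_pow: "g \<in> G \<Longrightarrow> expo x (g [^]\<^bsub>P\<^esub> (n::int)) = n * expo x g"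
  using group_hom.hom_int_pow[OF expo_group_hom] by simp

lemma expo_cj: "g \<in> G \<Longrightarrow> h \<in> G \<Longrightarrow> expo x (cj g h) = expo x h"
  by (simp add: cj_def expo_mult expo_iv)

text \<open>Equality in the abelianisation, which is free abelian on \<open>X\<close>.\<close>

definition same_expo :: "'a word set \<Rightarrow> 'a word set \<Rightarrow> bool" where
  "same_expo g h \<longleftrightarrow> (\<forall>x\<in>X. expo x g = expo x h)"

lemma same_expo_sym: "same_expo g h \<Longrightarrow> same_expo h g"
  and same_expo_trans: "same_expo g h \<Longrightarrow> same_expo h k \<Longrightarrow> same_expo g k"
  and same_expo_refl: "same_expo g g"
  by (simp_all add: same_expo_def)

lemma same_expo_cj: "g \<in> G \<Longrightarrow> h \<in> G \<Longrightarrow> same_expo (cj g h) h"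
  by (simp add: same_expo_def expo_cj)

lemma same_expo_homI:
  assumes "\<phi> \<in> hom P P" "\<psi> \<in> hom P P" "\<And>y. y \<in> X \<Longrightarrow> same_expo (\<phi> (gen y)) (\<psi> (gen y))" "g \<in> G"
  shows "same_expo (\<phi> g) (\<psi> g)"
  unfolding same_expo_def
proof
  fix x assume x: "x \<in> X"
  have "(expo x \<circ> \<phi>) g = (expo x \<circ> \<psi>) g"
  proof (rule hom_eqI[OF group_integer_group _ _ _ assms(4)])
    show "expo x \<circ> \<phi> \<in> hom P integer_group" "expo x \<circ> \<psi> \<in> hom P integer_group"
      using assms(1,2) expo_hom hom_compose by blast+
    show "(expo x \<circ> \<phi>) (gen y) = (expo x \<circ> \<psi>) (gen y)" if "y \<in> X" for y
      using assms(3)[OF that] x by (simp add: same_expo_def)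
  qed
  then show "expo x (\<phi> g) = expo x (\<psi> g)" by simp
qed

text \<open>A homomorphism induces a linear map on exponent vectors.\<close>

lemma same_expo_hom:
  assumes \<phi>: "\<phi> \<in> hom P P" and "g \<in> G" "h \<in> G" "same_expo g h"
  shows "same_expo (\<phi> g) (\<phi> h)"
  unfolding same_expo_def
proof
  fix x assume x: "x \<in> X"
  \<comment> \<open>Row \<open>x\<close> of the matrix that \<open>\<phi>\<close> induces on
    exponent vectors; it agrees with \<open>expo x \<circ> \<phi>\<close> because both are
    homomorphisms with the same values on generators.\<close>
  define f where "f k = (\<Sum>y\<in>X. expo x (\<phi> (gen y)) * expo y k)" for k
  have "(expo x \<circ> \<phi>) k = f k" if "k \<in> G" for k
  proof (rule hom_eqI[OF group_integer_group _ _ _ that])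
    show "expo x \<circ> \<phi> \<in> hom P integer_group" using \<phi> expo_hom hom_compose by blast
    show "f \<in> hom P integer_group"
      by (rule homI) (simp_all add: f_def expo_mult distrib_left sum.distrib)
    fix y assume "y \<in> X"
    then have "f (gen y) = (\<Sum>z\<in>X. if z = y then expo x (\<phi> (gen z)) else 0)"
      unfolding f_def by (intro sum.cong) (auto simp: expo_gen)
    then show "(expo x \<circ> \<phi>) (gen y) = f (gen y)" using \<open>y \<in> X\<close> by simp
  qed
  moreover have "f g = f h" using assms(4) by (simp add: f_def same_expo_def)
  ultimately show "expo x (\<phi> g) = expo x (\<phi> h)" using assms(2,3) by simp
qed

lemma expo_sub_outside:
  assumes "Y \<subseteq> X" "y \<in> X" "y \<notin> Y" "g \<in> sub Y"
  shows "expo y g = 0"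
proof -
  have "subgroup {g \<in> G. expo y g = 0} P"
    by (rule subgroup.intro) (simp_all add: subset_eq expo_mult expo_iv expo_one)
  then have "sub Y \<subseteq> {g \<in> G. expo y g = 0}"
    by (rule sub_subset_iff_gens) (use assms in \<open>auto simp: expo_gen\<close>)
  then show ?thesis using assms(4) by blast
qed

definition clique :: "'a set \<Rightarrow> bool" where
  "clique Y \<longleftrightarrow> Y \<subseteq> X \<and> (\<forall>u\<in>Y. \<forall>w\<in>Y. sim u w)"

text \<open>The parabolic subgroup of a clique is free abelian: split off the power of one generator
  \<open>y\<close>. Its exponent is visible to \<open>expo y\<close>, since the other factor
  contributes nothing there.\<close>

lemma clique_expo_zero:
  assumes "finite Y" "clique Y" "g \<in> sub Y" "\<And>x. x \<in> X \<Longrightarrow> expo x g = 0"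
  shows "g = \<one>\<^bsub>P\<^esub>"
  using assms
proof (induction Y arbitrary: g)
  case empty
  then show ?case by (simp add: pc_sub_def grp.generate_empty)
next
  case (insert y Y)
  have Y: "Y \<subseteq> X" "y \<in> X" "insert y Y \<subseteq> X" "clique Y" and s: "\<And>z. z \<in> Y \<Longrightarrow> sim y z"
    using insert.prems(1) by (auto simp: clique_def)
  obtain q and n :: int where q: "q \<in> sub Y" "g = q \<cdot> gen y [^]\<^bsub>P\<^esub> n"
    using sub_insert_split[OF Y(3) s insert.prems(2)] by blast
  have qG: "q \<in> G" using q(1) sub_closed[OF Y(1)] by blast
  have "expo y g = n"
    using q(2) qG Y(2) expo_sub_outside[OF Y(1,2) insert.hyps(2) q(1)]
    by (simp add: expo_mult expo_int_pow expo_gen)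
  then have "n = 0" using insert.prems(3) Y(2) by simp
  then have "g = q" using q(2) qG by simp
  then show ?case using insert.IH[OF Y(4)] q(1) insert.prems(3) by simp
qed

lemma clique_same_expo_eq:
  assumes "clique Y" "g \<in> sub Y" "h \<in> sub Y" "same_expo g h"
  shows "g = h"
proof -
  have Y: "Y \<subseteq> X" "finite Y" using assms(1) finite_subset[OF _ finite_X] by (auto simp: clique_def)
  have G: "g \<in> G" "h \<in> G" using sub_closed[OF Y(1)] assms by blast+
  have "g \<cdot> iv h \<in> sub Y"
    using sub_subgroup[OF Y(1)] assms(2,3) by (simp add: subgroup.m_closed subgroup.m_inv_closed)
  moreover have "expo x (g \<cdot> iv h) = 0" if "x \<in> X" for x
    using assms(4) G that by (simp add: same_expo_def expo_mult expo_iv)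
  ultimately have "g \<cdot> iv h = \<one>\<^bsub>P\<^esub>" using clique_expo_zero[OF Y(2) assms(1)] by blast
  then show ?thesis using G grp.inv_equality grp.inv_inv by (metis grp.inv_closed)
qed


section \<open>Closed sets\<close>

lemma ortho_eq: "Y \<subseteq> X \<Longrightarrow> ortho \<Gamma> Y = {u \<in> X. \<forall>y\<in>Y. sim u y}"
  using graph_dist_le_1_iff[OF pair_graph] by (auto simp: ortho_def sim_def)

lemma ortho_subset: "ortho \<Gamma> Y \<subseteq> X"
  by (auto simp: ortho_def)

lemma ortho_antimono: "Y \<subseteq> Z \<Longrightarrow> ortho \<Gamma> Z \<subseteq> ortho \<Gamma> Y"
  by (auto simp: ortho_def)

lemma cl_subset: "graph_cl \<Gamma> Y \<subseteq> X"
  unfolding graph_cl_def by (rule ortho_subset)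

lemma subset_cl: "Y \<subseteq> X \<Longrightarrow> Y \<subseteq> graph_cl \<Gamma> Y"
  using sim_sym by (auto simp: graph_cl_def ortho_eq ortho_subset)

lemma cl_mono: "Y \<subseteq> Z \<Longrightarrow> graph_cl \<Gamma> Y \<subseteq> graph_cl \<Gamma> Z"
  unfolding graph_cl_def by (intro ortho_antimono)

text \<open>Taking complements reverses inclusions, so a triple complement equals a single
  one.\<close>

lemma ortho_cl: "Y \<subseteq> X \<Longrightarrow> ortho \<Gamma> (graph_cl \<Gamma> Y) = ortho \<Gamma> Y"
  using ortho_antimono[OF subset_cl[of Y]] subset_cl[OF ortho_subset[of Y]]
  unfolding graph_cl_def by blast

lemma cl_closed: "Y \<subseteq> X \<Longrightarrow> graph_cl \<Gamma> Y \<in> closed_sets \<Gamma>"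
  using cl_subset[of Y] ortho_cl[of Y] by (simp add: closed_sets_def graph_cl_def)

lemma closed_subset: "Y \<in> closed_sets \<Gamma> \<Longrightarrow> Y \<subseteq> X"
  by (simp add: closed_sets_def)

lemma cl_least: "Y \<in> closed_sets \<Gamma> \<Longrightarrow> Z \<subseteq> Y \<Longrightarrow> graph_cl \<Gamma> Z \<subseteq> Y"
  using cl_mono[of Z Y] by (auto simp: closed_sets_def)

text \<open>A clique lies in its own complement, hence so does its closure; and elements of the
  closure are adjacent or equal to everything in that complement.\<close>

lemma clique_cl:
  assumes "clique Y"
  shows "clique (graph_cl \<Gamma> Y)"
  unfolding clique_def
proof (intro conjI ballI)
  have Y: "Y \<subseteq> X" using assms by (simp add: clique_def)
  then have "Y \<subseteq> ortho \<Gamma> Y" using assms by (auto simp: clique_def ortho_eq)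
  then have sub: "graph_cl \<Gamma> Y \<subseteq> ortho \<Gamma> Y" unfolding graph_cl_def by (rule ortho_antimono)
  fix u w assume "u \<in> graph_cl \<Gamma> Y" "w \<in> graph_cl \<Gamma> Y"
  then show "sim u w" using sub ortho_eq[OF ortho_subset, of Y] by (auto simp: graph_cl_def)
qed (rule cl_subset)

lemma clique_pair: "x \<in> X \<Longrightarrow> y \<in> X \<Longrightarrow> sim x y \<Longrightarrow> clique {x, y}"
  using sim_sym sim_refl by (auto simp: clique_def)

lemma clique_cl_sing: "x \<in> X \<Longrightarrow> clique (graph_cl \<Gamma> {x})"
  using clique_cl clique_pair[of x x] sim_refl by simp

text \<open>The complement of \<open>x\<close> is closed and contains \<open>y\<close>, so it
  contains the closure of \<open>y\<close>; every element of the closure of \<open>x\<close> is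
  adjacent or equal to all its members.\<close>

lemma cl_sim:
  assumes "x \<in> X" "y \<in> X" "sim x y" "u \<in> graph_cl \<Gamma> {x}" "w \<in> graph_cl \<Gamma> {y}"
  shows "sim u w"
proof -
  have "{y} \<subseteq> ortho \<Gamma> {x}" using assms(1-3) sim_sym by (simp add: ortho_eq)
  then have "graph_cl \<Gamma> {y} \<subseteq> graph_cl \<Gamma> (ortho \<Gamma> {x})" by (rule cl_mono)
  also have "\<dots> = ortho \<Gamma> {x}" using ortho_cl[of "{x}"] assms(1) by (simp add: graph_cl_def)
  finally have "w \<in> ortho \<Gamma> {x}" using assms(5) by blast
  moreover have "graph_cl \<Gamma> {x} = {u \<in> X. \<forall>y\<in>ortho \<Gamma> {x}. sim u y}"
    unfolding graph_cl_def by (rule ortho_eq[OF ortho_subset])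
  ultimately show ?thesis using assms(4) by simp
qed

lemma gen_in_sub_cl: "x \<in> X \<Longrightarrow> gen x \<in> sub (graph_cl \<Gamma> {x})"
  using subset_cl[of "{x}"] by (intro gen_in_sub) simp


section \<open>The stabilisers\<close>

lemma hom_eq_on_sub:
  assumes "Y \<subseteq> X" "\<phi> \<in> hom P P" "\<psi> \<in> hom P P" "\<And>y. y \<in> Y \<Longrightarrow> \<phi> (gen y) = \<psi> (gen y)" "g \<in> sub Y"
  shows "\<phi> g = \<psi> g"
proof -
  interpret p: group_hom P P \<phi> by unfold_locales (rule assms)
  interpret q: group_hom P P \<psi> by unfold_locales (rule assms)
  have "subgroup {g \<in> G. \<phi> g = \<psi> g} P"
    by (rule subgroup.intro) (simp_all add: subset_eq)
  then have "sub Y \<subseteq> {g \<in> G. \<phi> g = \<psi> g}"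
    by (rule sub_subset_iff_gens) (use assms in auto)
  then show ?thesis using assms(5) by blast
qed

lemma hom_image_sub:
  assumes "Y \<subseteq> X" "subgroup H P" "\<phi> \<in> hom P P" "\<And>y. y \<in> Y \<Longrightarrow> \<phi> (gen y) \<in> H"
  shows "\<phi> ` sub Y \<subseteq> H"
proof -
  interpret p: group_hom P P \<phi> by unfold_locales (rule assms)
  have "subgroup {g \<in> G. \<phi> g \<in> H} P"
    by (rule subgroup.intro)
      (simp_all add: subset_eq subgroup.m_closed[OF assms(2)] subgroup.m_inv_closed[OF assms(2)]
        subgroup.one_closed[OF assms(2)])
  then have "sub Y \<subseteq> {g \<in> G. \<phi> g \<in> H}"
    by (rule sub_subset_iff_gens) (use assms in auto)
  then show ?thesis by blast
qed

lemma cj_hom: "g \<in> G \<Longrightarrow> cj g \<in> hom P P"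
  by (rule homI) (simp_all add: cj_mult)

lemma St_conj_iff:
  "\<phi> \<in> St_conj \<Gamma> \<longleftrightarrow> \<phi> \<in> auto P \<and> (\<forall>Y\<in>closed_sets \<Gamma>. \<exists>g\<in>G. \<phi> ` sub Y = cj g ` sub Y)"
proof -
  have "(\<exists>g\<in>G. \<phi> ` S = (\<lambda>h. conj_by P h g) ` S) \<longleftrightarrow> (\<exists>g\<in>G. \<phi> ` S = cj g ` S)" for S
  proof
    assume "\<exists>g\<in>G. \<phi> ` S = (\<lambda>h. conj_by P h g) ` S"
    then obtain g where "g \<in> G" "\<phi> ` S = (\<lambda>h. conj_by P h g) ` S" by blast
    then show "\<exists>g\<in>G. \<phi> ` S = cj g ` S" by (intro bexI[of _ "iv g"]) (simp_all add: conj_by_cj)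
  next
    assume "\<exists>g\<in>G. \<phi> ` S = cj g ` S"
    then obtain g where "g \<in> G" "\<phi> ` S = cj g ` S" by blast
    then show "\<exists>g\<in>G. \<phi> ` S = (\<lambda>h. conj_by P h g) ` S"
      by (intro bexI[of _ "iv g"]) (simp_all add: conj_by_cj)
  qed
  then show ?thesis by (simp add: St_conj_def)
qed

lemma auto_image_cj:
  assumes "\<phi> \<in> auto P" "g \<in> G" "S \<subseteq> G"
  shows "\<phi> ` cj g ` S = cj (\<phi> g) ` \<phi> ` S"
  unfolding image_image using assms by (intro image_cong) (auto simp only: auto_cj subset_eq)

lemma cj_image_cj:
  assumes "g \<in> G" "h \<in> G" "S \<subseteq> G"
  shows "cj g ` cj h ` S = cj (g \<cdot> h) ` S"
  unfolding image_image using assms by (intro image_cong) (auto simp only: cj_cj subset_eq)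

lemma cj_image_one:
  assumes "S \<subseteq> G"
  shows "cj \<one>\<^bsub>P\<^esub> ` S = S"
proof -
  have "cj \<one>\<^bsub>P\<^esub> ` S = (\<lambda>h. h) ` S" using assms by (intro image_cong) (simp_all only: cj_one subset_eq)
  then show ?thesis by simp
qed

lemma mult_A_image:
  assumes "\<phi> \<in> auto P" "\<psi> \<in> auto P" "S \<subseteq> G"
  shows "(\<phi> \<otimes>\<^bsub>A\<^esub> \<psi>) ` S = \<psi> ` \<phi> ` S"
  unfolding image_image using assms by (intro image_cong) (auto simp only: mult_A_apply subset_eq)

lemma A_inv_image:
  assumes "\<phi> \<in> auto P" "S \<subseteq> G"
  shows "(inv\<^bsub>A\<^esub> \<phi>) ` \<phi> ` S = S"
proof -
  have "(inv\<^bsub>A\<^esub> \<phi>) ` \<phi> ` S = (\<lambda>h. h) ` S"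
    unfolding image_image using assms by (intro image_cong) (auto simp only: A_inv_apply subset_eq)
  then show ?thesis by simp
qed

lemma one_A_image: "S \<subseteq> G \<Longrightarrow> \<one>\<^bsub>A\<^esub> ` S = S"
  by (auto simp: one_A image_iff)

lemma closed_sub_subset: "Y \<in> closed_sets \<Gamma> \<Longrightarrow> sub Y \<subseteq> G"
  using sub_subset closed_subset by blast

lemma St_conj_subgroup: "subgroup (St_conj \<Gamma>) A"
proof (rule agrp.subgroupI)
  show "St_conj \<Gamma> \<subseteq> carrier A" by (auto simp: St_conj_def)
  have "\<one>\<^bsub>A\<^esub> \<in> St_conj \<Gamma>"
    unfolding St_conj_iff
  proof (intro conjI ballI)
    show "\<one>\<^bsub>A\<^esub> \<in> auto P" using agrp.one_closed by simp
    show "\<exists>g\<in>G. \<one>\<^bsub>A\<^esub> ` sub Y = cj g ` sub Y" if "Y \<in> closed_sets \<Gamma>" for Y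
      using closed_sub_subset[OF that] by (intro bexI[of _ "\<one>\<^bsub>P\<^esub>"]) (simp_all add: one_A_image cj_image_one)
  qed
  then show "St_conj \<Gamma> \<noteq> {}" by blast
next
  fix \<phi> assume \<phi>: "\<phi> \<in> St_conj \<Gamma>"
  then have a: "\<phi> \<in> auto P" by (simp add: St_conj_iff)
  show "inv\<^bsub>A\<^esub> \<phi> \<in> St_conj \<Gamma>"
    unfolding St_conj_iff
  proof (intro conjI ballI)
    fix Y assume Y: "Y \<in> closed_sets \<Gamma>"
    let ?S = "sub Y" and ?\<beta> = "inv\<^bsub>A\<^esub> \<phi>"
    note S = closed_sub_subset[OF Y]
    obtain g where g: "g \<in> G" "\<phi> ` ?S = cj g ` ?S" using \<phi> Y unfolding St_conj_iff by blast
    have pS: "\<phi> ` ?S \<subseteq> G" using S a by auto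
    \<comment> \<open>Solve for \<open>?S\<close> and apply the inverse automorphism; the new
      conjugator is the image of \<open>iv g\<close>.\<close>
    have "?S = cj (iv g) ` \<phi> ` ?S" unfolding g(2) using g(1) S by (simp add: cj_image_cj cj_image_one)
    then have "?\<beta> ` ?S = ?\<beta> ` cj (iv g) ` \<phi> ` ?S" by simp
    also have "\<dots> = cj (?\<beta> (iv g)) ` ?S" using a g(1) S pS by (simp add: auto_image_cj A_inv_image)
    finally show "\<exists>g\<in>G. ?\<beta> ` ?S = cj g ` ?S" using a g(1) by (intro bexI[of _ "?\<beta> (iv g)"]) simp_all
  qed (use a in simp)
next
  fix \<phi> \<psi> assume \<phi>: "\<phi> \<in> St_conj \<Gamma>" and \<psi>: "\<psi> \<in> St_conj \<Gamma>"
  then have a: "\<phi> \<in> auto P" "\<psi> \<in> auto P" by (simp_all add: St_conj_iff)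
  show "\<phi> \<otimes>\<^bsub>A\<^esub> \<psi> \<in> St_conj \<Gamma>"
    unfolding St_conj_iff
  proof (intro conjI ballI)
    show "\<phi> \<otimes>\<^bsub>A\<^esub> \<psi> \<in> auto P" using a agrp.m_closed by simp
    fix Y assume Y: "Y \<in> closed_sets \<Gamma>"
    note S = closed_sub_subset[OF Y]
    obtain g where g: "g \<in> G" "\<phi> ` sub Y = cj g ` sub Y" using \<phi> Y unfolding St_conj_iff by blast
    obtain h where h: "h \<in> G" "\<psi> ` sub Y = cj h ` sub Y" using \<psi> Y unfolding St_conj_iff by blast
    have "(\<phi> \<otimes>\<^bsub>A\<^esub> \<psi>) ` sub Y = cj (\<psi> g \<cdot> h) ` sub Y"
      using a g h S by (simp add: mult_A_image auto_image_cj cj_image_cj)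
    then show "\<exists>g\<in>G. (\<phi> \<otimes>\<^bsub>A\<^esub> \<psi>) ` sub Y = cj g ` sub Y"
      using a g(1) h(1) by (intro bexI[of _ "\<psi> g \<cdot> h"]) simp_all
  qed
qed

lemma St_subset_St_conj: "St \<Gamma> \<subseteq> St_conj \<Gamma>"
proof
  fix \<phi> assume \<phi>: "\<phi> \<in> St \<Gamma>"
  have "\<exists>g\<in>G. \<phi> ` sub Y = cj g ` sub Y" if "Y \<in> closed_sets \<Gamma>" for Y
    using \<phi> that closed_sub_subset[OF that]
    by (intro bexI[of _ "\<one>\<^bsub>P\<^esub>"]) (simp_all add: St_def cj_image_one)
  then show "\<phi> \<in> St_conj \<Gamma>" using \<phi> by (simp add: St_conj_iff St_def)
qed

lemma St_subgroup: "subgroup (St \<Gamma>) A"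
proof (rule agrp.subgroupI)
  show "St \<Gamma> \<subseteq> carrier A" by (auto simp: St_def)
  have "\<one>\<^bsub>A\<^esub> \<in> St \<Gamma>"
    using agrp.one_closed closed_sub_subset by (simp add: St_def one_A_image)
  then show "St \<Gamma> \<noteq> {}" by blast
next
  fix \<phi> assume \<phi>: "\<phi> \<in> St \<Gamma>"
  then have a: "\<phi> \<in> auto P" by (simp add: St_def)
  have "(inv\<^bsub>A\<^esub> \<phi>) ` sub Y = sub Y" if "Y \<in> closed_sets \<Gamma>" for Y
    using A_inv_image[OF a closed_sub_subset[OF that]] \<phi> that by (simp add: St_def)
  then show "inv\<^bsub>A\<^esub> \<phi> \<in> St \<Gamma>" using a by (simp add: St_def)
next
  fix \<phi> \<psi> assume \<phi>: "\<phi> \<in> St \<Gamma>" and \<psi>: "\<psi> \<in> St \<Gamma>"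
  then have a: "\<phi> \<in> auto P" "\<psi> \<in> auto P" by (simp_all add: St_def)
  have "(\<phi> \<otimes>\<^bsub>A\<^esub> \<psi>) ` sub Y = sub Y" if "Y \<in> closed_sets \<Gamma>" for Y
    using mult_A_image[OF a closed_sub_subset[OF that]] \<phi> \<psi> that by (simp add: St_def)
  then show "\<phi> \<otimes>\<^bsub>A\<^esub> \<psi> \<in> St \<Gamma>" using a agrp.m_closed[of \<phi> \<psi>] by (simp add: St_def)
qed

text \<open>Otherwise every vertex in the orthogonal complement of \<open>Y\<close> is joined to two components of the
  complement of \<open>x\<^sup>\<bottom>\<close>, hence lies in \<open>x\<^sup>\<bottom>\<close>, and then \<open>x\<close> lies in the closure of \<open>Y\<close>.\<close>

lemma closed_set_component:
  assumes "x \<in> X" "C \<in> star_components \<Gamma> x" "Y \<in> closed_sets \<Gamma>" "x \<notin> Y" "y \<in> Y" "y \<in> C" "z \<in> Y" "z \<notin> C"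
  shows "sim x z"
proof (rule ccontr)
  assume ns: "\<not> sim x z"
  have Y: "Y \<subseteq> X" "Y = ortho \<Gamma> (ortho \<Gamma> Y)" using assms(3) by (auto simp: closed_sets_def graph_cl_def)
  have "ortho \<Gamma> Y \<subseteq> ortho \<Gamma> {x}"
  proof
    fix w assume w: "w \<in> ortho \<Gamma> Y"
    then have w': "w \<in> X" "sim w y" "sim w z" using ortho_eq[OF Y(1)] assms by auto
    show "w \<in> ortho \<Gamma> {x}"
    proof (rule ccontr)
      assume "w \<notin> ortho \<Gamma> {x}"
      then have "w \<in> C"
        using star_boundary[OF assms(1,2,6) sim_sym[OF w'(2)]] w'(1) by (auto simp: ortho_sing assms(1))
      then show False using star_boundary[OF assms(1,2) _ w'(3)] ns assms(8) by blast
    qed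
  qed
  then have "ortho \<Gamma> (ortho \<Gamma> {x}) \<subseteq> Y" using ortho_antimono Y(2) by blast
  then show False using subset_cl[of "{x}"] assms(1,4) by (auto simp: graph_cl_def)
qed

text \<open>If \<open>x \<in> Y\<close>, the automorphism preserves \<open>sub Y\<close>. Otherwise
  it acts on \<open>sub Y\<close> trivially when \<open>Y\<close> misses \<open>C\<close>, and else
  as conjugation by the inverse of \<open>gen x\<close>: by \<open>closed_set_component\<close> the
  vertices of \<open>Y\<close> outside \<open>C\<close> commute with \<open>x\<close>.\<close>

lemma elem_conj_in_St_conj:
  assumes x: "x \<in> X" and C: "C \<in> star_components \<Gamma> x"
  shows "elem_conj \<Gamma> C x \<in> St_conj \<Gamma>"
  unfolding St_conj_iff
proof (intro conjI ballI)
  let ?\<alpha> = "elem_conj \<Gamma> C x"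
  note a = elem_conj[OF assms]
  show "?\<alpha> \<in> auto P" by (rule a(1))
  fix Y assume Y: "Y \<in> closed_sets \<Gamma>"
  note YX = closed_subset[OF Y]
  note S = sub_subgroup[OF YX]
  show "\<exists>g\<in>G. ?\<alpha> ` sub Y = cj g ` sub Y"
  proof (cases "x \<in> Y")
    case True
    have cl: "cj k (gen y) \<in> sub Y" if "k \<in> sub Y" "y \<in> Y" for k y
      using that gen_in_sub subgroup.m_closed[OF S] subgroup.m_inv_closed[OF S] by (simp add: cj_def)
    have gx: "gen x \<in> sub Y" "iv (gen x) \<in> sub Y"
      using gen_in_sub[OF True] subgroup.m_inv_closed[OF S] by blast+
    have 1: "?\<alpha> ` sub Y \<subseteq> sub Y"
      by (rule hom_image_sub[OF YX S autoD(1)[OF a(1)]]) (use cl gx a(2) YX gen_in_sub in auto)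
    have 2: "(inv\<^bsub>A\<^esub> ?\<alpha>) ` sub Y \<subseteq> sub Y"
      by (rule hom_image_sub[OF YX S autoD(1)[OF A_inv_auto[OF a(1)]]])
        (use cl gx elem_conj_inv_gen[OF assms] YX gen_in_sub in auto)
    have "sub Y \<subseteq> ?\<alpha> ` sub Y"
    proof
      fix g assume g: "g \<in> sub Y"
      then have "g = ?\<alpha> ((inv\<^bsub>A\<^esub> ?\<alpha>) g)" using A_inv_apply(2)[OF a(1)] sub_closed[OF YX] by simp
      then show "g \<in> ?\<alpha> ` sub Y" using 2 g by blast
    qed
    then have "?\<alpha> ` sub Y = cj \<one>\<^bsub>P\<^esub> ` sub Y" using 1 cj_image_one[OF sub_subset[OF YX]] by simp
    then show ?thesis by blast
  next
    case False
    have "\<exists>k\<in>G. \<forall>y\<in>Y. ?\<alpha> (gen y) = cj k (gen y)"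
    proof (cases "Y \<inter> C = {}")
      case True
      then have "?\<alpha> (gen y) = cj \<one>\<^bsub>P\<^esub> (gen y)" if "y \<in> Y" for y
        using a(2) that YX by (auto simp only: cj_one gen_closed subset_eq disjoint_iff if_False)
      then show ?thesis by blast
    next
      case False
      then obtain y0 where y0: "y0 \<in> Y" "y0 \<in> C" by blast
      have "?\<alpha> (gen y) = cj (iv (gen x)) (gen y)" if y: "y \<in> Y" for y
      proof (cases "y \<in> C")
        case True
        then show ?thesis using a(2) y YX by auto
      next
        case nC: False
        have "sim x y" using closed_set_component[OF x C Y \<open>x \<notin> Y\<close> y0 y nC] .
        then have "cj (lt (x, False)) (gen y) = gen y"
          using y YX x by (intro cj_commute lt_gen_commute lt_closed gen_closed) auto
        then show ?thesis using a(2)[of y] y YX x nC by auto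
      qed
      then show ?thesis using x by (intro bexI[of _ "iv (gen x)"] ballI) simp_all
    qed
    then obtain k where k: "k \<in> G" "\<And>y. y \<in> Y \<Longrightarrow> ?\<alpha> (gen y) = cj k (gen y)" by blast
    have "?\<alpha> ` sub Y = cj k ` sub Y"
      using hom_eq_on_sub[OF YX autoD(1)[OF a(1)] cj_hom[OF k(1)] k(2)] by (intro image_cong refl)
    then show ?thesis using k(1) by blast
  qed
qed

section \<open>Automorphisms acting trivially on the abelianisation\<close>

definition IA :: "('a word set \<Rightarrow> 'a word set) set" where
  "IA = {\<phi> \<in> auto P. \<forall>h\<in>G. same_expo (\<phi> h) h}"

lemma id_hom: "(\<lambda>h. h) \<in> hom P P"
  by (simp add: hom_def)

text \<open>The inverse of \<open>\<psi>\<close> induces a map on exponent vectors, and applying it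
  to the assumed equality gives the claim.\<close>

lemma same_expo_A_inv:
  assumes "\<phi> \<in> auto P" "\<psi> \<in> auto P" "\<And>h. h \<in> G \<Longrightarrow> same_expo (\<phi> h) (\<psi> h)"
  shows "\<phi> \<otimes>\<^bsub>A\<^esub> inv\<^bsub>A\<^esub> \<psi> \<in> IA"
proof -
  have b: "inv\<^bsub>A\<^esub> \<psi> \<in> auto P" using assms(2) by simp
  have "same_expo ((\<phi> \<otimes>\<^bsub>A\<^esub> inv\<^bsub>A\<^esub> \<psi>) h) h" if h: "h \<in> G" for h
    using same_expo_hom[OF autoD(1)[OF b] _ _ assms(3)[OF h]] assms(1,2) b h
    by (simp add: mult_A_apply A_inv_apply)
  then show ?thesis using assms(1) b agrp.m_closed by (simp add: IA_def)
qed

lemma IA_subgroup: "subgroup IA A"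
proof (rule agrp.subgroupI)
  show "IA \<subseteq> carrier A" by (auto simp: IA_def)
  have "\<one>\<^bsub>A\<^esub> \<in> IA" using agrp.one_closed by (simp add: IA_def one_A same_expo_refl)
  then show "IA \<noteq> {}" by blast
  then show "inv\<^bsub>A\<^esub> \<phi> \<in> IA" if \<phi>: "\<phi> \<in> IA" for \<phi>
  proof -
    have a: "\<phi> \<in> auto P" using \<phi> by (simp add: IA_def)
    have "same_expo (\<one>\<^bsub>A\<^esub> h) (\<phi> h)" if "h \<in> G" for h
      using \<phi> that same_expo_sym by (simp add: IA_def one_A)
    then have "\<one>\<^bsub>A\<^esub> \<otimes>\<^bsub>A\<^esub> inv\<^bsub>A\<^esub> \<phi> \<in> IA" using agrp.one_closed by (intro same_expo_A_inv a) simp_all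
    then show ?thesis using a agrp.l_one[of "inv\<^bsub>A\<^esub> \<phi>"] by simp
  qed
  show "\<phi> \<otimes>\<^bsub>A\<^esub> \<psi> \<in> IA" if "\<phi> \<in> IA" "\<psi> \<in> IA" for \<phi> \<psi>
  proof -
    have a: "\<phi> \<in> auto P" "\<psi> \<in> auto P" using that by (simp_all add: IA_def)
    have "same_expo ((\<phi> \<otimes>\<^bsub>A\<^esub> \<psi>) h) h" if "h \<in> G" for h
      using \<open>\<phi> \<in> IA\<close> \<open>\<psi> \<in> IA\<close> a that same_expo_trans[of "\<psi> (\<phi> h)" "\<phi> h" h]
      by (simp add: IA_def mult_A_apply)
    then show ?thesis using a agrp.m_closed[of \<phi> \<psi>] by (simp add: IA_def)
  qed
qed

lemma elem_conj_in_IA: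
  assumes "x \<in> X" "C \<in> star_components \<Gamma> x"
  shows "elem_conj \<Gamma> C x \<in> IA"
proof -
  note a = elem_conj[OF assms]
  have "same_expo (elem_conj \<Gamma> C x h) h" if "h \<in> G" for h
  proof (rule same_expo_homI[OF autoD(1)[OF a(1)] id_hom _ that])
    show "same_expo (elem_conj \<Gamma> C x (gen y)) (gen y)" if "y \<in> X" for y
      using a(2)[OF that] that assms(1) by (simp add: same_expo_cj same_expo_refl)
  qed
  then show ?thesis using a(1) by (simp add: IA_def)
qed

text \<open>On the closed clique generated by \<open>x\<close> and \<open>y\<close>,
  \<open>\<phi>\<close> sends each of the two generators to \<open>cj g s\<close> with the same
  \<open>g\<close>. Exponents are preserved, and inside a clique they force \<open>s\<close> to be
  that generator.\<close>

lemma IA_St_conj_conjugating: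
  assumes "\<phi> \<in> St_conj \<Gamma>" "\<phi> \<in> IA"
  shows "conjugating \<phi>"
  unfolding conjugating_def
proof (intro conjI ballI impI)
  show a: "\<phi> \<in> auto P" using assms(1) by (simp add: St_conj_iff)
  fix x y assume xy: "x \<in> X" "y \<in> X" "sim x y"
  let ?Y = "graph_cl \<Gamma> {x, y}"
  have c: "clique ?Y" "?Y \<in> closed_sets \<Gamma>" "{x, y} \<subseteq> ?Y"
    using clique_cl clique_pair[OF xy] cl_closed[of "{x, y}"] subset_cl[of "{x, y}"] xy by simp_all
  note S = closed_sub_subset[OF c(2)]
  obtain g where g: "g \<in> G" "\<phi> ` sub ?Y = cj g ` sub ?Y" using assms(1) c(2) unfolding St_conj_iff by blast
  have "\<phi> (gen z) = cj g (gen z)" if z: "z \<in> {x, y}" for z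
  proof -
    have zX: "z \<in> X" and zs: "gen z \<in> sub ?Y" using z xy c(3) gen_in_sub by blast+
    then obtain s where s: "s \<in> sub ?Y" "\<phi> (gen z) = cj g s" using g(2) by blast
    have sG: "s \<in> G" using s(1) S by blast
    have "same_expo s (cj g s)" "same_expo (\<phi> (gen z)) (gen z)"
      using same_expo_sym same_expo_cj[OF g(1) sG] assms(2) zX by (auto simp only: IA_def mem_Collect_eq gen_closed)
    then have "same_expo s (gen z)" using s(2) same_expo_trans by simp
    then have "s = gen z" using clique_same_expo_eq[OF c(1) s(1) zs] by blast
    then show ?thesis using s(2) by simp
  qed
  then show "\<exists>g\<in>G. \<phi> (gen x) = cj g (gen x) \<and> \<phi> (gen y) = cj g (gen y)" using g(1) by blast
qed

text \<open>A description without generators. One inclusion is checked on the elementary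
  automorphisms, the other is Laurence's theorem.\<close>

lemma Conj_eq: "Conj \<Gamma> = St_conj \<Gamma> \<inter> IA"
proof
  show "Conj \<Gamma> \<subseteq> St_conj \<Gamma> \<inter> IA"
    unfolding Conj_def
  proof (rule agrp.generate_subgroup_incl)
    show "subgroup (St_conj \<Gamma> \<inter> IA) A"
      using St_conj_subgroup IA_subgroup by (rule agrp.subgroups_Inter_pair)
  qed (use elem_conj_in_St_conj elem_conj_in_IA in blast)
  show "St_conj \<Gamma> \<inter> IA \<subseteq> Conj \<Gamma>"
    using IA_St_conj_conjugating conjugating_in_Conj shortest_conjugators_exist by blast
qed

lemma St_inter_IA: "St \<Gamma> \<inter> IA = {\<one>\<^bsub>A\<^esub>}"
proof
  show "{\<one>\<^bsub>A\<^esub>} \<subseteq> St \<Gamma> \<inter> IA"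
    using subgroup.one_closed[OF St_subgroup] subgroup.one_closed[OF IA_subgroup] by simp
  show "St \<Gamma> \<inter> IA \<subseteq> {\<one>\<^bsub>A\<^esub>}"
  proof
    fix \<phi> assume \<phi>: "\<phi> \<in> St \<Gamma> \<inter> IA"
    then have a: "\<phi> \<in> auto P" by (simp add: St_def)
    have "\<phi> = \<one>\<^bsub>A\<^esub>"
    proof (rule auto_eqI[OF a])
      show "\<one>\<^bsub>A\<^esub> \<in> auto P" using agrp.one_closed by simp
      fix x assume x: "x \<in> X"
      note s = gen_in_sub_cl[OF x]
      have "\<phi> ` sub (graph_cl \<Gamma> {x}) = sub (graph_cl \<Gamma> {x})"
        using \<phi> cl_closed[of "{x}"] x by (simp add: St_def)
      then have "\<phi> (gen x) \<in> sub (graph_cl \<Gamma> {x})" using s by blast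
      moreover have "same_expo (\<phi> (gen x)) (gen x)" using \<phi> x by (simp add: IA_def)
      ultimately have "\<phi> (gen x) = gen x" using clique_same_expo_eq[OF clique_cl_sing[OF x]] s by blast
      then show "\<phi> (gen x) = \<one>\<^bsub>A\<^esub> (gen x)" using x by (simp add: one_A)
    qed
    then show "\<phi> \<in> {\<one>\<^bsub>A\<^esub>}" by simp
  qed
qed

text \<open>Undoing the conjugation separately on every \<open>G(cl x)\<close> yields an endomorphism, since the
  subgroups \<open>G(cl x)\<close> and \<open>G(cl y)\<close> commute elementwise for adjacent \<open>x\<close> and \<open>y\<close>.\<close>

lemma St_conj_straighten:
  assumes \<phi>: "\<phi> \<in> St_conj \<Gamma>"
  obtains h where "h \<in> hom P P" "h \<in> extensional G" "\<And>x. x \<in> X \<Longrightarrow> h (gen x) \<in> sub (graph_cl \<Gamma> {x})"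
    "\<And>g. g \<in> G \<Longrightarrow> same_expo (h g) (\<phi> g)"
proof -
  have a: "\<phi> \<in> auto P" using \<phi> by (simp add: St_conj_iff)
  have "\<exists>s. s \<in> sub (graph_cl \<Gamma> {x}) \<and> same_expo s (\<phi> (gen x))" if x: "x \<in> X" for x
  proof -
    have c: "graph_cl \<Gamma> {x} \<in> closed_sets \<Gamma>" using cl_closed[of "{x}"] x by simp
    obtain g where g: "g \<in> G" "\<phi> ` sub (graph_cl \<Gamma> {x}) = cj g ` sub (graph_cl \<Gamma> {x})"
      using \<phi> c unfolding St_conj_iff by blast
    then obtain s where s: "s \<in> sub (graph_cl \<Gamma> {x})" "\<phi> (gen x) = cj g s"
      using gen_in_sub_cl[OF x] by blast
    then have "same_expo s (\<phi> (gen x))"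
      using same_expo_sym[OF same_expo_cj[OF g(1), of s]] closed_sub_subset[OF c] by (simp add: subset_eq)
    then show ?thesis using s(1) by blast
  qed
  then obtain f where f: "\<And>x. x \<in> X \<Longrightarrow> f x \<in> sub (graph_cl \<Gamma> {x})"
      "\<And>x. x \<in> X \<Longrightarrow> same_expo (f x) (\<phi> (gen x))"
    by metis
  have fG: "f x \<in> G" if "x \<in> X" for x using f(1)[OF that] sub_closed[OF cl_subset] by blast
  have comm: "f x \<cdot> f y = f y \<cdot> f x" if xy: "adj x y" "x \<in> X" "y \<in> X" for x y
  proof -
    \<comment> \<open>Elementwise commutation is extended in two stages: first from generators to
      \<open>f y\<close>, then from generators to \<open>f x\<close>.\<close>
    have 1: "gen u \<cdot> f y = f y \<cdot> gen u" if u: "u \<in> graph_cl \<Gamma> {x}" for u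
    proof (rule sub_commute[OF _ cl_subset _ f(1)[OF xy(3)]])
      show "gen u \<in> G" using u cl_subset[of "{x}"] by (intro gen_closed) blast
      show "gen u \<cdot> gen w = gen w \<cdot> gen u" if "w \<in> graph_cl \<Gamma> {y}" for w
        using gen_commute cl_sim[OF xy(2,3) _ u that] xy(1) by (simp add: sim_def)
    qed
    have "f y \<cdot> f x = f x \<cdot> f y"
      by (rule sub_commute[OF fG[OF xy(3)] cl_subset _ f(1)[OF xy(2)]]) (rule 1[symmetric])
    then show ?thesis by simp
  qed
  obtain h where h: "h \<in> hom P P" "h \<in> extensional G" "\<And>x. x \<in> X \<Longrightarrow> h (gen x) = f x"
    by (rule pc_hom_exists[of P f \<Gamma>])
      (rule grp.is_group, rule Pi_I, erule fG, erule comm, assumption+, rule that)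
  have "same_expo (h g) (\<phi> g)" if "g \<in> G" for g
    by (rule same_expo_homI[OF h(1) autoD(1)[OF a] _ that]) (simp add: h(3) f(2))
  then show ?thesis using that h f(1) by simp
qed

text \<open>The element \<open>k (h (gen x))\<close> lies in the subgroup of the clique
  \<open>graph_cl \<Gamma> {x}\<close> and has the exponents of
  \<open>\<psi> (\<phi> (gen x))\<close>, that is of \<open>gen x\<close>; the two are therefore
  equal.\<close>

lemma straighten_inverse:
  assumes h: "h \<in> hom P P" "\<And>x. x \<in> X \<Longrightarrow> h (gen x) \<in> sub (graph_cl \<Gamma> {x})"
      "\<And>g. g \<in> G \<Longrightarrow> same_expo (h g) (\<phi> g)"
    and k: "k \<in> hom P P" "\<And>Y. Y \<in> closed_sets \<Gamma> \<Longrightarrow> k ` sub Y \<subseteq> sub Y"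
      "\<And>g. g \<in> G \<Longrightarrow> same_expo (k g) (\<psi> g)"
    and \<phi>: "\<phi> \<in> auto P" "\<psi> \<in> auto P" "\<And>g. g \<in> G \<Longrightarrow> \<psi> (\<phi> g) = g" and g: "g \<in> G"
  shows "k (h g) = g"
proof -
  have "(k \<circ> h) g = (\<lambda>g. g) g"
  proof (rule hom_eqI[OF grp.is_group hom_compose[OF h(1) k(1)] id_hom _ g])
    fix x assume x: "x \<in> X"
    let ?Y = "graph_cl \<Gamma> {x}"
    have Y: "?Y \<in> closed_sets \<Gamma>" using cl_closed[of "{x}"] x by simp
    have hG: "h (gen x) \<in> G" using h(2)[OF x] closed_sub_subset[OF Y] by blast
    have "same_expo (\<psi> (h (gen x))) (gen x)"
      using same_expo_hom[OF autoD(1)[OF \<phi>(2)] hG _ h(3)] x \<phi>(1,3) by simp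
    then have "same_expo (k (h (gen x))) (gen x)" using same_expo_trans[OF k(3)[OF hG]] by blast
    moreover have "k (h (gen x)) \<in> sub ?Y" using h(2)[OF x] k(2)[OF Y] by blast
    ultimately show "(k \<circ> h) (gen x) = gen x"
      using clique_same_expo_eq[OF clique_cl_sing[OF x] _ gen_in_sub_cl[OF x]] by simp
  qed
  then show ?thesis by simp
qed

text \<open>Straightening \<open>\<phi>\<close> and its inverse gives two endomorphisms that are
  mutually inverse by \<open>straighten_inverse\<close>, so the first is an automorphism in
  \<open>St\<close>.\<close>

lemma St_conj_same_expo_St:
  assumes \<phi>: "\<phi> \<in> St_conj \<Gamma>"
  shows "\<exists>\<psi>\<in>St \<Gamma>. \<forall>g\<in>G. same_expo (\<phi> g) (\<psi> g)"
proof -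
  have a: "\<phi> \<in> auto P" using \<phi> by (simp add: St_conj_iff)
  have \<phi>': "inv\<^bsub>A\<^esub> \<phi> \<in> St_conj \<Gamma>" using subgroup.m_inv_closed[OF St_conj_subgroup \<phi>] .
  obtain h where h: "h \<in> hom P P" "h \<in> extensional G" "\<And>x. x \<in> X \<Longrightarrow> h (gen x) \<in> sub (graph_cl \<Gamma> {x})"
    "\<And>g. g \<in> G \<Longrightarrow> same_expo (h g) (\<phi> g)"
    by (rule St_conj_straighten[OF \<phi>], rule that)
  obtain k where k: "k \<in> hom P P" "k \<in> extensional G" "\<And>x. x \<in> X \<Longrightarrow> k (gen x) \<in> sub (graph_cl \<Gamma> {x})"
    "\<And>g. g \<in> G \<Longrightarrow> same_expo (k g) ((inv\<^bsub>A\<^esub> \<phi>) g)"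
    by (rule St_conj_straighten[OF \<phi>'], rule that)
  \<comment> \<open>A closed set contains the closure of each of its vertices, so control on every
    \<open>graph_cl \<Gamma> {x}\<close> suffices for all closed sets.\<close>
  have stable: "f ` sub Y \<subseteq> sub Y"
    if f: "f \<in> hom P P" "\<And>x. x \<in> X \<Longrightarrow> f (gen x) \<in> sub (graph_cl \<Gamma> {x})" and Y: "Y \<in> closed_sets \<Gamma>" for f Y
  proof (rule hom_image_sub[OF closed_subset[OF Y] sub_subgroup[OF closed_subset[OF Y]] f(1)])
    fix y assume y: "y \<in> Y"
    then have "graph_cl \<Gamma> {y} \<subseteq> Y" using cl_least[OF Y] by simp
    then show "f (gen y) \<in> sub Y" using f(2)[of y] y closed_subset[OF Y] sub_mono by blast
  qed
  have sh: "h ` sub Y \<subseteq> sub Y" and sk: "k ` sub Y \<subseteq> sub Y" if "Y \<in> closed_sets \<Gamma>" for Y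
    using stable[OF h(1) h(3) that] stable[OF k(1) k(3) that] by blast+
  have kh: "k (h g) = g" if "g \<in> G" for g
    by (rule straighten_inverse[of h \<phi> k "inv\<^bsub>A\<^esub> \<phi>"])
      (fact h k sk a A_inv_auto[OF a] A_inv_apply(1)[OF a] that)+
  have hk: "h (k g) = g" if "g \<in> G" for g
    by (rule straighten_inverse[of k "inv\<^bsub>A\<^esub> \<phi>" h \<phi>])
      (fact h k sh a A_inv_auto[OF a] A_inv_apply(2)[OF a] that)+
  have "bij_betw h G G"
    by (rule bij_betwI[where g = k]) (use h(1) k(1) kh hk in \<open>auto simp: hom_def\<close>)
  then have ha: "h \<in> auto P" using h by (intro autoI)
  have "h ` sub Y = sub Y" if Y: "Y \<in> closed_sets \<Gamma>" for Y
  proof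
    show "sub Y \<subseteq> h ` sub Y"
    proof
      fix g assume g: "g \<in> sub Y"
      then have "g = h (k g)" using hk closed_sub_subset[OF Y] by (simp add: subset_eq)
      then show "g \<in> h ` sub Y" using sk[OF Y] g by blast
    qed
  qed (rule sh[OF Y])
  then have "h \<in> St \<Gamma>" using ha by (simp add: St_def)
  then show ?thesis using h(4) same_expo_sym by blast
qed

section \<open>The semidirect product decomposition\<close>

lemma St_conj_eq: "St_conj \<Gamma> = Conj \<Gamma> <#>\<^bsub>A\<^esub> St \<Gamma>"
proof
  show "St_conj \<Gamma> \<subseteq> Conj \<Gamma> <#>\<^bsub>A\<^esub> St \<Gamma>"
  proof
    fix \<phi> assume \<phi>: "\<phi> \<in> St_conj \<Gamma>"
    then obtain \<psi> where \<psi>: "\<psi> \<in> St \<Gamma>" "\<And>g. g \<in> G \<Longrightarrow> same_expo (\<phi> g) (\<psi> g)"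
      using St_conj_same_expo_St by blast
    have a: "\<phi> \<in> auto P" "\<psi> \<in> auto P" using \<phi> \<psi>(1) by (simp_all add: St_conj_iff St_def)
    \<comment> \<open>The quotient of \<open>\<phi>\<close> by an element of \<open>St\<close> with
      the same action on the abelianisation lies in \<open>St_conj\<close> and in \<open>IA\<close>,
      hence in \<open>Conj\<close>.\<close>
    have "\<phi> \<otimes>\<^bsub>A\<^esub> inv\<^bsub>A\<^esub> \<psi> \<in> St_conj \<Gamma>"
      using \<phi> \<psi>(1) St_subset_St_conj subgroup.m_closed[OF St_conj_subgroup]
        subgroup.m_inv_closed[OF St_conj_subgroup] by blast
    then have "\<phi> \<otimes>\<^bsub>A\<^esub> inv\<^bsub>A\<^esub> \<psi> \<in> Conj \<Gamma>" using same_expo_A_inv[OF a \<psi>(2)] Conj_eq by blast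
    moreover have "\<phi> = (\<phi> \<otimes>\<^bsub>A\<^esub> inv\<^bsub>A\<^esub> \<psi>) \<otimes>\<^bsub>A\<^esub> \<psi>" using a by (simp add: agrp.m_assoc)
    ultimately show "\<phi> \<in> Conj \<Gamma> <#>\<^bsub>A\<^esub> St \<Gamma>" using \<psi>(1) unfolding set_mult_def by blast
  qed
  show "Conj \<Gamma> <#>\<^bsub>A\<^esub> St \<Gamma> \<subseteq> St_conj \<Gamma>"
    using Conj_eq St_subset_St_conj subgroup.m_closed[OF St_conj_subgroup] unfolding set_mult_def by blast
qed

text \<open>Since \<open>\<alpha>\<close> acts trivially on the abelianisation,
  \<open>\<phi>\<close> and its product with \<open>\<alpha>\<close> act there alike.\<close>

lemma IA_normal:
  assumes "\<phi> \<in> auto P" "\<alpha> \<in> IA"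
  shows "\<phi> \<otimes>\<^bsub>A\<^esub> \<alpha> \<otimes>\<^bsub>A\<^esub> inv\<^bsub>A\<^esub> \<phi> \<in> IA"
proof (rule same_expo_A_inv)
  have a: "\<alpha> \<in> auto P" using assms(2) by (simp add: IA_def)
  then show "\<phi> \<otimes>\<^bsub>A\<^esub> \<alpha> \<in> auto P" using assms(1) agrp.m_closed by simp
  show "same_expo ((\<phi> \<otimes>\<^bsub>A\<^esub> \<alpha>) h) (\<phi> h)" if "h \<in> G" for h
    using assms a that by (simp add: IA_def mult_A_apply)
qed (rule assms(1))

lemma Conj_normal: "Conj \<Gamma> \<lhd> A\<lparr>carrier := St_conj \<Gamma>\<rparr>"
proof -
  interpret S: group "A\<lparr>carrier := St_conj \<Gamma>\<rparr>"
    by (rule agrp.subgroup_imp_group[OF St_conj_subgroup])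
  show ?thesis
    unfolding S.normal_inv_iff
  proof (intro conjI ballI)
    show "subgroup (Conj \<Gamma>) (A\<lparr>carrier := St_conj \<Gamma>\<rparr>)"
      by (rule agrp.subgroup_incl[OF Conj_subgroup St_conj_subgroup]) (use Conj_eq in blast)
    fix \<phi> \<alpha> assume "\<phi> \<in> carrier (A\<lparr>carrier := St_conj \<Gamma>\<rparr>)" and \<alpha>: "\<alpha> \<in> Conj \<Gamma>"
    then have \<phi>: "\<phi> \<in> St_conj \<Gamma>" by simp
    have \<alpha>': "\<alpha> \<in> St_conj \<Gamma>" "\<alpha> \<in> IA" using \<alpha> Conj_eq by blast+
    have "\<phi> \<in> auto P" using \<phi> by (simp add: St_conj_iff)
    then have "\<phi> \<otimes>\<^bsub>A\<^esub> \<alpha> \<otimes>\<^bsub>A\<^esub> inv\<^bsub>A\<^esub> \<phi> \<in> IA" using IA_normal \<alpha>'(2) by blast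
    moreover have "\<phi> \<otimes>\<^bsub>A\<^esub> \<alpha> \<otimes>\<^bsub>A\<^esub> inv\<^bsub>A\<^esub> \<phi> \<in> St_conj \<Gamma>"
      using \<phi> \<alpha>'(1) subgroup.m_closed[OF St_conj_subgroup] subgroup.m_inv_closed[OF St_conj_subgroup] by blast
    ultimately show "\<phi> \<otimes>\<^bsub>A\<lparr>carrier := St_conj \<Gamma>\<rparr>\<^esub> \<alpha> \<otimes>\<^bsub>A\<lparr>carrier := St_conj \<Gamma>\<rparr>\<^esub>
        inv\<^bsub>A\<lparr>carrier := St_conj \<Gamma>\<rparr>\<^esub> \<phi> \<in> Conj \<Gamma>"
      using agrp.m_inv_consistent[OF St_conj_subgroup \<phi>] Conj_eq by simp
  qed
qed

end

theorem theorem2p20: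
  fixes \<Gamma> :: "'a pair_pre_digraph"
  assumes "pair_graph \<Gamma>"
  shows "Conj \<Gamma> \<lhd> (right_AutoGroup (pc_group \<Gamma>))\<lparr>carrier := St_conj \<Gamma>\<rparr>
    \<and> subgroup (St \<Gamma>) ((right_AutoGroup (pc_group \<Gamma>))\<lparr>carrier := St_conj \<Gamma>\<rparr>)
    \<and> Conj \<Gamma> \<inter> St \<Gamma> = {\<one>\<^bsub>right_AutoGroup (pc_group \<Gamma>)\<^esub>}
    \<and> St_conj \<Gamma> = Conj \<Gamma> <#>\<^bsub>right_AutoGroup (pc_group \<Gamma>)\<^esub> St \<Gamma>"
proof -
  interpret raag \<Gamma> by (rule raag.intro[OF assms])
  have "Conj \<Gamma> \<inter> St \<Gamma> = St \<Gamma> \<inter> IA" using Conj_eq St_subset_St_conj by blast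
  moreover have "subgroup (St \<Gamma>) (A\<lparr>carrier := St_conj \<Gamma>\<rparr>)"
    by (rule agrp.subgroup_incl[OF St_subgroup St_conj_subgroup St_subset_St_conj])
  ultimately show ?thesis using Conj_normal St_inter_IA St_conj_eq by simp
qed

end
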